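(* Let $D<0$ be a discriminant, let $d$ be a fundamental discriminant (with $d=1$ allowed) such that $D=dd'$ with $d'$ a discriminant, and let $m\geq 1$ be an integer. Let $\delta\in(0,\tfrac14]$ and let $\ell(\delta)$ be a constant such that $\tau(c)\leq \ell(\delta)c^{\delta}$ for all $c\in\mathbb{N}$. Then \[ \left| \operatorname{Tr}_d j_m(z_D)+24\delta_d\sigma_1(m)h(D)-\sum_{z_Q\in\mathcal{R}(\frac1m)}\chi_d(Q)e(-mz_Q)\right| \leq |D|^{\frac{13}{12}+\frac\delta2} m^{\frac76+\delta} \tau(D) \tau(m)\,\zeta^2(1+\delta)\,\ell(\delta)\log(2m|D|^{\frac12})\, |\log \delta|\cdot C, \] where $C=8.5\times 10^6$ if $d<0$ and $C=2\times 10^6\, m$ if $d>0$.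
   Context: $e(x)=e^{2\pi i x}$. A discriminant is an integer $\equiv 0,1 \pmod 4$; $d=1$ counts as a fundamental discriminant. $\tau(n)$ is the number of positive divisors of $|n|$, $\sigma_1(m)=\sum_{k\mid m}k$, $\zeta$ is the Riemann zeta function, and $\delta_d=1$ if $d=1$, $\delta_d=0$ otherwise. For a positive definite integral binary quadratic form $Q=[a,b,c]=ax^2+bxy+cy^2$ of discriminant $D=b^2-4ac$, put $z_Q=\frac{-b+i\sqrt{|D|}}{2a}\in\mathbb{H}$. The genus character is $\chi_d(Q)=\left(\frac dn\right)$ (Kronecker symbol) if $\gcd(a,b,c,d)=1$, where $n$ is any integer represented by $Q$ with $\gcd(d,n)=1$, and $\chi_d(Q)=0$ if $\gcd(a,b,c,d)>1$. $j_m$ is the unique polynomial in the modular $j$-function with $j_m(z)=q^{-m}+O(q)$, $q=e^{2\pi i z}$. With $\mathcal F=\{z\in\mathbb H:-\frac12\le \operatorname{Re} z\le 0,\ |z|\ge1\}\cup\{z\in\mathbb H: 0<\operatorname{Re} z<\frac12,\ |z|>1\}$, define $\operatorname{Tr}_d j_m(z_D)=\sum_{Q}\chi_d(Q)\omega_Q^{-1}j_m(z_Q)$, the sum over all positive definite integral binary quadratic forms $Q$ of discriminant $D$ with $z_Q\in\mathcal F$, where $\omega_Q=2$ (resp. $3$) if $Q$ is ${\rm PSL}_2(\mathbb Z)$-equivalent to $[a,0,a]$ (resp. $[a,a,a]$) and $\omega_Q=1$ otherwise. $h(D)$ denotes the class number of discriminant $D$ (number of ${\rm PSL}_2(\mathbb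 Z)$-classes of positive definite forms of discriminant $D$, counted with weight $\omega_Q^{-1}$ as in the trace). $\mathcal R(Y)=\{z=x+iy\in\mathbb H: -\frac12\le x<\frac12,\ y>Y\}$, and $\sum_{z_Q\in\mathcal R(Y)}$ runs over all positive definite integral binary quadratic forms $Q$ of discriminant $D$ with $z_Q\in\mathcal R(Y)$. *)

theory Defs
  imports
    "HOL-Complex_Analysis.Complex_Analysis"
    "HOL-Number_Theory.Number_Theory"
    "HOL-Computational_Algebra.Squarefree"
    "HOL-Library.Landau_Symbols"
begin

section \<open>Arithmetic functions\<close>

definition e :: "complex \<Rightarrow> complex" where
  "e x = exp (2 * of_real pi * \<i> * x)"

definition divisor_sigma :: "nat \<Rightarrow> nat \<Rightarrow> nat" where
  "divisor_sigma k n = (\<Sum>t | t dvd n. t ^ k)"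

definition tau :: "int \<Rightarrow> nat" where
  "tau n = card {k::nat. int k dvd n}"

text \<open>The Riemann zeta function at real arguments \<open>s > 1\<close>; the definition is not meant for other \<open>s\<close>.\<close>

definition zeta :: "real \<Rightarrow> real" where
  "zeta s = (\<Sum>n. 1 / real (Suc n) powr s)"

definition is_discriminant :: "int \<Rightarrow> bool" where
  "is_discriminant D \<longleftrightarrow> D mod 4 = 0 \<or> D mod 4 = 1"

text \<open>One, or the discriminant of a quadratic field; the first disjunct includes \<open>d = 1\<close>.\<close>

definition fundamental_discriminant :: "int \<Rightarrow> bool" where
  "fundamental_discriminant d \<longleftrightarrow>
     (d mod 4 = 1 \<and> squarefree d) \<or>
     (\<exists>k. d = 4 * k \<and> (k mod 4 = 2 \<or> k mod 4 = 3) \<and> squarefree k)"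

definition kronecker_prime :: "int \<Rightarrow> int \<Rightarrow> int" where
  "kronecker_prime a p =
     (if p = 2 then (if even a then 0 else if a mod 8 = 1 \<or> a mod 8 = 7 then 1 else -1)
      else Legendre a p)"

definition kronecker :: "int \<Rightarrow> int \<Rightarrow> int" where
  "kronecker a n =
     (if n = 0 then (if \<bar>a\<bar> = 1 then 1 else 0)
      else (if n < 0 \<and> a < 0 then -1 else 1) *
           (\<Prod>p\<in>prime_factors n. kronecker_prime a p ^ multiplicity p n))"


section \<open>Binary quadratic forms\<close>

text \<open>The triple \<open>(a, b, c)\<close> stands for \<open>[a, b, c] = a x\<^sup>2 + b x y + c y\<^sup>2\<close>.\<close>

type_synonym bqf = "int \<times> int \<times> int"

fun bqf_eval :: "bqf \<Rightarrow> 'a::comm_ring_1 \<Rightarrow> 'a \<Rightarrow> 'a" where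
  "bqf_eval (a, b, c) x y = of_int a * x\<^sup>2 + of_int b * x * y + of_int c * y\<^sup>2"

fun bqf_disc :: "bqf \<Rightarrow> int" where
  "bqf_disc (a, b, c) = b\<^sup>2 - 4 * a * c"

definition bqf_pos_def :: "bqf \<Rightarrow> bool" where
  "bqf_pos_def Q \<longleftrightarrow> (\<forall>x y::real. (x, y) \<noteq> (0, 0) \<longrightarrow> bqf_eval Q x y > 0)"

definition bqfs :: "int \<Rightarrow> bqf set" where
  "bqfs D = {Q. bqf_pos_def Q \<and> bqf_disc Q = D}"

text \<open>Equivalence under \<open>SL\<^sub>2(\<int>)\<close>; since \<open>-I\<close> acts trivially, this is equivalence under \<open>PSL\<^sub>2(\<int>)\<close>.\<close>

definition bqf_equiv :: "bqf \<Rightarrow> bqf \<Rightarrow> bool" where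
  "bqf_equiv Q Q' \<longleftrightarrow>
     (\<exists>p q r s::int. p * s - q * r = 1 \<and>
        (\<forall>x y::int. bqf_eval Q' x y = bqf_eval Q (p * x + q * y) (r * x + s * y)))"

definition bqf_weight :: "bqf \<Rightarrow> nat" where
  "bqf_weight Q =
     (if \<exists>a. bqf_equiv Q (a, 0, a) then 2
      else if \<exists>a. bqf_equiv Q (a, a, a) then 3 else 1)"

definition bqf_classes :: "int \<Rightarrow> bqf set set" where
  "bqf_classes D = bqfs D // {(Q, Q'). Q \<in> bqfs D \<and> Q' \<in> bqfs D \<and> bqf_equiv Q Q'}"

text \<open>The weighted class number; imprimitive forms are included, and the weight depends only on
  the class, so any representative may be used.\<close>

definition class_number :: "int \<Rightarrow> real" where
  "class_number D = (\<Sum>K\<in>bqf_classes D. 1 / real (bqf_weight (SOME Q. Q \<in> K)))"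

fun bqf_root :: "bqf \<Rightarrow> complex" where
  "bqf_root (a, b, c) =
     (- of_int b + \<i> * of_real (sqrt (real_of_int \<bar>bqf_disc (a, b, c)\<bar>))) / (2 * of_int a)"

text \<open>For the forms at issue the value does not depend on the represented integer \<open>n\<close> chosen.\<close>

fun genus_character :: "int \<Rightarrow> bqf \<Rightarrow> int" where
  "genus_character d (a, b, c) =
     (if Gcd {a, b, c, d} = 1
      then kronecker d (SOME n. coprime d n \<and> (\<exists>x y::int. n = bqf_eval (a, b, c) x y))
      else 0)"


section \<open>The functions \<open>j\<^sub>m\<close> and their traces\<close>

definition E4 :: "complex \<Rightarrow> complex" where
  "E4 z = 1 + 240 * (\<Sum>n. of_nat (divisor_sigma 3 (Suc n)) * e (of_nat (Suc n) * z))"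

definition E6 :: "complex \<Rightarrow> complex" where
  "E6 z = 1 - 504 * (\<Sum>n. of_nat (divisor_sigma 5 (Suc n)) * e (of_nat (Suc n) * z))"

definition klein_j :: "complex \<Rightarrow> complex" where
  "klein_j z = 1728 * E4 z ^ 3 / (E4 z ^ 3 - E6 z ^ 2)"

text \<open>\<open>j_poly m\<close> is the polynomial \<open>P\<close> with \<open>P(j(z)) = q\<^sup>-\<^sup>m + O(q)\<close> as \<open>Im z \<rightarrow> \<infinity>\<close>, where \<open>q = e z\<close>.\<close>

definition j_poly :: "nat \<Rightarrow> complex poly" where
  "j_poly m = (THE P. (\<lambda>z. poly P (klein_j z) - e (- of_nat m * z)) \<in> O[filtercomap Im at_top](e))"

definition jm :: "nat \<Rightarrow> complex \<Rightarrow> complex" where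
  "jm m z = poly (j_poly m) (klein_j z)"

definition fund_domain :: "complex set" where
  "fund_domain =
     {z. Im z > 0 \<and> -1/2 \<le> Re z \<and> Re z \<le> 0 \<and> cmod z \<ge> 1} \<union>
     {z. Im z > 0 \<and> 0 < Re z \<and> Re z < 1/2 \<and> cmod z > 1}"

definition strip_above :: "real \<Rightarrow> complex set" where
  "strip_above Y = {z. Im z > 0 \<and> -1/2 \<le> Re z \<and> Re z < 1/2 \<and> Im z > Y}"

definition trace_jm :: "int \<Rightarrow> nat \<Rightarrow> int \<Rightarrow> complex" where
  "trace_jm d m D =
     (\<Sum>Q | Q \<in> bqfs D \<and> bqf_root Q \<in> fund_domain.
        of_int (genus_character d Q) / of_nat (bqf_weight Q) * jm m (bqf_root Q))"

end

theory Submission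
  imports Defs
begin

text \<open>
  No Kloosterman sums are needed, because only the size of the error matters. Let \<open>\<Gamma>\<close> be the modular
  group and \<open>\<Gamma>\<^sub>\<infinity>\<close> the stabiliser of the cusp. On the fundamental domain \<open>j - 744 = e(-z) + O(1)\<close> with
  an explicit constant. Hence, for every \<open>z\<close> in the upper half-plane, \<open>j(z) - 744\<close> differs by at most
  \<open>20000\<close> from the sum of \<open>e(-gz)\<close> over the \<open>g \<in> \<Gamma>\<^sub>\<infinity>\<setminus>\<Gamma>\<close> with \<open>Im(gz) > 1\<close>, which has at most one term.
  By the maximum principle \<open>j\<^sub>m\<close> is the Hecke image
  \<open>\<Sum>\<^sub>X (j(Xz) - 744)\<close>, where \<open>X = (a, b; 0, d)\<close> with \<open>ad = m\<close> and \<open>0 \<le> b < d\<close>. Write each product \<open>gX\<close> as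
  \<open>X'g'\<close> up to \<open>\<plusminus>\<Gamma>\<^sub>\<infinity>\<close>. The sum over \<open>b\<close> annihilates all terms with \<open>d > 1\<close>, and what remains is
  \<open>|j\<^sub>m(z) - \<Sum> e(-mgz)| \<le> 20000 \<sigma>\<^sub>1(m)\<close>, the sum running over \<open>Im(gz) > 1/m\<close>. Summed over the reduced forms,
  with weights \<open>1/\<omega>\<^sub>Q\<close> that cancel the stabilisers, these exponentials give exactly the sum over the
  strip. There are at most \<open>|D|\<close> reduced forms, so the error is \<open>O(|D| \<sigma>\<^sub>1(m))\<close>, well below the claimed
  bound.
\<close>

subsection \<open>The cotangent series\<close>

text \<open>\<open>E4\<close> and \<open>E6\<close> are given by their \<open>q\<close>-series,
  which hide modularity; hence the detour through lattice sums. The reflection formula of the Gamma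
  function produces the cotangent, its derivatives link sums of \<open>1 / (w + k)^(n + 1)\<close>
  to power series in \<open>e w\<close>, and summation by rows identifies both series with sums over
  \<open>Z x Z\<close>, whose terms the modular group permutes. The denominator of
  \<open>klein_j\<close> must not vanish: this is checked on the fundamental domain, where
  \<open>|e z| <= 1/200\<close>, and carried elsewhere by modularity. The same smallness makes every
  constant explicit, from two exact coefficients and a geometric tail. Since \<open>j_poly\<close>
  is a definite description, existence and uniqueness of the polynomial precede any use of
  \<open>jm\<close>. The class number term is matched with nothing: it is at most
  \<open>24 |D| sigma_1(m)\<close> and joins the error, whence \<open>20024\<close>. In the final
  comparison \<open>sigma_1(m) <= m tau(m)\<close>, the logarithm is at least \<open>1/2\<close>,
  \<open>C\<close> is at least \<open>2000000\<close>, and the unmatched factors are at least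
  \<open>1\<close>.\<close>

text \<open>\<open>polycot 0 w\<close> is \<open>-\<pi> cot (\<pi> w)\<close>, and \<open>polycot n\<close> is its \<open>n\<close>-th derivative.\<close>

definition polycot :: "nat \<Rightarrow> complex \<Rightarrow> complex" where
  "polycot n w = Polygamma n w + (-1) ^ Suc n * Polygamma n (1 - w)"

lemma one_minus_notin_nonpos_Ints: "w \<notin> \<int> \<Longrightarrow> 1 - w \<notin> \<int>\<^sub>\<le>\<^sub>0" for w :: complex
  by (metis Ints_1 Ints_diff diff_diff_eq2 diff_add_cancel add_diff_cancel_left' nonpos_Ints_subset_Ints subsetD)

lemma notin_nonpos_Ints: "w \<notin> \<int> \<Longrightarrow> w \<notin> \<int>\<^sub>\<le>\<^sub>0" for w :: complex
  using nonpos_Ints_subset_Ints by blast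

text \<open>The alternating sign in \<open>polycot\<close> is the one that the inner derivative of
  \<open>1 - w\<close> produces, so differentiation only raises the index.\<close>

lemma has_field_derivative_polycot:
  assumes "w \<notin> \<int>"
  shows "(polycot n has_field_derivative polycot (Suc n) w) (at w)"
  unfolding polycot_def
  using notin_nonpos_Ints[OF assms] one_minus_notin_nonpos_Ints[OF assms]
  by (auto intro!: derivative_eq_intros)

text \<open>By the reflection formula \<open>pi / sin (pi w)\<close> is a product of two Gamma
  values, both nonzero off the integers; a zero of the sine would turn the quotient into
  \<open>0\<close>.\<close>

lemma sin_pi_nonzero: "w \<notin> \<int> \<Longrightarrow> sin (of_real pi * w) \<noteq> 0" for w :: complex
  using Gamma_reflection_complex[of w] notin_nonpos_Ints one_minus_notin_nonpos_Ints
  by (auto simp: Gamma_eq_zero_iff)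

text \<open>Logarithmic derivative of the reflection formula: both sides are differentiated and the
  common factor \<open>pi / sin (pi w)\<close> is cancelled.\<close>

lemma polycot_0:
  assumes "w \<notin> \<int>"
  shows "polycot 0 w = - of_real pi * cos (of_real pi * w) / sin (of_real pi * w)"
proof -
  note w = notin_nonpos_Ints[OF assms] one_minus_notin_nonpos_Ints[OF assms]
  note s = sin_pi_nonzero[OF assms]
  have "((\<lambda>z. Gamma z * Gamma (1 - z)) has_field_derivative
          Gamma w * Gamma (1 - w) * polycot 0 w) (at w)"
    using w by (auto intro!: derivative_eq_intros simp: polycot_def algebra_simps)
  moreover have "((\<lambda>z. of_real pi / sin (of_real pi * z)) has_field_derivative
          - (of_real pi)\<^sup>2 * cos (of_real pi * w) / (sin (of_real pi * w))\<^sup>2) (at w)"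
    using s by (auto intro!: derivative_eq_intros simp: power2_eq_square)
  ultimately have "Gamma w * Gamma (1 - w) * polycot 0 w =
      - (of_real pi)\<^sup>2 * cos (of_real pi * w) / (sin (of_real pi * w))\<^sup>2"
    unfolding Gamma_reflection_complex by (rule DERIV_unique)
  then have "of_real pi / sin (of_real pi * w) * polycot 0 w =
      of_real pi / sin (of_real pi * w) * (- of_real pi * cos (of_real pi * w) / sin (of_real pi * w))"
    unfolding Gamma_reflection_complex by (simp add: power2_eq_square)
  moreover have "of_real pi / sin (of_real pi * w) \<noteq> 0" using s by simp
  ultimately show ?thesis by (rule mult_left_cancel[THEN iffD1, rotated])
qed

text \<open>Turns an identity for \<open>polycot n\<close> off the integers, an open set, into one
  for \<open>polycot (Suc n)\<close>; this is how the differential equation below is differentiated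
  repeatedly.\<close>

lemma polycot_unique_derivative:
  assumes "\<And>u. u \<notin> \<int> \<Longrightarrow> polycot n u = f u" and "w \<notin> \<int>"
    and "(f has_field_derivative f') (at w)"
  shows "polycot (Suc n) w = f'"
proof -
  have "(f has_field_derivative polycot (Suc n) w) (at w)"
    by (rule has_field_derivative_transform_within_open[OF has_field_derivative_polycot, of w "- \<int>"])
       (use assms in \<open>auto simp: closed_Ints open_Compl\<close>)
  then show ?thesis using assms(3) by (rule DERIV_unique)
qed

text \<open>The Riccati equation of the cotangent. It makes every higher derivative a polynomial in
  \<open>polycot 0\<close>.\<close>

lemma polycot_1:
  assumes "w \<notin> \<int>" shows "polycot 1 w = (of_real pi)\<^sup>2 + (polycot 0 w)\<^sup>2"
proof -
  note s = sin_pi_nonzero[OF assms]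
  have "polycot (Suc 0) w = (- of_real pi * (- sin (of_real pi * w) * of_real pi) * sin (of_real pi * w)
      - - of_real pi * cos (of_real pi * w) * (cos (of_real pi * w) * of_real pi)) / (sin (of_real pi * w) * sin (of_real pi * w))"
    by (rule polycot_unique_derivative[OF polycot_0 assms])
       (use s in \<open>auto intro!: derivative_eq_intros simp: minus_divide_left simp del: minus_divide_left [symmetric]\<close>)
  also have "\<dots> = (of_real pi)\<^sup>2 + (- of_real pi * cos (of_real pi * w) / sin (of_real pi * w))\<^sup>2"
    using s by (simp add: power_divide power_mult_distrib power2_eq_square add_divide_distrib)
  finally show ?thesis using polycot_0[OF assms] by simp
qed

text \<open>The Riccati equation is differentiated four times. At \<open>1/2\<close> the cotangent
  vanishes, so only products of \<open>polycot 1 = pi^2\<close> and \<open>polycot 3\<close>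
  survive. These values carry \<open>zeta(4)\<close> and \<open>zeta(6)\<close>.\<close>

lemma polycot_half:
  "polycot 3 (1/2) = 2 * of_real pi ^ 4" "polycot 5 (1/2) = 16 * of_real pi ^ 6"
proof -
  have half: "(1/2 :: complex) \<notin> \<int>"
  proof
    assume "(1/2 :: complex) \<in> \<int>"
    then obtain k where "(1/2 :: complex) = of_int k" by (auto elim: Ints_cases)
    then have "(of_int (2 * k) :: complex) = of_int 1" by (simp add: field_simps)
    then have "2 * k = 1" by (rule of_int_eq_iff[THEN iffD1])
    then show False by presburger
  qed
  note D = has_field_derivative_polycot
  note [derivative_intros] = D[THEN DERIV_chain2]
  have 1: "polycot (Suc 0) u = (of_real pi)\<^sup>2 + (polycot 0 u)\<^sup>2" if "u \<notin> \<int>" for u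
    using polycot_1[OF that] by simp
  have 2: "polycot (Suc (Suc 0)) u = 2 * polycot 0 u * polycot (Suc 0) u" if "u \<notin> \<int>" for u
    by (rule polycot_unique_derivative[OF 1 that])
       (use that in \<open>auto intro!: derivative_eq_intros D\<close>)
  have 3: "polycot (Suc (Suc (Suc 0))) u = 2 * (polycot (Suc 0) u)\<^sup>2 + 2 * polycot 0 u * polycot (Suc (Suc 0)) u"
    if "u \<notin> \<int>" for u
    by (rule polycot_unique_derivative[OF 2 that])
       (use that in \<open>auto intro!: derivative_eq_intros D simp: power2_eq_square algebra_simps\<close>)
  have 4: "polycot (Suc (Suc (Suc (Suc 0)))) u =
      6 * polycot (Suc 0) u * polycot (Suc (Suc 0)) u + 2 * polycot 0 u * polycot (Suc (Suc (Suc 0))) u"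
    if "u \<notin> \<int>" for u
    by (rule polycot_unique_derivative[OF 3 that])
       (use that in \<open>auto intro!: derivative_eq_intros D simp: power2_eq_square algebra_simps\<close>)
  have 5: "polycot (Suc (Suc (Suc (Suc (Suc 0))))) u =
      6 * (polycot (Suc (Suc 0)) u)\<^sup>2 + 8 * polycot (Suc 0) u * polycot (Suc (Suc (Suc 0))) u
      + 2 * polycot 0 u * polycot (Suc (Suc (Suc (Suc 0)))) u"
    if "u \<notin> \<int>" for u
    by (rule polycot_unique_derivative[OF 4 that])
       (use that in \<open>auto intro!: derivative_eq_intros D simp: power2_eq_square algebra_simps\<close>)
  have c: "cos (of_real pi * (1/2)) = (0 :: complex)" using cos_of_real_pi_half by simp
  have 0: "polycot 0 (1/2) = 0"
    using polycot_0[OF half] c by simp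
  show "polycot 3 (1/2) = 2 * of_real pi ^ 4"
    using 1[OF half] 3[OF half] 0 by (simp add: eval_nat_numeral)
  show "polycot 5 (1/2) = 16 * of_real pi ^ 6"
    using 1[OF half] 2[OF half] 3[OF half] 5[OF half] 0 by (simp add: eval_nat_numeral)
qed

text \<open>Splitting into even and odd terms gives \<open>\<zeta>(k) = S + \<zeta>(k) / 2\<^sup>k\<close>, and the sum \<open>S\<close> over the odd
  terms is a value of \<^const>\<open>Polygamma\<close> at \<open>1/2\<close>.\<close>

lemma zeta_sums_polycot:
  assumes "odd n" "n \<ge> 1"
  shows "(\<lambda>k. 1 / of_nat (Suc k) ^ Suc n) sums
           (polycot n (1/2) / (2 * fact n * (2 ^ Suc n - 1)))"
proof -
  let ?f = "\<lambda>k. 1 / of_nat (Suc k) ^ Suc n :: complex"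
  have "summable (\<lambda>k. norm (?f k))"
  proof -
    have "summable (\<lambda>k. inverse (real (k + 1) ^ Suc n))"
      using inverse_power_summable[of "Suc n", where 'a = real] assms(2)
      by (subst summable_iff_shift) auto
    moreover have "inverse (real (k + 1) ^ Suc n) = norm (?f k)" for k
      by (simp add: norm_inverse norm_power divide_inverse norm_of_nat del: of_nat_Suc power_Suc)
    ultimately show ?thesis by simp
  qed
  then have "summable ?f" by (rule summable_norm_cancel)
  then obtain s where s: "?f sums s" by (auto simp: summable_def)
  have pair: "(\<lambda>k. ?f (2 * k) + ?f (2 * k + 1)) sums s"
  proof -
    have "(\<lambda>k. sum ?f {k * 2..<k * 2 + 2}) sums s" by (rule sums_group[OF s]) simp
    moreover have "sum ?f {k * 2..<k * 2 + 2} = ?f (2 * k) + ?f (2 * k + 1)" for k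
    proof -
      have "{k * 2..<k * 2 + 2} = {2 * k, 2 * k + 1}" by auto
      then show ?thesis by simp
    qed
    ultimately show ?thesis by simp
  qed
  have "(\<lambda>k. inverse ((1/2 + of_nat k) ^ Suc n)) sums ((-1) ^ Suc n * Polygamma n (1/2 :: complex) / fact n)"
    by (rule Polygamma_LIMSEQ) (use assms in auto)
  moreover have "Polygamma n (1/2 :: complex) = polycot n (1/2) / 2"
    using assms by (simp add: polycot_def)
  ultimately have "(\<lambda>k. inverse ((1/2 + of_nat k) ^ Suc n)) sums (polycot n (1/2) / 2 / fact n)"
    using assms by simp
  then have "(\<lambda>k. 1 / 2 ^ Suc n * inverse ((1/2 + of_nat k) ^ Suc n)) sums (1 / 2 ^ Suc n * (polycot n (1/2) / 2 / fact n))"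
    by (rule sums_mult)
  moreover have "1 / 2 ^ Suc n * inverse ((1/2 + of_nat k) ^ Suc n) = ?f (2 * k)" for k
  proof -
    have "(2::complex) * (1/2 + of_nat k) = of_nat (Suc (2 * k))" by (simp add: field_simps)
    then have "of_nat (Suc (2 * k)) ^ Suc n = (2::complex) ^ Suc n * (1/2 + of_nat k) ^ Suc n"
      by (metis power_mult_distrib)
    then show ?thesis by (simp only: divide_inverse inverse_mult_distrib mult_1)
  qed
  ultimately have odd: "(\<lambda>k. ?f (2 * k)) sums (polycot n (1/2) / (2 * fact n * 2 ^ Suc n))"
    by (simp add: mult.commute mult.left_commute)
  have "?f (2 * k + 1) = 1 / 2 ^ Suc n * ?f k" for k
  proof -
    have "(of_nat (Suc (2 * k + 1)) :: complex) = 2 * of_nat (Suc k)" by simp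
    then show ?thesis by (simp only: power_mult_distrib) simp
  qed
  then have even: "(\<lambda>k. ?f (2 * k + 1)) sums (1 / 2 ^ Suc n * s)"
    using sums_mult[OF s, of "1 / 2 ^ Suc n"] by simp
  have eq: "s = polycot n (1/2) / (2 * fact n * 2 ^ Suc n) + 1 / 2 ^ Suc n * s"
    using sums_unique2[OF pair sums_add[OF odd even]] .
  have "(2::real) ^ Suc n \<noteq> 1" using one_less_power[of "2::real" "Suc n"] by linarith
  then have "(2::complex) ^ Suc n - 1 \<noteq> 0"
    by (metis eq_iff_diff_eq_0 of_real_1 of_real_eq_iff of_real_numeral of_real_power)
  with eq have "s = polycot n (1/2) / (2 * fact n * (2 ^ Suc n - 1))"
    by (simp add: divide_simps del: power_Suc) (simp add: algebra_simps)
  with s show ?thesis by simp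
qed

section \<open>Lipschitz formula: derivatives of the cotangent as power series in
  \<open>e w\<close>\<close>

lemma summable_power_times_geometric:
  fixes q :: "'a :: {real_normed_field, banach}"
  assumes "norm q < 1"
  shows "summable (\<lambda>k. of_nat k ^ n * q ^ k)"
  using assms
proof (induction n arbitrary: q)
  case 0
  then show ?case by (simp add: summable_geometric)
next
  case (Suc n)
  have "summable (\<lambda>k. diffs (\<lambda>k. of_nat k ^ n) k * q ^ k)"
    by (rule termdiff_converges[OF Suc.prems Suc.IH])
  then have "summable (\<lambda>k. q * (diffs (\<lambda>k. of_nat k ^ n) k * q ^ k))" by (rule summable_mult)
  also have "(\<lambda>k. q * (diffs (\<lambda>k. of_nat k ^ n) k * q ^ k)) =
      (\<lambda>k. of_nat (Suc k) ^ Suc n * q ^ Suc k :: 'a)"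
    by (simp add: diffs_def fun_eq_iff del: of_nat_Suc)
  finally show ?case by (subst (asm) summable_Suc_iff)
qed

text \<open>The polylogarithm of order \<open>-n\<close>. For \<open>n = 0\<close> the term
  \<open>k = 0\<close> counts as \<open>1\<close>, because \<open>0 ^ 0 = 1\<close>; this fixes the
  constant in \<open>polycot_q_expansion\<close>.\<close>

definition polylog_series :: "nat \<Rightarrow> complex \<Rightarrow> complex" where
  "polylog_series n q = (\<Sum>k. of_nat k ^ n * q ^ k)"

text \<open>The Euler operator \<open>q d/dq\<close> multiplies the \<open>k\<close>-th coefficient
  by \<open>k\<close>. Only \<open>q * f'\<close> is given in closed form, which is what the chain
  rule through \<open>e\<close> calls for and avoids a division by \<open>q\<close>.\<close>

lemma has_field_derivative_polylog_series:
  assumes "cmod q < 1"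
  shows "\<exists>f'. (polylog_series n has_field_derivative f') (at q) \<and> q * f' = polylog_series (Suc n) q"
proof -
  obtain r where r: "cmod q < r" "r < 1" using dense assms by blast
  have "summable (\<lambda>k. of_nat k ^ n * (of_real r :: complex) ^ k)"
    using r by (intro summable_power_times_geometric) (simp add: abs_if, meson le_less_trans norm_ge_zero not_less_iff_gr_or_eq)
  then have "((\<lambda>q. \<Sum>k. of_nat k ^ n * q ^ k) has_field_derivative
     (\<Sum>k. diffs (\<lambda>k. of_nat k ^ n) k * q ^ k)) (at q)"
    by (rule termdiffs_strong) (use r in auto)
  moreover have "q * (\<Sum>k. diffs (\<lambda>k. of_nat k ^ n) k * q ^ k) = polylog_series (Suc n) q"
  proof -
    have s: "summable (\<lambda>k. diffs (\<lambda>k. of_nat k ^ n) k * q ^ k)"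
      by (rule termdiff_converges[OF assms summable_power_times_geometric])
    have "q * (\<Sum>k. diffs (\<lambda>k. of_nat k ^ n) k * q ^ k) = (\<Sum>k. q * (diffs (\<lambda>k. of_nat k ^ n) k * q ^ k))"
      by (rule suminf_mult[OF s, symmetric])
    also have "\<dots> = (\<Sum>k. of_nat (Suc k) ^ Suc n * q ^ Suc k)"
      by (simp add: diffs_def mult_ac del: of_nat_Suc)
    also have "\<dots> = polylog_series (Suc n) q"
      unfolding polylog_series_def
      by (subst suminf_split_head[OF summable_power_times_geometric[OF assms]]) simp
    finally show ?thesis .
  qed
  ultimately show ?thesis unfolding polylog_series_def[abs_def] by blast
qed

lemma has_field_derivative_e [derivative_intros]:
  "(f has_field_derivative f') (at z within S) \<Longrightarrow>
   ((\<lambda>z. e (f z)) has_field_derivative (2 * of_real pi * \<i> * e (f z) * f')) (at z within S)"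
  unfolding e_def by (auto intro!: derivative_eq_intros)

lemma norm_e: "cmod (e z) = exp (- 2 * pi * Im z)"
  by (simp add: e_def norm_exp_eq_Re)

lemma norm_e_less_1: "Im z > 0 \<Longrightarrow> cmod (e z) < 1"
  by (simp add: norm_e)

lemma e_add: "e (z + w) = e z * e w"
  by (simp add: e_def exp_add algebra_simps)

lemma e_of_nat_mult: "e (of_nat n * z) = e z ^ n"
  by (simp add: e_def exp_of_nat_mult [symmetric] mult_ac)

lemma e_nonzero [simp]: "e z \<noteq> 0"
  by (simp add: e_def)

lemma e_minus: "e (- z) = 1 / e z"
  by (simp add: e_def exp_minus divide_inverse)

lemma e_of_int [simp]: "e (of_int k) = 1"
proof -
  have "e (of_int k) = exp (\<i> * (of_int (2 * k) * of_real pi))"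
    by (simp add: e_def mult_ac)
  also have "\<dots> = 1" using exp_integer_2pi[of "of_int k"] by (simp add: mult_ac)
  finally show ?thesis .
qed

lemma upper_half_notin_Ints: "Im w > 0 \<Longrightarrow> w \<notin> \<int>"
  by (auto elim!: Ints_cases)

text \<open>The base case writes the cotangent as \<open>i pi (1 + q) / (1 - q)\<close> with
  \<open>q = e w\<close>. Each derivative in \<open>w\<close> then acts as
  \<open>2 pi i q d/dq\<close>.\<close>

theorem polycot_q_expansion:
  assumes "Im w > 0"
  shows "polycot n w = (2 * of_real pi * \<i>) ^ Suc n * polylog_series n (e w)
           - (if n = 0 then \<i> * of_real pi else 0)"
  using assms
proof (induction n arbitrary: w)
  case 0
  let ?x = "exp (\<i> * (of_real pi * w))"
  have q: "e w = ?x ^ 2" by (simp add: e_def exp_of_nat_mult [symmetric] mult_ac)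
  have q1: "cmod (e w) < 1" using 0 by (rule norm_e_less_1)
  then have pl: "polylog_series 0 (e w) = 1 / (1 - e w)"
    by (simp add: polylog_series_def suminf_geometric)
  have pc: "polycot 0 w = \<i> * of_real pi * (1 + e w) / (1 - e w)"
  proof -
    have n: "1 - ?x ^ 2 \<noteq> 0"
    proof
      assume "1 - ?x ^ 2 = 0"
      then have "e w = 1" unfolding q by (simp only: right_minus_eq)
      with q1 show False by simp
    qed
    have x0: "?x \<noteq> 0" by simp
    have c: "cos (of_real pi * w) = (?x + 1 / ?x) / 2" "sin (of_real pi * w) = (?x - 1 / ?x) / (2 * \<i>)"
      by (simp_all only: cos_exp_eq sin_exp_eq exp_minus inverse_eq_divide)
    have p: "?x + 1 / ?x = (1 + ?x ^ 2) / ?x" "?x - 1 / ?x = - (1 - ?x ^ 2) / ?x"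
      using x0 by (simp_all only: add_divide_distrib diff_divide_distrib minus_diff_eq power2_eq_square nonzero_mult_div_cancel_left not_False_eq_True) simp_all
    define X where "X = ?x ^ 2"
    show ?thesis
      unfolding polycot_0[OF upper_half_notin_Ints[OF 0]] c q p X_def[symmetric]
      using x0 n[folded X_def] by (simp add: divide_simps)
  qed
  have "1 - e w \<noteq> 0" using q1 by auto
  then show ?case unfolding pl pc by (simp add: divide_simps) (simp add: algebra_simps)
next
  case (Suc n)
  obtain f' where f': "(polylog_series n has_field_derivative f') (at (e w))"
      "e w * f' = polylog_series (Suc n) (e w)"
    using has_field_derivative_polylog_series[OF norm_e_less_1[OF Suc.prems]] by blast
  have ew: "(e has_field_derivative (2 * of_real pi * \<i> * e w)) (at w)"
    using has_field_derivative_e[OF DERIV_ident, of w UNIV] by simp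
  have "((\<lambda>w. polylog_series n (e w)) has_field_derivative f' * (2 * of_real pi * \<i> * e w)) (at w)"
    by (rule DERIV_chain2[OF f'(1) ew])
  then have "((\<lambda>w. (2 * of_real pi * \<i>) ^ Suc n * polylog_series n (e w)
           - (if n = 0 then \<i> * of_real pi else 0)) has_field_derivative
      (2 * of_real pi * \<i>) ^ Suc n * (f' * (2 * of_real pi * \<i> * e w)) - 0) (at w)"
    by (intro DERIV_diff DERIV_cmult DERIV_const)
  moreover have "((\<lambda>w. (2 * of_real pi * \<i>) ^ Suc n * polylog_series n (e w)
           - (if n = 0 then \<i> * of_real pi else 0)) has_field_derivative polycot (Suc n) w) (at w)"
    by (rule has_field_derivative_transform_within_open
          [OF has_field_derivative_polycot[OF upper_half_notin_Ints[OF Suc.prems]], of "{w. Im w > 0}"])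
       (use Suc in \<open>auto simp: open_halfspace_Im_gt\<close>)
  ultimately have "polycot (Suc n) w = (2 * of_real pi * \<i>) ^ Suc n * (f' * (2 * of_real pi * \<i> * e w)) - 0"
    using DERIV_unique by blast
  also have "\<dots> = (2 * of_real pi * \<i>) ^ Suc (Suc n) * (e w * f')" by (simp add: mult_ac)
  finally show ?case using f'(2) by simp
qed

subsection \<open>Eisenstein series as lattice sums\<close>

lemma quadratic_form_lower_bound:
  assumes "Im z > 0"
  obtains c where "c > 0" "\<And>x y. c * (x\<^sup>2 + y\<^sup>2) \<le> (cmod (of_real x * z + of_real y))\<^sup>2"
proof -
  define u v where "u = Re z" and "v = Im z"
  have v: "v > 0" using assms by (simp add: v_def)
  \<comment> \<open>From \<open>y = (x u + y) - x u\<close> the sum \<open>x^2 + y^2\<close> is at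
    most \<open>2 (x u + y)^2\<close> plus \<open>(1 + 2 u^2) / v^2\<close> times
    \<open>(x v)^2\<close>; \<open>C\<close> exceeds both coefficients.\<close>
  define C where "C = 2 + (1 + 2 * u\<^sup>2) / v\<^sup>2"
  have C: "C > 0" unfolding C_def using v by (intro add_pos_nonneg) (auto intro!: divide_nonneg_nonneg add_nonneg_nonneg)
  have "1 / C * (x\<^sup>2 + y\<^sup>2) \<le> (cmod (of_real x * z + of_real y))\<^sup>2" for x y
  proof -
    have n: "(cmod (of_real x * z + of_real y))\<^sup>2 = (x * u + y)\<^sup>2 + (x * v)\<^sup>2"
      by (simp add: cmod_power2 u_def v_def)
    have "y\<^sup>2 \<le> 2 * (x * u + y)\<^sup>2 + 2 * (x * u)\<^sup>2"
      using zero_le_power2[of "(x * u + y) + x * u"] by (simp add: power2_eq_square algebra_simps)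
    then have "x\<^sup>2 + y\<^sup>2 \<le> 2 * (x * u + y)\<^sup>2 + (1 + 2 * u\<^sup>2) * x\<^sup>2"
      by (simp add: power_mult_distrib algebra_simps)
    also have "(1 + 2 * u\<^sup>2) * x\<^sup>2 = (1 + 2 * u\<^sup>2) / v\<^sup>2 * (x * v)\<^sup>2"
      using v by (simp add: power_mult_distrib)
    also have "2 * (x * u + y)\<^sup>2 + (1 + 2 * u\<^sup>2) / v\<^sup>2 * (x * v)\<^sup>2 \<le> C * (x * u + y)\<^sup>2 + C * (x * v)\<^sup>2"
      unfolding C_def by (intro add_mono mult_right_mono) (auto intro!: divide_nonneg_nonneg add_nonneg_nonneg)
    finally have "x\<^sup>2 + y\<^sup>2 \<le> C * (cmod (of_real x * z + of_real y))\<^sup>2"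
      unfolding n by (simp add: algebra_simps)
    then show ?thesis using C by (simp add: field_simps)
  qed
  then show ?thesis using that[of "1 / C"] C by auto
qed

section \<open>Unconditional sums over the integers and over the lattice\<close>

lemma int_halves: "(UNIV :: int set) = range int \<union> range (\<lambda>j. - int j - 1)"
proof -
  have "x \<in> range int \<union> range (\<lambda>j. - int j - 1)" for x
  proof (cases "x \<ge> 0")
    case True then show ?thesis by (auto intro!: image_eqI[of _ _ "nat x"])
  next
    case False then show ?thesis by (auto intro!: image_eqI[of _ _ "nat (- x - 1)"])
  qed
  then show ?thesis by blast
qed

lemma summable_on_int_halves:
  fixes f :: "int \<Rightarrow> real"
  assumes "(\<lambda>j. f (int j)) summable_on UNIV" "(\<lambda>j. f (- int j - 1)) summable_on UNIV"
  shows "f summable_on UNIV"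
proof -
  show ?thesis unfolding int_halves
  proof (rule summable_on_Un_disjoint)
    show "f summable_on range int"
      using assms(1) by (subst summable_on_reindex) (auto simp: inj_def o_def)
    show "f summable_on range (\<lambda>j. - int j - 1)"
      using assms(2) by (subst summable_on_reindex) (auto simp: inj_def o_def)
  qed auto
qed

text \<open>Unconditional summability is assumed, so the sequential sums over the two halves
  determine the value. The halves match the two series in \<open>polycot\<close>:
  \<open>w + j\<close>, and up to sign \<open>1 - w + j\<close>.\<close>

lemma has_sum_int_halves:
  fixes f :: "int \<Rightarrow> complex"
  assumes "f summable_on UNIV" "(\<lambda>j. f (int j)) sums a" "(\<lambda>j. f (- int j - 1)) sums b"
  shows "(f has_sum (a + b)) UNIV"
proof -
  have *: "(f has_sum s) (range h)" if "(\<lambda>j. f (h j)) sums s" "inj h" for h :: "nat \<Rightarrow> int" and s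
  proof -
    have "f summable_on range h" using assms(1) summable_on_subset_banach by blast
    then have "(f \<circ> h) summable_on UNIV" using that(2) by (simp add: summable_on_reindex)
    then have "((f \<circ> h) has_sum infsum (f \<circ> h) UNIV) UNIV" by (rule has_sum_infsum)
    moreover from this have "infsum (f \<circ> h) UNIV = s"
      using has_sum_imp_sums that(1) sums_unique2 by (fastforce simp: o_def)
    ultimately show ?thesis using that(2) by (simp add: has_sum_reindex)
  qed
  show ?thesis unfolding int_halves
    by (rule has_sum_Un_disjoint[OF *[OF assms(2)] *[OF assms(3)]]) (auto simp: inj_def)
qed

lemma summable_on_int_inverse_square: "(\<lambda>k::int. 1 / (1 + (real_of_int k)\<^sup>2)) summable_on UNIV"
proof -
  have s: "summable (\<lambda>n::nat. 2 * inverse (real (Suc n) ^ 2))"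
    using inverse_power_summable[of 2, where 'a = real]
    by (intro summable_mult) (subst summable_Suc_iff, simp)
  have "1 / (1 + (real n)\<^sup>2) \<le> 2 * inverse (real (Suc n) ^ 2)" for n
  proof -
    have "2 * real n \<le> 1 + (real n)\<^sup>2"
      using zero_le_power2[of "real n - 1"] by (simp add: power2_eq_square algebra_simps)
    then have "(1 + real n)\<^sup>2 \<le> 2 * (1 + (real n)\<^sup>2)"
      by (simp add: power2_eq_square algebra_simps)
    then show ?thesis by (simp add: field_simps add_pos_nonneg)
  qed
  then have "summable (\<lambda>n::nat. 1 / (1 + (real n)\<^sup>2))"
    by (intro summable_comparison_test'[OF s, of 0]) auto
  then have 1: "(\<lambda>n::nat. 1 / (1 + (real n)\<^sup>2)) summable_on UNIV"
    by (subst summable_on_UNIV_nonneg_real_iff) auto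
  then have "(\<lambda>n. 1 / (1 + (real n)\<^sup>2)) summable_on range Suc"
    using summable_on_subset_banach by blast
  then have "(\<lambda>n. 1 / (1 + (real (Suc n))\<^sup>2)) summable_on UNIV"
    by (subst (asm) summable_on_reindex) (auto simp: o_def)
  moreover have "1 / (1 + (real (Suc n))\<^sup>2) = 1 / (1 + (real_of_int (- int n - 1))\<^sup>2)" for n
    by (simp add: power2_eq_square algebra_simps)
  ultimately show ?thesis using 1 by (intro summable_on_int_halves) simp_all
qed

lemma summable_on_product:
  fixes f :: "'a \<Rightarrow> real" and g :: "'b \<Rightarrow> real"
  assumes "f summable_on A" "g summable_on B" "\<And>x. f x \<ge> 0" "\<And>y. g y \<ge> 0"
  shows "(\<lambda>(x, y). f x * g y) summable_on A \<times> B"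
proof -
  have "(\<lambda>p. norm (case p of (x, y) \<Rightarrow> f x * g y)) summable_on A \<times> B"
    unfolding Infinite_Sum.abs_summable_on_Sigma_iff
  proof (intro conjI ballI)
    fix x assume "x \<in> A"
    show "(\<lambda>y. norm (case (x, y) of (x, y) \<Rightarrow> f x * g y)) summable_on B"
      using summable_on_cmult_right[OF assms(2), of "f x"] assms by simp
  next
    have "infsum (\<lambda>y. norm (case (x, y) of (x, y) \<Rightarrow> f x * g y)) B = f x * infsum g B" for x
      using assms by (simp add: infsum_cmult_right)
    then show "(\<lambda>x. norm (infsum (\<lambda>y. norm (case (x, y) of (x, y) \<Rightarrow> f x * g y)) B)) summable_on A"
      using summable_on_cmult_left[OF assms(1), of "infsum g B"] assms by (simp add: infsum_nonneg abs_mult)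
  qed
  then show ?thesis using assms by (simp add: case_prod_unfold)
qed

text \<open>The sums below run over all of \<open>\<int> \<times> \<int>\<close>: the origin contributes \<open>1 / 0 = 0\<close>.\<close>

definition eisenstein_term :: "nat \<Rightarrow> complex \<Rightarrow> int \<times> int \<Rightarrow> complex" where
  "eisenstein_term k z = (\<lambda>(m, n). 1 / (of_int m * z + of_int n) ^ k)"

lemma eisenstein_summable:
  assumes "Im z > 0" "k \<ge> 4"
  shows "eisenstein_term k z summable_on UNIV"
proof -
  obtain c where c: "c > 0" "\<And>x y. c * (x\<^sup>2 + y\<^sup>2) \<le> (cmod (of_real x * z + of_real y))\<^sup>2"
    using quadratic_form_lower_bound[OF assms(1)] by blast
  \<comment> \<open>With \<open>s = m^2 + n^2 >= 1\<close> and \<open>N = |m z + n|\<close>: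
    \<open>N^2 >= c s\<close> and \<open>(1 + m^2) (1 + n^2) <= 4 s^2\<close> handle four powers of
    \<open>N\<close>, and \<open>N >= sqrt c\<close> bounds the other \<open>k - 4\<close>. The
    majorant is a product of two convergent series.\<close>
  define K where "K = 4 / (c\<^sup>2 * sqrt c ^ (k - 4))"
  have K: "K \<ge> 0" using c by (simp add: K_def)
  have "(\<lambda>(m, n). 1 / (1 + (real_of_int m)\<^sup>2) * (1 / (1 + (real_of_int n)\<^sup>2))) summable_on UNIV \<times> UNIV"
    by (intro summable_on_product summable_on_int_inverse_square) auto
  then have s: "(\<lambda>p. K * (case p of (m, n) \<Rightarrow> 1 / (1 + (real_of_int m)\<^sup>2) * (1 / (1 + (real_of_int n)\<^sup>2)))) summable_on UNIV"
    by (intro summable_on_cmult_right) simp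
  have "norm (eisenstein_term k z p) \<le> K * (case p of (m, n) \<Rightarrow> 1 / (1 + (real_of_int m)\<^sup>2) * (1 / (1 + (real_of_int n)\<^sup>2)))" for p
  proof (cases "p = (0, 0)")
    case True
    then show ?thesis using K assms(2) by (simp add: eisenstein_term_def zero_power)
  next
    case False
    obtain m n where p: "p = (m, n)" by fastforce
    define x y where "x = real_of_int m" and "y = real_of_int n"
    define N where "N = cmod (of_real x * z + of_real y)"
    define s where "s = x\<^sup>2 + y\<^sup>2"
    have "m\<^sup>2 + n\<^sup>2 \<ge> 1" using False p
      by (metis int_one_le_iff_zero_less sum_power2_gt_zero_iff prod.inject)
    then have s1: "s \<ge> 1" unfolding s_def x_def y_def
      by (metis of_int_1 of_int_add of_int_le_iff of_int_power)
    have N2: "N\<^sup>2 \<ge> c * s" using c(2) by (simp add: N_def s_def)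
    also have "c * s \<ge> c" using c s1 by simp
    finally have N1: "N \<ge> sqrt c" unfolding N_def by (simp add: real_le_lsqrt)
    have "(1 + x\<^sup>2) * (1 + y\<^sup>2) \<le> (2 * s) * (2 * s)"
    proof -
      have "x\<^sup>2 \<le> s" "y\<^sup>2 \<le> s" by (simp_all add: s_def)
      then have "1 + x\<^sup>2 \<le> s + s" "1 + y\<^sup>2 \<le> s + s" using s1 by (intro add_mono; simp)+
      then have "1 + x\<^sup>2 \<le> 2 * s" "1 + y\<^sup>2 \<le> 2 * s" by (simp_all only: mult_2)
      then show ?thesis using s1 by (intro mult_mono) auto
    qed
    also have "c\<^sup>2 * \<dots> \<le> 4 * (N\<^sup>2)\<^sup>2"
    proof -
      have "(c * s)\<^sup>2 \<le> (N\<^sup>2)\<^sup>2" using N2 c s1 by (intro power_mono) auto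
      then show ?thesis by (simp add: power2_eq_square algebra_simps)
    qed
    finally have h1: "c\<^sup>2 * ((1 + x\<^sup>2) * (1 + y\<^sup>2)) \<le> 4 * N ^ 4" using c by (simp add: mult_left_mono)
    have h2: "sqrt c ^ (k - 4) \<le> N ^ (k - 4)" using N1 c by (intro power_mono) auto
    have "c\<^sup>2 * ((1 + x\<^sup>2) * (1 + y\<^sup>2)) * sqrt c ^ (k - 4) \<le> 4 * N ^ 4 * N ^ (k - 4)"
      by (rule mult_mono[OF h1 h2]) (use c in \<open>auto simp: N_def\<close>)
    also have "\<dots> = 4 * N ^ k" using assms(2) by (simp flip: power_add)
    finally have *: "c\<^sup>2 * sqrt c ^ (k - 4) * ((1 + x\<^sup>2) * (1 + y\<^sup>2)) \<le> 4 * N ^ k" by (simp add: mult_ac)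
    have N0: "N > 0" using N1 c by (smt (verit) real_sqrt_gt_zero)
    have "norm (eisenstein_term k z p) = 1 / N ^ k"
      by (simp add: eisenstein_term_def p N_def x_def y_def norm_divide norm_power)
    also have "\<dots> \<le> 4 / (c\<^sup>2 * sqrt c ^ (k - 4) * ((1 + x\<^sup>2) * (1 + y\<^sup>2)))"
    proof -
      have "0 < c\<^sup>2 * sqrt c ^ (k - 4) * ((1 + x\<^sup>2) * (1 + y\<^sup>2))"
        using c by (intro mult_pos_pos) (auto intro!: add_pos_nonneg)
      with * show ?thesis using N0 by (simp only: divide_le_eq le_divide_eq times_divide_eq_left) (simp add: field_simps)
    qed
    finally show ?thesis by (simp add: K_def p x_def y_def)
  qed
  then have "(\<lambda>p. norm (eisenstein_term k z p)) summable_on UNIV"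
    by (intro Infinite_Sum.abs_summable_on_comparison_test'[OF s]) auto
  then show ?thesis by (rule abs_summable_summable)
qed

text \<open>Summability is that of the row \<open>m = 1\<close> of the lattice sum, hence
  \<open>n >= 3\<close>; the value comes from the series of \<open>Polygamma n\<close> at
  \<open>w\<close> and at \<open>1 - w\<close>.\<close>

lemma has_sum_row:
  assumes "Im w > 0" "n \<ge> 3"
  shows "((\<lambda>k::int. 1 / (w + of_int k) ^ Suc n) has_sum ((-1) ^ Suc n * polycot n w / fact n)) UNIV"
proof -
  have w0: "w \<noteq> 0" using assms by auto
  have "eisenstein_term (Suc n) w summable_on range (\<lambda>k. (1, k))"
    using eisenstein_summable[of w "Suc n"] assms summable_on_subset_banach by fastforce
  then have s: "(\<lambda>k::int. 1 / (w + of_int k) ^ Suc n) summable_on UNIV"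
    by (subst (asm) summable_on_reindex) (auto simp: inj_def o_def eisenstein_term_def)
  have 1: "(\<lambda>j. 1 / (w + of_int (int j)) ^ Suc n) sums ((-1) ^ Suc n * Polygamma n w / fact n)"
    using Polygamma_LIMSEQ[OF w0, of n] assms by (simp add: inverse_eq_divide)
  have "1 - w \<noteq> 0" using assms by auto
  then have "(\<lambda>j. inverse ((1 - w + of_nat j) ^ Suc n)) sums ((-1) ^ Suc n * Polygamma n (1 - w) / fact n)"
    using Polygamma_LIMSEQ[of "1 - w" n] assms by auto
  then have "(\<lambda>j. (-1) ^ Suc n * inverse ((1 - w + of_nat j) ^ Suc n)) sums
      ((-1) ^ Suc n * ((-1) ^ Suc n * Polygamma n (1 - w) / fact n))" by (rule sums_mult)
  moreover have "(-1) ^ Suc n * inverse ((1 - w + of_nat j) ^ Suc n) = 1 / (w + of_int (- int j - 1)) ^ Suc n" for j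
  proof -
    have "w + of_int (- int j - 1) = (-1) * (1 - w + of_nat j)" by simp
    then have "(w + of_int (- int j - 1)) ^ Suc n = (-1) ^ Suc n * (1 - w + of_nat j) ^ Suc n"
      by (metis power_mult_distrib)
    moreover have "1 / (-1 :: complex) ^ Suc n = (-1) ^ Suc n"
      by (cases "even n") auto
    ultimately show ?thesis by (simp add: divide_inverse)
  qed
  ultimately have 2: "(\<lambda>j. 1 / (w + of_int (- int j - 1)) ^ Suc n) sums
      ((-1) ^ Suc n * ((-1) ^ Suc n * Polygamma n (1 - w) / fact n))" by simp
  have "((-1) ^ Suc n * Polygamma n w / fact n) + ((-1) ^ Suc n * ((-1) ^ Suc n * Polygamma n (1 - w) / fact n))
      = (-1) ^ Suc n * polycot n w / fact n"
    by (cases "even n") (simp_all add: polycot_def diff_divide_distrib add_divide_distrib)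
  with has_sum_int_halves[OF s 1 2] show ?thesis by simp
qed

text \<open>The lattice is summed by rows. The row \<open>m = 0\<close> gives twice a zeta value,
  the rows \<open>m > 0\<close> follow from the Lipschitz formula, and the rows \<open>m < 0\<close>
  repeat them because the weight is even. Summability of the row sums yields the second
  claim.\<close>

theorem eisenstein_q_expansion:
  assumes z: "Im z > 0" and n: "odd n" "n \<ge> 3"
  shows "infsum (eisenstein_term (Suc n) z) UNIV =
    2 * (polycot n (1/2) / (2 * fact n * (2 ^ Suc n - 1))
      + (2 * of_real pi * \<i>) ^ Suc n / fact n * (\<Sum>j. polylog_series n (e z ^ Suc j)))"
    and "summable (\<lambda>j. polylog_series n (e z ^ Suc j))"
proof -
  let ?C = "(2 * of_real pi * \<i>) ^ Suc n / fact n"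
  let ?Z = "polycot n (1/2) / (2 * fact n * (2 ^ Suc n - 1))"
  let ?E = "eisenstein_term (Suc n) z"
  have even: "even (Suc n)" using n by simp
  \<comment> \<open>The value of row \<open>m\<close>.\<close>
  define g where "g m = (if m = 0 then ?Z + ?Z else ?C * polylog_series n (e z ^ nat \<bar>m\<bar>))" for m :: int
  have sE: "?E summable_on UNIV" using eisenstein_summable[OF z] n by simp
  have S: "(?E has_sum infsum ?E UNIV) (UNIV \<times> UNIV)"
    using has_sum_infsum[OF sE] by simp
  have pos: "((\<lambda>k. ?E (m, k)) has_sum g m) UNIV" if "m > 0" for m
  proof -
    have im: "Im (of_int m * z) > 0" using that z by simp
    have "e (of_int m * z) = e z ^ nat \<bar>m\<bar>"
      using e_of_nat_mult[of "nat m" z] that by simp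
    then have "(-1) ^ Suc n * polycot n (of_int m * z) / fact n = g m"
      using that n polycot_q_expansion[OF im, of n] even by (auto simp: g_def)
    with has_sum_row[OF im n(2)] show ?thesis by (simp add: eisenstein_term_def)
  qed
  have row: "((\<lambda>k. ?E (m, k)) has_sum g m) UNIV" for m
  proof (cases m "0 :: int" rule: linorder_cases)
    case less
    have "((\<lambda>k. ?E (- m, k)) has_sum g m) UNIV"
      using pos[of "- m"] less by (simp add: g_def)
    moreover have "?E (m, k) = ?E (- m, - k)" for k
    proof -
      have "of_int (- m) * z + of_int (- k) = - (of_int m * z + of_int k)" by simp
      then show ?thesis using even by (simp only: eisenstein_term_def split power_minus_even)
    qed
    ultimately show ?thesis
      by (subst has_sum_reindex_bij_witness[of UNIV uminus uminus UNIV "\<lambda>k. ?E (- m, k)"]) auto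
  next
    case equal
    have s: "(\<lambda>k. ?E (m, k)) summable_on UNIV"
    proof -
      have "?E summable_on range (\<lambda>k. (m, k))" using sE summable_on_subset_banach by blast
      then show ?thesis by (subst (asm) summable_on_reindex) (auto simp: inj_def o_def)
    qed
    have "(\<lambda>j. ?E (m, int (Suc j))) sums ?Z"
      using zeta_sums_polycot[of n] n equal by (simp add: eisenstein_term_def)
    \<comment> \<open>The origin counts as \<open>1 / 0 = 0\<close>, so prepending the term
      \<open>j = 0\<close> leaves the sum unchanged.\<close>
    then have 1: "(\<lambda>j. ?E (m, int j)) sums ?Z"
      using n by (subst (asm) sums_Suc_iff) (simp add: eisenstein_term_def equal)
    have "?E (m, int (Suc j)) = ?E (m, - int j - 1)" for j
    proof -
      have "of_int m * z + of_int (- int j - 1) = - (of_int m * z + of_int (int (Suc j)))" using equal by simp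
      then show ?thesis using even by (simp only: eisenstein_term_def split power_minus_even)
    qed
    with \<open>(\<lambda>j. ?E (m, int (Suc j))) sums ?Z\<close> have 2: "(\<lambda>j. ?E (m, - int j - 1)) sums ?Z" by simp
    show ?thesis using has_sum_int_halves[OF s 1 2] equal by (simp add: g_def)
  next
    case greater then show ?thesis by (rule pos)
  qed
  have G: "(g has_sum infsum ?E UNIV) UNIV"
    by (rule has_sum_SigmaD[OF S row])
  then have sG: "g summable_on UNIV" by (rule has_sum_imp_summable)
  have "g summable_on range (\<lambda>j. int (Suc j))" using sG summable_on_subset_banach by blast
  then have "(\<lambda>j. g (int (Suc j))) summable_on UNIV"
    by (subst (asm) summable_on_reindex) (auto simp: inj_def o_def)
  then have "summable (\<lambda>j. g (int (Suc j)))" by (rule summable_on_imp_summable)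
  moreover have "(2 * of_real pi * \<i>) ^ Suc n \<noteq> 0" by simp
  ultimately show su: "summable (\<lambda>j. polylog_series n (e z ^ Suc j))"
    by (simp add: g_def nat_add_distrib del: power_Suc)
  then have P: "(\<lambda>j. ?C * polylog_series n (e z ^ Suc j)) sums (?C * (\<Sum>j. polylog_series n (e z ^ Suc j)))"
    by (intro sums_mult summable_sums)
  then have 2: "(\<lambda>j. g (- int j - 1)) sums (?C * (\<Sum>j. polylog_series n (e z ^ Suc j)))"
    by (simp add: g_def nat_add_distrib add_ac del: power_Suc)
  from P have "(\<lambda>j. g (int (Suc j))) sums (?C * (\<Sum>j. polylog_series n (e z ^ Suc j)))"
    by (simp add: g_def nat_add_distrib del: power_Suc)
  then have 1: "(\<lambda>j. g (int j)) sums (?C * (\<Sum>j. polylog_series n (e z ^ Suc j)) + g 0)"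
    by (subst (asm) sums_Suc_iff) simp
  have "infsum ?E UNIV = ?C * (\<Sum>j. polylog_series n (e z ^ Suc j)) + g 0 + ?C * (\<Sum>j. polylog_series n (e z ^ Suc j))"
    by (rule has_sum_unique[OF G has_sum_int_halves[OF sG 1 2]])
  then show "infsum ?E UNIV = 2 * (?Z + ?C * (\<Sum>j. polylog_series n (e z ^ Suc j)))"
    by (simp add: g_def algebra_simps)
qed

text \<open>Both sides sum \<open>b\<^sup>n q\<^sup>a\<^sup>b\<close> over all pairs \<open>a, b \<ge> 1\<close>; the left-hand side groups them by \<open>a b = N + 1\<close>.\<close>

lemma lambert_series:
  fixes q :: complex
  assumes q: "cmod q < 1" and n: "n \<ge> 1"
  shows "(\<lambda>N. of_nat (divisor_sigma n (Suc N)) * q ^ Suc N) sums (\<Sum>j. polylog_series n (q ^ Suc j))"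
proof -
  define f where "f = (\<lambda>(a::nat, b::nat). of_nat (Suc b) ^ n * q ^ (Suc a * Suc b))"
  have sb: "summable (\<lambda>b. real (Suc b) ^ n * cmod q ^ b)"
  proof -
    have "summable (\<lambda>b. real b ^ n * cmod q ^ b)"
      using q by (intro summable_power_times_geometric) simp
    then have "summable (\<lambda>b. real (Suc b) ^ n * cmod q ^ Suc b)" by (subst summable_Suc_iff)
    then have *: "summable (\<lambda>b. cmod q * (real (Suc b) ^ n * cmod q ^ b))" by (simp add: mult_ac)
    show ?thesis
    proof (cases "q = 0")
      case True
      then show ?thesis by (intro summable_finite[of "{0}"]) (auto simp: zero_power)
    next
      case False
      with * show ?thesis by (subst (asm) summable_cmult_iff) simp
    qed
  qed
  \<comment> \<open>A majorant that splits as a product, from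
    \<open>|q|^((a+1)(b+1)) <= |q|^(a+b)\<close>.\<close>
  have "(\<lambda>(a, b). cmod q ^ a * (real (Suc b) ^ n * cmod q ^ b)) summable_on UNIV \<times> UNIV"
  proof (rule summable_on_product)
    show "(\<lambda>a. cmod q ^ a) summable_on UNIV"
      using q by (subst summable_on_UNIV_nonneg_real_iff) (auto intro: summable_geometric)
    show "(\<lambda>b. real (Suc b) ^ n * cmod q ^ b) summable_on UNIV"
      using sb by (subst summable_on_UNIV_nonneg_real_iff) auto
  qed auto
  moreover have "norm (f p) \<le> (case p of (a, b) \<Rightarrow> cmod q ^ a * (real (Suc b) ^ n * cmod q ^ b))" for p
  proof -
    obtain a b where p: "p = (a, b)" by fastforce
    have "cmod q ^ (Suc a * Suc b) \<le> cmod q ^ (a + b)"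
      using q by (intro power_decreasing) auto
    then have "real (Suc b) ^ n * cmod q ^ (Suc a * Suc b) \<le> real (Suc b) ^ n * cmod q ^ (a + b)"
      by (intro mult_left_mono) auto
    then show ?thesis
      by (simp add: p f_def norm_mult norm_power power_add mult_ac del: of_nat_Suc power_Suc mult_Suc mult_Suc_right)
  qed
  ultimately have "(\<lambda>p. norm (f p)) summable_on UNIV"
    by (intro Infinite_Sum.abs_summable_on_comparison_test') auto
  then have sf: "f summable_on UNIV" by (rule abs_summable_summable)
  then have S: "(f has_sum infsum f UNIV) (UNIV \<times> UNIV)" by (simp add: has_sum_infsum)
  have "((\<lambda>b. f (a, b)) has_sum polylog_series n (q ^ Suc a)) UNIV" for a
  proof -
    have "f summable_on range (\<lambda>b. (a, b))" using sf summable_on_subset_banach by blast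
    then have "(\<lambda>b. f (a, b)) summable_on UNIV"
      by (subst (asm) summable_on_reindex) (auto simp: inj_def o_def)
    then have h: "((\<lambda>b. f (a, b)) has_sum infsum (\<lambda>b. f (a, b)) UNIV) UNIV" by (rule has_sum_infsum)
    have "cmod (q ^ Suc a) < 1"
    proof -
      have "cmod q * cmod q ^ a \<le> cmod q * 1"
        using q by (intro mult_left_mono) (auto intro: power_le_one)
      with q show ?thesis by (simp add: norm_power norm_mult)
    qed
    then have "(\<lambda>b. of_nat b ^ n * (q ^ Suc a) ^ b) sums polylog_series n (q ^ Suc a)"
      unfolding polylog_series_def by (intro summable_sums summable_power_times_geometric)
    then have "(\<lambda>b. of_nat (Suc b) ^ n * (q ^ Suc a) ^ Suc b) sums polylog_series n (q ^ Suc a)"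
      using n by (subst sums_Suc_iff) (simp add: zero_power)
    then have "(\<lambda>b. f (a, b)) sums polylog_series n (q ^ Suc a)"
      by (simp add: f_def power_mult [symmetric] del: of_nat_Suc power_Suc mult_Suc mult_Suc_right)
    with has_sum_imp_sums[OF h] have "infsum (\<lambda>b. f (a, b)) UNIV = polylog_series n (q ^ Suc a)"
      by (rule sums_unique2)
    with h show ?thesis by simp
  qed
  then have "((\<lambda>a. polylog_series n (q ^ Suc a)) has_sum infsum f UNIV) UNIV"
    by (intro has_sum_SigmaD[OF S]) auto
  then have I: "infsum f UNIV = (\<Sum>j. polylog_series n (q ^ Suc j))"
    by (metis has_sum_imp_sums sums_unique)
  \<comment> \<open>New coordinates: \<open>Suc b\<close> is a divisor of \<open>Suc N\<close>, and
    its cofactor is \<open>Suc a\<close>.\<close>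
  define h where "h = (\<lambda>(N::nat, b::nat). of_nat (Suc b) ^ n * q ^ Suc N)"
  have "(f has_sum infsum f UNIV) UNIV \<longleftrightarrow> (h has_sum infsum f UNIV) (Sigma UNIV (\<lambda>N. {b. Suc b dvd Suc N}))"
  proof (rule has_sum_reindex_bij_witness[of _ "\<lambda>(N, b). (Suc N div Suc b - 1, b)" "\<lambda>(a, b). (Suc a * Suc b - 1, b)"], goal_cases)
    case (1 p) then show ?case by (auto simp del: mult_Suc mult_Suc_right split: prod.splits)
  next
    case (2 p)
    have "Suc (Suc a * Suc b - 1) = Suc a * Suc b" for a b by simp
    then show ?case by (auto simp del: mult_Suc mult_Suc_right split: prod.splits)
  next
    case (3 p)
    obtain N b where p: "p = (N, b)" by fastforce
    with 3 have d: "Suc b dvd Suc N" by simp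
    then have "Suc (Suc N div Suc b - 1) = Suc N div Suc b"
    proof -
      have "Suc N div Suc b > 0" using d by (simp add: div_greater_zero_iff dvd_imp_le del: Suc_le_mono)
      then show ?thesis by simp
    qed
    then have "Suc (Suc N div Suc b - 1) * Suc b = Suc N" using d by (simp only: dvd_div_mult_self)
    then show ?case by (simp only: p split) simp
  next
    case (4 p) then show ?case by auto
  next
    case (5 p)
    have "Suc (Suc a * Suc b - 1) = Suc a * Suc b" for a b by simp
    then show ?case by (simp only: f_def h_def split: prod.splits) simp
  qed auto
  then have H: "(h has_sum infsum f UNIV) (Sigma UNIV (\<lambda>N. {b. Suc b dvd Suc N}))" using S by simp
  have "((\<lambda>b. h (N, b)) has_sum of_nat (divisor_sigma n (Suc N)) * q ^ Suc N) {b. Suc b dvd Suc N}" for N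
  proof -
    have fin: "finite {b. Suc b dvd Suc N}"
      by (rule finite_subset[of _ "{..N}"]) (auto dest: dvd_imp_le)
    have "(\<Sum>b | Suc b dvd Suc N. Suc b ^ n) = divisor_sigma n (Suc N)"
      unfolding divisor_sigma_def
    proof (rule sum.reindex_bij_witness[of _ "\<lambda>t. t - 1" Suc], goal_cases)
      case (4 t)
      then have "t > 0" by (auto intro: Nat.gr0I)
      with 4 show ?case by simp
    qed (auto simp: Suc_pred intro!: Suc_pred Nat.gr0I)
    then have "sum (\<lambda>b. h (N, b)) {b. Suc b dvd Suc N} = of_nat (divisor_sigma n (Suc N)) * q ^ Suc N"
      unfolding h_def split by (simp flip: sum_distrib_right del: of_nat_Suc power_Suc)
         (metis (no_types, lifting) of_nat_power of_nat_sum sum.cong)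
    with has_sum_finite[OF fin, of "\<lambda>b. h (N, b)"] show ?thesis by simp
  qed
  then have "((\<lambda>N. of_nat (divisor_sigma n (Suc N)) * q ^ Suc N) has_sum infsum f UNIV) UNIV"
    by (intro has_sum_SigmaD[OF H]) auto
  then show ?thesis unfolding I by (rule has_sum_imp_sums)
qed

text \<open>The factor is \<open>2 zeta(4)\<close>, with \<open>zeta(4) = pi^4 / 90\<close>; in
  weight six it is \<open>2 zeta(6)\<close>, with \<open>zeta(6) = pi^6 / 945\<close>.\<close>

lemma eisenstein_E4:
  assumes "Im z > 0" shows "infsum (eisenstein_term 4 z) UNIV = of_real pi ^ 4 / 45 * E4 z"
proof -
  have f: "fact 3 = (6 :: complex)" by (simp add: eval_nat_numeral)
  have "(2 * of_real pi * \<i>) ^ 4 = 16 * of_real pi ^ 4" by (simp add: power_mult_distrib)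
  moreover have "(\<Sum>j. polylog_series 3 (e z ^ Suc j)) = (\<Sum>n. of_nat (divisor_sigma 3 (Suc n)) * e (of_nat (Suc n) * z))"
    using sums_unique[OF lambert_series[OF norm_e_less_1[OF assms], of 3]]
    by (simp add: e_of_nat_mult del: of_nat_Suc power_Suc)
  moreover have "2 * (2 * of_real pi ^ 4 / (2 * 6 * (2 ^ 4 - 1)) + 16 * of_real pi ^ 4 / 6 * S) = of_real pi ^ 4 / 45 * (1 + 240 * S)" for S :: complex
    by (simp add: field_simps)
  ultimately show ?thesis
    using eisenstein_q_expansion(1)[OF assms, of 3] polycot_half
    by (simp add: E4_def f algebra_simps del: of_nat_Suc power_Suc)
qed

lemma eisenstein_E6:
  assumes "Im z > 0" shows "infsum (eisenstein_term 6 z) UNIV = 2 * of_real pi ^ 6 / 945 * E6 z"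
proof -
  have f: "fact 5 = (120 :: complex)" by (simp add: eval_nat_numeral)
  have "(2 * of_real pi * \<i>) ^ 6 = - 64 * of_real pi ^ 6" by (simp add: power_mult_distrib power_eq_if[of \<i>])
  moreover have "(\<Sum>j. polylog_series 5 (e z ^ Suc j)) = (\<Sum>n. of_nat (divisor_sigma 5 (Suc n)) * e (of_nat (Suc n) * z))"
    using sums_unique[OF lambert_series[OF norm_e_less_1[OF assms], of 5]]
    by (simp add: e_of_nat_mult del: of_nat_Suc power_Suc)
  moreover have "2 * (16 * of_real pi ^ 6 / (2 * 120 * (2 ^ 6 - 1)) + - 64 * of_real pi ^ 6 / 120 * S) = 2 * of_real pi ^ 6 / 945 * (1 - 504 * S)" for S :: complex
    by (simp add: field_simps)
  ultimately show ?thesis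
    using eisenstein_q_expansion(1)[OF assms, of 5] polycot_half
    by (simp add: E6_def f algebra_simps del: of_nat_Suc power_Suc)
qed

subsection \<open>Modularity of the Eisenstein series\<close>

text \<open>\<open>(p, q, r, s)\<close> stands for the matrix with rows \<open>(p, q)\<close> and \<open>(r, s)\<close>.\<close>

type_synonym mat2 = "int \<times> int \<times> int \<times> int"

fun mob :: "mat2 \<Rightarrow> complex \<Rightarrow> complex" where
  "mob (p, q, r, s) z = (of_int p * z + of_int q) / (of_int r * z + of_int s)"

fun mdet :: "mat2 \<Rightarrow> int" where
  "mdet (p, q, r, s) = p * s - q * r"

fun mmul :: "mat2 \<Rightarrow> mat2 \<Rightarrow> mat2" where
  "mmul (p, q, r, s) (p', q', r', s') =
     (p * p' + q * r', p * q' + q * s', r * p' + s * r', r * q' + s * s')"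

lemma of_int_denominator_nonzero:
  assumes "Im z > 0" "(r, s) \<noteq> (0, 0)"
  shows "of_int r * z + of_int s \<noteq> 0"
proof
  assume *: "of_int r * z + of_int s = 0"
  from arg_cong[OF this, of Im] assms(1) have "r = 0" by simp
  with * assms(2) show False by simp
qed

lemma Im_mob:
  assumes "Im z > 0" "(r, s) \<noteq> (0, 0)"
  shows "Im (mob (p, q, r, s) z) = of_int (mdet (p, q, r, s)) * Im z / (cmod (of_int r * z + of_int s))\<^sup>2"
proof -
  have "mob (p, q, r, s) z = (of_int p * z + of_int q) * cnj (of_int r * z + of_int s) / of_real ((cmod (of_int r * z + of_int s))\<^sup>2)"
    by (simp only: mob.simps complex_div_cnj[of "of_int p * z + of_int q"] of_real_power)
  then show ?thesis
    by (simp add: Im_divide_of_real algebra_simps)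
qed

lemma Im_mob_pos: "Im z > 0 \<Longrightarrow> mdet M > 0 \<Longrightarrow> Im (mob M z) > 0"
proof (cases M)
  case (fields p q r s)
  assume *: "Im z > 0" "mdet M > 0"
  then have rs: "(r, s) \<noteq> (0, 0)" using fields by auto
  then show ?thesis
    using * of_int_denominator_nonzero[OF *(1) rs] unfolding fields Im_mob[OF *(1) rs]
    by (intro divide_pos_pos mult_pos_pos) (simp_all only: of_int_0_less_iff zero_less_power2 norm_eq_zero not_False_eq_True)
qed

lemma mdet_mmul: "mdet (mmul M N) = mdet M * mdet N"
  by (cases M; cases N) (simp add: algebra_simps)

lemma mmul_assoc: "mmul (mmul M N) K = mmul M (mmul N K)"
  by (cases M; cases N; cases K) (simp add: algebra_simps)

lemma mob_mmul:
  assumes "Im z > 0" "mdet N \<noteq> 0"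
  shows "mob (mmul M N) z = mob M (mob N z)"
proof -
  obtain p q r s p' q' r' s' where MN: "M = (p', q', r', s')" "N = (p, q, r, s)"
    by (metis surj_pair)
  define d where "d = of_int r * z + of_int s"
  have d: "d \<noteq> 0" unfolding d_def using assms MN
    by (intro of_int_denominator_nonzero) auto
  define P where "P = of_int p * z + of_int q"
  have "of_int x * (P / d) + of_int y = (of_int x * P + of_int y * d) / d" for x y
    using d by (simp add: add_divide_distrib)
  then have "mob M (mob N z) = ((of_int p' * P + of_int q' * d) / d) / ((of_int r' * P + of_int s' * d) / d)"
    by (simp only: MN mob.simps flip: P_def d_def)
  also have "\<dots> = (of_int p' * P + of_int q' * d) / (of_int r' * P + of_int s' * d)"
    using d by simp
  also have "\<dots> = mob (mmul M N) z"
    by (simp add: MN d_def P_def algebra_simps)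
  finally show ?thesis by simp
qed

text \<open>Multiplying the row vector \<open>(m, n)\<close> by the matrix from the right permutes
  \<open>Z x Z\<close>, and each term picks up the \<open>k\<close>-th power of the
  denominator.\<close>

lemma infsum_eisenstein_mob:
  assumes "Im z > 0" "p * s - q * r = 1"
  shows "infsum (eisenstein_term k (mob (p, q, r, s) z)) UNIV
           = (of_int r * z + of_int s) ^ k * infsum (eisenstein_term k z) UNIV"
proof -
  define d where "d = of_int r * z + of_int s"
  have d: "d \<noteq> 0" unfolding d_def using assms
    by (intro of_int_denominator_nonzero) auto
  define h where "h = (\<lambda>(m, n). (m * p + n * r, m * q + n * s))"
  have "bij_betw h UNIV UNIV"
  proof (rule bij_betw_byWitness[where f' = "\<lambda>(m, n). (m * s - n * r, n * p - m * q)"]; (intro ballI)?)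
    fix x :: "int \<times> int"
    obtain m n where x: "x = (m, n)" by (cases x)
    have "(m * p + n * r) * s - (m * q + n * s) * r = m * (p * s - q * r)"
         "(m * q + n * s) * p - (m * p + n * r) * q = n * (p * s - q * r)"
         "(m * s - n * r) * p + (n * p - m * q) * r = m * (p * s - q * r)"
         "(m * s - n * r) * q + (n * p - m * q) * s = n * (p * s - q * r)"
      by (simp_all add: algebra_simps)
    note eqs = this[unfolded assms(2) mult_1_right]
    show "(case h x of (m, n) \<Rightarrow> (m * s - n * r, n * p - m * q)) = x"
      by (simp only: h_def x split eqs)
    show "h (case x of (m, n) \<Rightarrow> (m * s - n * r, n * p - m * q)) = x"
      by (simp only: h_def x split eqs)
  qed simp_all
  then have "infsum (\<lambda>x. eisenstein_term k z (h x)) UNIV = infsum (eisenstein_term k z) UNIV"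
    by (rule infsum_reindex_bij_betw)
  moreover
  have "eisenstein_term k (mob (p, q, r, s) z) x = d ^ k * eisenstein_term k z (h x)" for x
  proof -
    obtain m n where x: "x = (m, n)" by fastforce
    have "of_int m * mob (p, q, r, s) z + of_int n = (of_int (m * p + n * r) * z + of_int (m * q + n * s)) / d"
      using d by (simp add: d_def field_simps)
    then show ?thesis
      by (simp add: x eisenstein_term_def h_def power_divide)
  qed
  then have "eisenstein_term k (mob (p, q, r, s) z) = (\<lambda>x. d ^ k * eisenstein_term k z (h x))"
    by (rule ext)
  ultimately show ?thesis
    by (simp only: infsum_cmult_right' flip: d_def)
qed

lemma E4_mob:
  assumes "Im z > 0" "p * s - q * r = 1"
  shows "E4 (mob (p, q, r, s) z) = (of_int r * z + of_int s) ^ 4 * E4 z"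
proof -
  have "Im (mob (p, q, r, s) z) > 0" by (rule Im_mob_pos) (use assms in auto)
  then show ?thesis
    using infsum_eisenstein_mob[OF assms, of 4] assms by (simp add: eisenstein_E4 del: mob.simps)
qed

lemma E6_mob:
  assumes "Im z > 0" "p * s - q * r = 1"
  shows "E6 (mob (p, q, r, s) z) = (of_int r * z + of_int s) ^ 6 * E6 z"
proof -
  have "Im (mob (p, q, r, s) z) > 0" by (rule Im_mob_pos) (use assms in auto)
  then show ?thesis
    using infsum_eisenstein_mob[OF assms, of 6] assms by (simp add: eisenstein_E6 del: mob.simps)
qed

text \<open>\<open>1728\<close> times the discriminant cusp form of weight 12.\<close>

definition delta_form :: "complex \<Rightarrow> complex" where
  "delta_form z = E4 z ^ 3 - E6 z ^ 2"

lemma delta_form_mob: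
  assumes "Im z > 0" "p * s - q * r = 1"
  shows "delta_form (mob (p, q, r, s) z) = (of_int r * z + of_int s) ^ 12 * delta_form z"
  unfolding delta_form_def E4_mob[OF assms] E6_mob[OF assms]
  by (simp add: power_mult_distrib right_diff_distrib flip: power_mult)

lemma klein_j_delta_form: "klein_j z = 1728 * E4 z ^ 3 / delta_form z"
  by (simp add: klein_j_def delta_form_def)

theorem klein_j_mob:
  assumes "Im z > 0" "mdet M = 1"
  shows "klein_j (mob M z) = klein_j z"
proof -
  obtain p q r s where M: "M = (p, q, r, s)" by (metis surj_pair)
  have 1: "p * s - q * r = 1" using assms M by simp
  have "of_int r * z + of_int s \<noteq> 0" using assms M by (intro of_int_denominator_nonzero) auto
  then show ?thesis
    unfolding M by (simp add: klein_j_delta_form delta_form_mob[OF assms(1) 1] E4_mob[OF assms(1) 1] power_mult_distrib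
        del: mob.simps flip: power_mult)
qed

subsection \<open>Expansions in \<open>q\<close>\<close>

text \<open>The exponent is \<open>N\<close>, not \<open>N + 1\<close>: the factor \<open>q\<close>
  is split off so that it can later be cancelled exactly from \<open>delta_form\<close>.\<close>

definition sigma_series :: "nat \<Rightarrow> complex \<Rightarrow> complex" where
  "sigma_series n q = (\<Sum>N. of_nat (divisor_sigma n (Suc N)) * q ^ N)"

lemma divisor_sigma_le: "divisor_sigma n (Suc N) \<le> Suc N ^ Suc n"
proof -
  have "{t. t dvd Suc N} \<subseteq> {1..Suc N}"
    using dvd_imp_le[of _ "Suc N"] dvd_pos_nat[of "Suc N"] by (auto simp: Suc_le_eq)
  then have "card {t. t dvd Suc N} \<le> Suc N" using card_mono[of "{1..Suc N}"] by fastforce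
  moreover have "divisor_sigma n (Suc N) \<le> card {t. t dvd Suc N} * Suc N ^ n"
    unfolding divisor_sigma_def
    by (intro order.trans[OF sum_bounded_above[where K = "Suc N ^ n"]] power_mono) (auto dest: dvd_imp_le)
  ultimately show ?thesis by (metis le_trans mult_le_mono1 power_Suc)
qed

lemma summable_sigma_series:
  assumes "cmod q < 1"
  shows "summable (\<lambda>N. of_nat (divisor_sigma n (Suc N)) * q ^ N)"
proof (cases "q = 0")
  case True
  then show ?thesis by (intro summable_finite[of "{0}"]) (auto simp: zero_power)
next
  case False
  have "summable (\<lambda>N. real (Suc N) ^ Suc n * cmod q ^ Suc N)"
    using assms summable_power_times_geometric[of "cmod q" "Suc n"] by (subst summable_Suc_iff) simp
  then have "summable (\<lambda>N. cmod q * (real (Suc N) ^ Suc n * cmod q ^ N))" by (simp add: mult_ac)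
  then have s: "summable (\<lambda>N. real (Suc N) ^ Suc n * cmod q ^ N)"
    using False by (subst (asm) summable_cmult_iff) simp
  have "norm (of_nat (divisor_sigma n (Suc N)) * q ^ N) \<le> real (Suc N) ^ Suc n * cmod q ^ N" for N
    using divisor_sigma_le[of n N]
    by (auto simp: norm_mult norm_power simp del: of_nat_Suc power_Suc intro!: mult_right_mono)
  then show ?thesis by (intro summable_comparison_test'[OF s, of 0]) auto
qed

lemma sigma_series_holomorphic: "sigma_series n holomorphic_on ball 0 1"
proof (rule power_series_holomorphic[of 0 1 "\<lambda>N. of_nat (divisor_sigma n (Suc N))"])
  fix q :: complex assume "q \<in> ball 0 1"
  then show "(\<lambda>N. of_nat (divisor_sigma n (Suc N)) * (q - 0) ^ N) sums sigma_series n q"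
    unfolding sigma_series_def using summable_sigma_series[of q n] by (simp add: summable_sums)
qed

lemma sum_e_sigma:
  assumes "Im z > 0"
  shows "(\<Sum>N. of_nat (divisor_sigma n (Suc N)) * e (of_nat (Suc N) * z)) = e z * sigma_series n (e z)"
proof -
  have "(\<Sum>N. of_nat (divisor_sigma n (Suc N)) * e (of_nat (Suc N) * z)) =
        (\<Sum>N. e z * (of_nat (divisor_sigma n (Suc N)) * e z ^ N))"
    by (simp only: e_of_nat_mult) (simp add: mult_ac del: of_nat_Suc)
  also have "\<dots> = e z * sigma_series n (e z)"
    unfolding sigma_series_def by (rule suminf_mult[OF summable_sigma_series[OF norm_e_less_1[OF assms]]])
  finally show ?thesis .
qed

lemma E4_sigma_series: "Im z > 0 \<Longrightarrow> E4 z = 1 + 240 * (e z * sigma_series 3 (e z))"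
  and E6_sigma_series: "Im z > 0 \<Longrightarrow> E6 z = 1 - 504 * (e z * sigma_series 5 (e z))"
  by (simp_all only: E4_def E6_def sum_e_sigma)

text \<open>Two coefficients are kept exactly. The others satisfy
  \<open>sigma_n(N + 3) <= (N + 3)^(n + 1)\<close>, which \<open>C * K^N\<close> dominates, so the
  tail is at most a geometric series of ratio \<open>K / 200\<close>.\<close>

lemma sigma_series_tail:
  assumes q: "cmod q \<le> 1 / 200" and K: "\<And>N. real (N + 3) ^ Suc n \<le> C * K ^ N" "K \<ge> 0" "K < 100"
  obtains t where "sigma_series n q = 1 + (1 + 2 ^ n) * q + q\<^sup>2 * t" "cmod t \<le> C / (1 - K / 200)"
proof
  let ?f = "\<lambda>N. of_nat (divisor_sigma n (Suc N)) * q ^ N"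
  let ?t = "\<Sum>N. of_nat (divisor_sigma n (Suc (N + 2))) * q ^ N"
  have q1: "cmod q < 1" using q by simp
  have "0 \<le> real (0 + 3) ^ Suc n" by simp
  also have "\<dots> \<le> C" using K(1)[of 0] by simp
  finally have C: "C \<ge> 0" .
  have d1: "divisor_sigma n (Suc 0) = 1" by (simp add: divisor_sigma_def)
  have "t dvd 2 \<longleftrightarrow> t = 1 \<or> t = 2" for t :: nat
    using two_is_prime_nat unfolding prime_nat_iff by auto
  then have "{t. t dvd Suc (Suc 0)} = {1, 2}"
    unfolding numeral_2_eq_2 by auto
  then have d2: "divisor_sigma n (Suc (Suc 0)) = 1 + 2 ^ n" by (simp add: divisor_sigma_def)
  have s: "summable ?f" by (rule summable_sigma_series[OF q1])
  have b: "norm (of_nat (divisor_sigma n (Suc (N + 2))) * q ^ N) \<le> C * (K / 200) ^ N" for N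
  proof -
    have "real (divisor_sigma n (Suc (N + 2))) \<le> real (N + 3) ^ Suc n"
      using divisor_sigma_le[of n "N + 2"]
      by (metis Suc3_eq_add_3 add.commute add_2_eq_Suc' of_nat_le_iff of_nat_power)
    then have "norm (of_nat (divisor_sigma n (Suc (N + 2))) * q ^ N) \<le> (C * K ^ N) * (1 / 200) ^ N"
      using K(1)[of N] q by (simp only: norm_mult norm_power norm_of_nat) (intro mult_mono power_mono; simp)
    then show ?thesis by (simp add: power_divide mult.assoc)
  qed
  have g: "(\<lambda>N. C * (K / 200) ^ N) sums (C * (1 / (1 - K / 200)))"
    using K by (intro sums_mult geometric_sums) auto
  have st: "summable (\<lambda>N. norm (of_nat (divisor_sigma n (Suc (N + 2))) * q ^ N))"
    by (rule summable_comparison_test'[OF sums_summable[OF g], of 0]) (use b in auto)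
  have "cmod ?t \<le> (\<Sum>N. norm (of_nat (divisor_sigma n (Suc (N + 2))) * q ^ N))"
    by (rule summable_norm[OF st])
  also have "\<dots> \<le> (\<Sum>N. C * (K / 200) ^ N)"
    by (rule suminf_le[OF b st sums_summable[OF g]])
  also have "\<dots> = C / (1 - K / 200)" using sums_unique[OF g] by simp
  finally show "cmod ?t \<le> C / (1 - K / 200)" .
  have "sigma_series n q = (\<Sum>N. ?f (N + 2)) + (\<Sum>N<2. ?f N)"
    unfolding sigma_series_def by (rule suminf_split_initial_segment[OF s])
  also have "(\<Sum>N<2. ?f N) = 1 + (1 + 2 ^ n) * q" by (simp add: numeral_2_eq_2 d1 d2)
  also have "(\<Sum>N. ?f (N + 2)) = (\<Sum>N. q\<^sup>2 * (of_nat (divisor_sigma n (Suc (N + 2))) * q ^ N))"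
    by (simp only: power_add mult_ac)
  also have "\<dots> = q\<^sup>2 * ?t" by (rule suminf_mult[OF summable_norm_cancel[OF st]])
  finally show "sigma_series n q = 1 + (1 + 2 ^ n) * q + q\<^sup>2 * ?t" by simp
qed

text \<open>Consecutive values of \<open>N + 3\<close> grow by a factor of at most
  \<open>4/3\<close>. The ratios used below are \<open>4 >= (4/3)^4\<close> and
  \<open>6 >= (4/3)^6\<close>.\<close>

lemma shifted_power_le:
  assumes "(4 / 3 :: real) ^ n \<le> K"
  shows "real (N + 3) ^ n \<le> 3 ^ n * K ^ N"
proof (induction N)
  case (Suc N)
  have "real (Suc N + 3) \<le> 4 / 3 * real (N + 3)" by simp
  then have "real (Suc N + 3) ^ n \<le> (4 / 3 * real (N + 3)) ^ n" by (intro power_mono) auto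
  also have "\<dots> = (4 / 3) ^ n * real (N + 3) ^ n" by (rule power_mult_distrib)
  also have "\<dots> \<le> K * (3 ^ n * K ^ N)" using assms Suc by (intro mult_mono) (auto intro: order.trans[OF _ assms])
  finally show ?case by (simp add: mult_ac)
qed simp

lemma sigma_series_3:
  assumes "cmod q \<le> 1 / 200"
  obtains a where "sigma_series 3 q = 1 + 9 * q + q\<^sup>2 * a" "cmod a \<le> 83"
proof -
  have "real (N + 3) ^ Suc 3 \<le> 81 * 4 ^ N" for N
    using shifted_power_le[of 4 4 N] by (simp add: power_divide)
  note * = sigma_series_tail[OF assms this]
  show ?thesis
  proof (rule *)
    fix t assume "sigma_series 3 q = 1 + (1 + 2 ^ 3) * q + q\<^sup>2 * t" "cmod t \<le> 81 / (1 - 4 / 200)"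
    then show ?thesis by (intro that[of t]) simp_all
  qed simp_all
qed

lemma sigma_series_5:
  assumes "cmod q \<le> 1 / 200"
  obtains b where "sigma_series 5 q = 1 + 33 * q + q\<^sup>2 * b" "cmod b \<le> 752"
proof -
  have "real (N + 3) ^ Suc 5 \<le> 729 * 6 ^ N" for N
    using shifted_power_le[of 6 6 N] by (simp add: power_divide)
  note * = sigma_series_tail[OF assms this]
  show ?thesis
  proof (rule *)
    fix t assume "sigma_series 5 q = 1 + (1 + 2 ^ 5) * q + q\<^sup>2 * t" "cmod t \<le> 729 / (1 - 6 / 200)"
    then show ?thesis by (intro that[of t]) simp_all
  qed simp_all
qed

text \<open>\<open>(E4^3 - E6^2) / (1728 q)\<close> multiplied out: the constant terms
  \<open>1\<close> cancel, which leaves a factor \<open>q\<close> to divide by.\<close>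

definition delta_series :: "complex \<Rightarrow> complex" where
  "delta_series q = (720 * sigma_series 3 q + 1008 * sigma_series 5 q + 172800 * q * sigma_series 3 q ^ 2
     - 254016 * q * sigma_series 5 q ^ 2 + 13824000 * q\<^sup>2 * sigma_series 3 q ^ 3) / 1728"

lemma delta_form_series: "Im z > 0 \<Longrightarrow> delta_form z = 1728 * e z * delta_series (e z)"
  by (simp add: delta_form_def delta_series_def E4_sigma_series E6_sigma_series power2_eq_square power3_eq_cube algebra_simps)

lemma delta_series_estimate:
  assumes q: "cmod q \<le> 1 / 200"
  obtains \<epsilon> \<gamma> where "delta_series q = 1 - 24 * q + q\<^sup>2 * \<epsilon>" "cmod \<epsilon> \<le> 24000"
    "(1 + 240 * (q * sigma_series 3 q)) ^ 3 = 1 + 720 * q + q\<^sup>2 * \<gamma>" "cmod \<gamma> \<le> 280000"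
proof -
  obtain a where a: "sigma_series 3 q = 1 + 9 * q + q\<^sup>2 * a" "cmod a \<le> 83"
    using sigma_series_3[OF q] by blast
  obtain b where b: "sigma_series 5 q = 1 + 33 * q + q\<^sup>2 * b" "cmod b \<le> 752"
    using sigma_series_5[OF q] by blast
  \<comment> \<open>With \<open>s3\<close>, \<open>s5\<close> for the two sigma series:
    \<open>s3^2 = 1 + q U\<close>, \<open>s5^2 = 1 + q V\<close> and \<open>W = s3^3\<close>. Thus
    everything beyond the linear term of \<open>delta_series\<close> has an explicit factor
    \<open>q^2\<close>.\<close>
  define U where "U = 18 + (81 + 2 * a) * q + 18 * a * q\<^sup>2 + a\<^sup>2 * q ^ 3"
  define V where "V = 66 + (1089 + 2 * b) * q + 66 * b * q\<^sup>2 + b\<^sup>2 * q ^ 3"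
  define W where "W = (1 + 9 * q + q\<^sup>2 * a) ^ 3"
  define \<epsilon> where "\<epsilon> = (720 * a + 1008 * b + 172800 * U - 254016 * V + 13824000 * W) / 1728"
  define \<gamma> where "\<gamma> = 720 * (9 + q * a) + 172800 * (1 + 9 * q + q\<^sup>2 * a)\<^sup>2 + 13824000 * q * W"
  have q2: "cmod q ^ 2 \<le> (1 / 200) ^ 2" and q3: "cmod q ^ 3 \<le> (1 / 200) ^ 3"
    using q by (intro power_mono; simp)+
  have a2: "cmod a ^ 2 \<le> 83 ^ 2" and b2: "cmod b ^ 2 \<le> 752 ^ 2"
    using a b by (intro power_mono; simp)+
  have nA: "cmod (1 + 9 * q + q\<^sup>2 * a) \<le> 1.048"
  proof -
    have "cmod (1 + 9 * q + q\<^sup>2 * a) \<le> 1 + 9 * cmod q + cmod q ^ 2 * cmod a"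
      by (rule order.trans[OF norm_triangle_ineq] add_mono)+ (simp_all add: norm_mult norm_power)
    also have "\<dots> \<le> 1 + 9 * (1 / 200) + (1 / 200) ^ 2 * 83"
      using q a q2 by (intro add_mono mult_mono) auto
    also have "\<dots> \<le> 1.048" by (simp add: power2_eq_square)
    finally show ?thesis .
  qed
  have nU: "cmod U \<le> 19.4"
  proof -
    have "cmod U \<le> cmod 18 + cmod ((81 + 2 * a) * q) + cmod (18 * a * q\<^sup>2) + cmod (a\<^sup>2 * q ^ 3)"
      unfolding U_def by (rule order.trans[OF norm_triangle_ineq] add_mono order.refl)+
    also have "\<dots> \<le> 18 + (81 + 2 * cmod a) * cmod q + 18 * cmod a * cmod q ^ 2 + cmod a ^ 2 * cmod q ^ 3"
      by (intro add_mono) (auto simp: norm_mult norm_power intro!: mult_right_mono order.trans[OF norm_triangle_ineq])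
    also have "\<dots> \<le> 18 + (81 + 2 * 83) * (1 / 200) + 18 * 83 * (1 / 200) ^ 2 + 83 ^ 2 * (1 / 200) ^ 3"
      using q a q2 q3 a2 by (intro add_mono mult_mono) auto
    also have "\<dots> \<le> 19.4" by (simp add: power2_eq_square power3_eq_cube)
    finally show ?thesis .
  qed
  have nV: "cmod V \<le> 80.4"
  proof -
    have "cmod V \<le> cmod 66 + cmod ((1089 + 2 * b) * q) + cmod (66 * b * q\<^sup>2) + cmod (b\<^sup>2 * q ^ 3)"
      unfolding V_def by (rule order.trans[OF norm_triangle_ineq] add_mono order.refl)+
    also have "\<dots> \<le> 66 + (1089 + 2 * cmod b) * cmod q + 66 * cmod b * cmod q ^ 2 + cmod b ^ 2 * cmod q ^ 3"
      by (intro add_mono) (auto simp: norm_mult norm_power intro!: mult_right_mono order.trans[OF norm_triangle_ineq])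
    also have "\<dots> \<le> 66 + (1089 + 2 * 752) * (1 / 200) + 66 * 752 * (1 / 200) ^ 2 + 752 ^ 2 * (1 / 200) ^ 3"
      using q b q2 q3 b2 by (intro add_mono mult_mono) auto
    also have "\<dots> \<le> 80.4" by (simp add: power2_eq_square power3_eq_cube)
    finally show ?thesis .
  qed
  have nW: "cmod W \<le> 1.152"
  proof -
    have "cmod W = cmod (1 + 9 * q + q\<^sup>2 * a) ^ 3" by (simp add: W_def norm_power)
    also have "\<dots> \<le> 1.048 ^ 3" using nA by (intro power_mono) auto
    also have "\<dots> \<le> 1.152" by (simp add: power3_eq_cube)
    finally show ?thesis .
  qed
  have "cmod (720 * a + 1008 * b + 172800 * U - 254016 * V + 13824000 * W) \<le>
      cmod (720 * a) + cmod (1008 * b) + cmod (172800 * U) + cmod (254016 * V) + cmod (13824000 * W)"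
    by (rule order.trans[OF norm_triangle_ineq] order.trans[OF norm_triangle_ineq4] add_mono order.refl)+
  also have "\<dots> \<le> 720 * 83 + 1008 * 752 + 172800 * 19.4 + 254016 * 80.4 + 13824000 * 1.152"
    using a b nU nV nW by (intro add_mono) (simp_all add: norm_mult)
  finally have n\<epsilon>: "cmod \<epsilon> \<le> 24000" by (simp add: \<epsilon>_def norm_divide)
  have n\<gamma>: "cmod \<gamma> \<le> 280000"
  proof -
    have "cmod \<gamma> \<le> cmod (720 * (9 + q * a)) + cmod (172800 * (1 + 9 * q + q\<^sup>2 * a)\<^sup>2) + cmod (13824000 * q * W)"
      unfolding \<gamma>_def by (rule order.trans[OF norm_triangle_ineq] add_mono order.refl)+
    also have "\<dots> \<le> 720 * (9 + cmod q * cmod a) + 172800 * cmod (1 + 9 * q + q\<^sup>2 * a) ^ 2 + 13824000 * cmod q * cmod W"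
      by (intro add_mono) (auto simp: norm_mult norm_power intro: order.trans[OF norm_triangle_ineq])
    also have "\<dots> \<le> 720 * (9 + 1 / 200 * 83) + 172800 * 1.048 ^ 2 + 13824000 * (1 / 200) * 1.152"
      using q a nA nW by (intro add_mono mult_mono power_mono) auto
    also have "\<dots> \<le> 280000" by (simp add: power2_eq_square)
    finally show ?thesis .
  qed
  show ?thesis
  proof (rule that[OF _ n\<epsilon> _ n\<gamma>])
    show "delta_series q = 1 - 24 * q + q\<^sup>2 * \<epsilon>"
      unfolding delta_series_def a b \<epsilon>_def U_def V_def W_def
      by (simp add: field_simps power2_eq_square power3_eq_cube)
    show "(1 + 240 * (q * sigma_series 3 q)) ^ 3 = 1 + 720 * q + q\<^sup>2 * \<gamma>"
      unfolding a \<gamma>_def W_def by (simp add: field_simps power2_eq_square power3_eq_cube)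
  qed
qed

text \<open>\<open>1 - 24/200 - 24000/200^2 = 0.28\<close>.\<close>

lemma delta_series_lower_bound:
  assumes q: "cmod q \<le> 1 / 200"
  shows "cmod (delta_series q) \<ge> 0.28"
proof -
  obtain \<epsilon> \<gamma> where *: "delta_series q = 1 - 24 * q + q\<^sup>2 * \<epsilon>" "cmod \<epsilon> \<le> 24000"
    using delta_series_estimate[OF q] by metis
  have "cmod (24 * q - q\<^sup>2 * \<epsilon>) \<le> cmod (24 * q) + cmod (q\<^sup>2 * \<epsilon>)" by (rule norm_triangle_ineq4)
  also have "\<dots> = 24 * cmod q + cmod q ^ 2 * cmod \<epsilon>" by (simp add: norm_mult norm_power)
  also have "\<dots> \<le> 24 * (1 / 200) + (1 / 200) ^ 2 * 24000"
    using q * by (intro add_mono mult_mono power_mono) auto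
  also have "\<dots> = 0.72" by (simp add: power2_eq_square)
  finally have "cmod (24 * q - q\<^sup>2 * \<epsilon>) \<le> 0.72" .
  moreover have "delta_series q = 1 - (24 * q - q\<^sup>2 * \<epsilon>)" using * by simp
  ultimately show ?thesis
    using norm_triangle_ineq2[of 1 "24 * q - q\<^sup>2 * \<epsilon>"] by simp
qed

lemma klein_j_series:
  assumes "Im z > 0"
  shows "klein_j z = (1 + 240 * (e z * sigma_series 3 (e z))) ^ 3 / (e z * delta_series (e z))"
  unfolding klein_j_delta_form delta_form_series[OF assms] E4_sigma_series[OF assms]
  by simp

theorem klein_j_near_cusp:
  assumes "Im z > 0" "cmod (e z) \<le> 1 / 200"
  shows "cmod (klein_j z - 744 - e (- z)) \<le> 1500000 * cmod (e z)"
proof -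
  define q where "q = e z"
  obtain \<epsilon> \<gamma> where *: "delta_series q = 1 - 24 * q + q\<^sup>2 * \<epsilon>" "cmod \<epsilon> \<le> 24000"
    "(1 + 240 * (q * sigma_series 3 q)) ^ 3 = 1 + 720 * q + q\<^sup>2 * \<gamma>" "cmod \<gamma> \<le> 280000"
    using delta_series_estimate assms unfolding q_def by metis
  have lb: "cmod (delta_series q) \<ge> 0.28" using delta_series_lower_bound assms by (simp add: q_def)
  then have n0: "delta_series q \<noteq> 0" by auto
  have q0: "q \<noteq> 0" by (simp add: q_def)
  have q: "cmod q \<le> 1 / 200" using assms by (simp add: q_def)
  have "klein_j z - 744 - e (- z) = ((1 + 720 * q + q\<^sup>2 * \<gamma>) - (1 + 744 * q) * delta_series q) / (q * delta_series q)"
    unfolding klein_j_series[OF assms(1)] e_minus q_def[symmetric] *(3)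
    using n0 q0 by (simp add: field_simps)
  \<comment> \<open>Since \<open>744 = 720 + 24\<close>, the terms linear in \<open>q\<close> cancel
    as well as the constant ones. One factor \<open>q\<close> cancels the denominator, the other is
    the gain; \<open>17856 = 744 * 24\<close>.\<close>
  also have "(1 + 720 * q + q\<^sup>2 * \<gamma>) - (1 + 744 * q) * delta_series q = q * (q * (\<gamma> - \<epsilon> + 17856 - 744 * q * \<epsilon>))"
    unfolding *(1) by (simp add: algebra_simps power2_eq_square)
  finally have eq: "klein_j z - 744 - e (- z) = q * (\<gamma> - \<epsilon> + 17856 - 744 * q * \<epsilon>) / delta_series q"
    using q0 by simp
  have "cmod (\<gamma> - \<epsilon> + 17856 - 744 * q * \<epsilon>) \<le> cmod \<gamma> + cmod \<epsilon> + cmod 17856 + cmod (744 * q * \<epsilon>)"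
    by (rule order.trans[OF norm_triangle_ineq] order.trans[OF norm_triangle_ineq4] add_mono order.refl)+
  also have "\<dots> = cmod \<gamma> + cmod \<epsilon> + 17856 + 744 * cmod q * cmod \<epsilon>" by (simp add: norm_mult)
  also have "\<dots> \<le> 280000 + 24000 + 17856 + 744 * (1 / 200) * 24000"
    using q * by (intro add_mono mult_mono) auto
  also have "\<dots> \<le> 420000" by simp
  \<comment> \<open>\<open>420000 / 0.28 = 1500000\<close>.\<close>
  finally have "cmod (klein_j z - 744 - e (- z)) \<le> cmod q * 420000 / 0.28"
    unfolding eq norm_divide norm_mult using lb
    by (intro frac_le mult_left_mono) auto
  then show ?thesis by (simp add: q_def)
qed

section \<open>A numerical bound for \<open>e\<close> on the fundamental domain\<close>

lemma pi_ge_31: "pi \<ge> 3.1"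
proof -
  \<comment> \<open>The half-angle formula and \<open>cos (pi/6) = sqrt 3 / 2\<close> give the exact
    value of the left-hand side, so \<open>sin x <= x\<close> bounds \<open>pi\<close> from
    below.\<close>
  have "sin (pi / 12) \<le> pi / 12" by (rule sin_x_le_x) simp
  moreover have "sin (pi / 12) \<ge> 0" by (rule sin_ge_zero) simp_all
  ultimately have "(sin (pi / 12))\<^sup>2 \<le> (pi / 12)\<^sup>2" by (intro power_mono)
  moreover have "cos (pi / 6) = 1 - 2 * (sin (pi / 12))\<^sup>2"
    using cos_double_sin[of "pi / 12"] by simp
  moreover have "cos (pi / 6) = sqrt 3 / 2" by (rule cos_30)
  moreover have "sqrt 3 \<le> 1.7321" by (rule real_le_lsqrt) (simp_all add: power2_eq_square)
  ultimately have "(pi / 12)\<^sup>2 \<ge> (3.1 / 12)\<^sup>2" by (simp add: power2_eq_square)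
  then show ?thesis using power2_le_imp_le[of "3.1 / 12" "pi / 12"] by simp
qed

lemma norm_e_le:
  assumes "Im z \<ge> sqrt 3 / 2"
  shows "cmod (e z) \<le> 1 / 200"
proof -
  have s3: "sqrt 3 \<ge> 1.732" by (rule real_le_rsqrt) (simp add: power2_eq_square)
  have "5.369 \<le> 3.1 * (1.732::real)" by simp
  also have "\<dots> \<le> pi * sqrt 3" using pi_ge_31 s3 by (intro mult_mono) auto
  also have "\<dots> \<le> 2 * pi * Im z" using mult_left_mono[OF assms, of "2 * pi"] by simp
  finally have le: "5.369 \<le> 2 * pi * Im z" .
  have sq: "b \<le> x ^ (2 * k)" if "a \<le> x ^ k" "b \<le> a\<^sup>2" "0 \<le> a" for a b x :: real and k
    unfolding power_even_eq by (rule order.trans[OF that(2) power_mono[OF that(1) that(3)]])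
  \<comment> \<open>\<open>exp x >= (1 + x/256)^256\<close>, and eight squarings rounded down
    evaluate the power: about \<open>214\<close> is the true value of \<open>exp 5.369\<close>, so
    \<open>200\<close> remains within reach.\<close>
  define y :: real where "y = 1 + 5.369 / 256"
  have "1.02097 \<le> y" by (simp add: y_def)
  then have "1.04237 \<le> y ^ 2"
    using sq[of "1.02097" y "1" "1.04237"] by (simp add: power2_eq_square)
  then have "1.08653 \<le> y ^ 4"
    using sq[of "1.04237" y "2" "1.08653"] by (simp add: power2_eq_square)
  then have "1.18054 \<le> y ^ 8"
    using sq[of "1.08653" y "4" "1.18054"] by (simp add: power2_eq_square)
  then have "1.39367 \<le> y ^ 16"
    using sq[of "1.18054" y "8" "1.39367"] by (simp add: power2_eq_square)
  then have "1.94231 \<le> y ^ 32"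
    using sq[of "1.39367" y "16" "1.94231"] by (simp add: power2_eq_square)
  then have "3.772 \<le> y ^ 64"
    using sq[of "1.94231" y "32" "3.772"] by (simp add: power2_eq_square)
  then have "14.227 \<le> y ^ 128"
    using sq[of "3.772" y "64" "14.227"] by (simp add: power2_eq_square)
  then have "(200 :: real) \<le> y ^ 256"
    using sq[of "14.227" y "128" "200"] by (simp add: power2_eq_square)
  also have "y ^ 256 \<le> exp 5.369"
    using exp_ge_one_plus_x_over_n_power_n[of 256 "5.369"] by (simp add: y_def)
  also have "\<dots> \<le> exp (2 * pi * Im z)" using le by simp
  finally show ?thesis by (simp add: norm_e exp_minus field_simps)
qed

subsection \<open>Reduction to the fundamental domain\<close>

fun minv :: "mat2 \<Rightarrow> mat2" where
  "minv (p, q, r, s) = (s, - q, - r, p)"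

definition mid :: mat2 where "mid = (1, 0, 0, 1)"

lemma mmul_minv: "mdet M = 1 \<Longrightarrow> mmul (minv M) M = mid" "mdet M = 1 \<Longrightarrow> mmul M (minv M) = mid"
  by (cases M; simp add: mid_def algebra_simps)+

lemma mmul_mid [simp]: "mmul mid M = M" "mmul M mid = M"
  by (cases M; simp add: mid_def)+

lemma mdet_minv [simp]: "mdet (minv M) = mdet M"
  by (cases M) (simp add: algebra_simps)

lemma mdet_mid [simp]: "mdet mid = 1"
  by (simp add: mid_def)

lemma mob_mid [simp]: "mob mid z = z"
  by (simp add: mid_def)

lemma mob_minv: "Im z > 0 \<Longrightarrow> mdet M = 1 \<Longrightarrow> mob (minv M) (mob M z) = z"
  by (metis mmul_minv(1) mob_mid mob_mmul zero_neq_one)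

lemma finite_small_denominators:
  assumes "Im z > 0"
  shows "finite {(r, s). cmod (of_int r * z + of_int s) \<le> B}"
proof -
  obtain c where c: "c > 0" "\<And>x y. c * (x\<^sup>2 + y\<^sup>2) \<le> (cmod (of_real x * z + of_real y))\<^sup>2"
    using quadratic_form_lower_bound[OF assms] by blast
  define N where "N = \<lceil>\<bar>B\<bar>\<^sup>2 / c\<rceil>"
  have "{(r, s). cmod (of_int r * z + of_int s) \<le> B} \<subseteq> {- N..N} \<times> {- N..N}"
  proof (rule subsetI)
    fix x assume "x \<in> {(r, s). cmod (of_int r * z + of_int s) \<le> B}"
    then obtain r s where x: "x = (r, s)" and *: "cmod (of_int r * z + of_int s) \<le> B" by auto
    have "c * ((of_int r)\<^sup>2 + (of_int s)\<^sup>2) \<le> (cmod (of_int r * z + of_int s))\<^sup>2"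
      using c(2)[of "of_int r" "of_int s"] by simp
    also have "\<dots> \<le> \<bar>B\<bar>\<^sup>2" using * by (intro power_mono) auto
    finally have "of_int (r\<^sup>2 + s\<^sup>2) \<le> \<bar>B\<bar>\<^sup>2 / c" using c(1) by (simp add: field_simps)
    then have "r\<^sup>2 + s\<^sup>2 \<le> N" unfolding N_def by (simp add: le_ceiling_iff del: of_int_add of_int_power)
    moreover have "\<bar>x\<bar> \<le> x\<^sup>2" for x :: int
      using self_le_power[of "\<bar>x\<bar>" 2] by (cases "x = 0") auto
    moreover have "0 \<le> r\<^sup>2" "0 \<le> s\<^sup>2" by simp_all
    ultimately have "\<bar>r\<bar> \<le> N" "\<bar>s\<bar> \<le> N" by (smt (verit))+
    then show "x \<in> {- N..N} \<times> {- N..N}" by (auto simp: x)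
  qed
  then show ?thesis by (rule finite_subset) simp
qed

lemma mob_shift:
  assumes "of_int r * z + of_int s \<noteq> 0"
  shows "mob (p + k * r, q + k * s, r, s) z = mob (p, q, r, s) z + of_int k"
  using assms by (simp add: field_simps)

lemma fund_domain_Im:
  assumes "z \<in> fund_domain" shows "Im z \<ge> sqrt 3 / 2" "Im z > 0" "\<bar>Re z\<bar> \<le> 1/2" "cmod z \<ge> 1"
proof -
  show *: "Im z > 0" "\<bar>Re z\<bar> \<le> 1/2" "cmod z \<ge> 1"
    using assms by (auto simp: fund_domain_def)
  have "1\<^sup>2 \<le> (cmod z)\<^sup>2" using * by (intro power_mono) auto
  moreover have "\<bar>Re z\<bar>\<^sup>2 \<le> (1/2)\<^sup>2" using * by (intro power_mono) auto
  ultimately have "3 / 4 \<le> (Im z)\<^sup>2" unfolding cmod_power2 power2_abs by (simp add: power_divide)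
  then have "sqrt (3 / 4) \<le> Im z" using * by (intro real_le_lsqrt) auto
  then show "Im z \<ge> sqrt 3 / 2" by (simp add: real_sqrt_divide)
qed

theorem reduction_to_fund_domain:
  assumes z: "Im z > 0"
  obtains M where "mdet M = 1" "mob M z \<in> fund_domain"
proof -
  \<comment> \<open>Minimising this denominator maximises the height of \<open>mob M z\<close>.
    Values of at most \<open>1\<close> form a finite set, nonempty because \<open>mid\<close> has
    the value \<open>1\<close>.\<close>
  define den where "den = (\<lambda>(p::int, q::int, r, s). cmod (of_int r * z + of_int s))"
  define V where "V = {den M | M. mdet M = 1 \<and> den M \<le> 1}"
  have "V \<subseteq> (\<lambda>(r, s). cmod (of_int r * z + of_int s)) ` {(r, s). cmod (of_int r * z + of_int s) \<le> 1}"
    unfolding V_def den_def by fastforce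
  then have fin: "finite V" using finite_small_denominators[OF z] by (meson finite_imageI finite_subset)
  have "den mid = 1" by (simp add: den_def mid_def)
  then have "1 \<in> V" unfolding V_def by (metis (mono_tags, lifting) mdet_mid mem_Collect_eq order_refl)
  then have "Min V \<in> V" using fin by (intro Min_in) auto
  then obtain M0 where M0: "mdet M0 = 1" "den M0 = Min V" "den M0 \<le> 1" unfolding V_def by force
  have min: "den M0 \<le> den M" if "mdet M = 1" for M
  proof (cases "den M \<le> 1")
    case True
    then have "den M \<in> V" unfolding V_def using that by blast
    then show ?thesis using M0 fin by simp
  qed (use M0 in simp)
  obtain p q r s where M0': "M0 = (p, q, r, s)" by (metis surj_pair)
  define d where "d = of_int r * z + of_int s"
  have d: "d \<noteq> 0" unfolding d_def using z M0 M0' by (intro of_int_denominator_nonzero) auto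
  define k where "k = - \<lfloor>Re (mob M0 z) + 1/2\<rfloor>"
  define M1 where "M1 = (p + k * r, q + k * s, r, s)"
  define w where "w = mob M1 z"
  have det1: "mdet M1 = 1" using M0 by (simp add: M1_def M0' algebra_simps)
  have w: "w = mob M0 z + of_int k" unfolding w_def M1_def M0' using d by (intro mob_shift) (simp add: d_def)
  then have re: "-1/2 \<le> Re w" "Re w < 1/2" unfolding k_def by (simp, linarith)+
  have im: "Im w > 0" unfolding w_def by (rule Im_mob_pos[OF z]) (simp add: det1)
  \<comment> \<open>The top row of \<open>M1\<close> is the bottom row of another matrix of
    determinant one, so minimality compares the two denominators; their quotient is
    \<open>w\<close>.\<close>
  have n1: "cmod w \<ge> 1"
  proof -
    have "mdet (- r, - s, p + k * r, q + k * s) = 1" using det1 by (simp add: M1_def algebra_simps)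
    from min[OF this] have "cmod d \<le> cmod (of_int (p + k * r) * z + of_int (q + k * s))"
      by (simp add: den_def M0' d_def)
    moreover have "w * d = of_int (p + k * r) * z + of_int (q + k * s)"
      using d by (simp add: w_def M1_def d_def)
    ultimately have "1 * cmod d \<le> cmod w * cmod d" by (metis mult_1 norm_mult)
    then show ?thesis using d by simp
  qed
  show ?thesis
  proof (cases "cmod w > 1 \<or> Re w \<le> 0")
    case True
    then have "w \<in> fund_domain" using re im n1 by (auto simp: fund_domain_def)
    then show ?thesis using that[OF det1] by (simp add: w_def)
  next
    case False
    \<comment> \<open>\<open>w\<close> lies on the right half of the unit arc, which
      \<open>fund_domain\<close> excludes; \<open>S\<close> sends it to \<open>- cnj w\<close> on
      the left half.\<close>
    define S :: mat2 where "S = (0, -1, 1, 0)"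
    have c1: "cmod w = 1" using False n1 by simp
    have "mob S w = - (1 / w)" by (simp add: S_def)
    also have "1 / w = cnj w"
    proof -
      have "w * cnj w = 1" using c1 complex_norm_square[of w] by simp
      moreover have "w \<noteq> 0" using c1 by auto
      ultimately show ?thesis by (simp add: field_simps)
    qed
    finally have "mob S w \<in> fund_domain" using re im c1 False by (auto simp: fund_domain_def)
    moreover have "mob S w = mob (mmul S M1) z" unfolding w_def using z det1 by (simp add: mob_mmul)
    moreover have "mdet (mmul S M1) = 1" by (simp add: mdet_mmul det1 S_def del: mmul.simps)
    ultimately show ?thesis using that by metis
  qed
qed

text \<open>Vanishing is invariant under the modular group, and on the fundamental domain
  \<open>e z\<close> is so small that \<open>delta_series\<close> stays away from
  \<open>0\<close>.\<close>

lemma delta_form_nonzero: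
  assumes z: "Im z > 0" shows "delta_form z \<noteq> 0"
proof -
  obtain M where M: "mdet M = 1" "mob M z \<in> fund_domain" using reduction_to_fund_domain[OF z] .
  obtain p q r s where M': "M = (p, q, r, s)" by (metis surj_pair)
  have q: "cmod (e (mob M z)) \<le> 1 / 200" by (intro norm_e_le fund_domain_Im(1) M)
  have "delta_series (e (mob M z)) \<noteq> 0" using delta_series_lower_bound[OF q] by auto
  then have "delta_form (mob M z) \<noteq> 0"
    using delta_form_series[OF fund_domain_Im(2)[OF M(2)]] by simp
  then show ?thesis using delta_form_mob[OF z, of p s q r] M M' by auto
qed

section \<open>Holomorphy, behaviour at the cusp and the vanishing criterion\<close>

abbreviation upper_half :: "complex set" where "upper_half \<equiv> {z. Im z > 0}"

lemma e_holomorphic: "e holomorphic_on S"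
  unfolding e_def[abs_def] by (intro holomorphic_intros)

lemma klein_j_holomorphic: "klein_j holomorphic_on upper_half"
proof -
  have S: "(\<lambda>z. sigma_series n (e z)) holomorphic_on upper_half" for n
  proof -
    have "e ` upper_half \<subseteq> ball 0 1" by (auto simp: norm_e_less_1)
    then show ?thesis
      using holomorphic_on_compose_gen[OF e_holomorphic sigma_series_holomorphic] by (simp add: o_def)
  qed
  have "(\<lambda>z. 1728 * (1 + 240 * (e z * sigma_series 3 (e z))) ^ 3 /
      ((1 + 240 * (e z * sigma_series 3 (e z))) ^ 3 - (1 - 504 * (e z * sigma_series 5 (e z))) ^ 2)) holomorphic_on upper_half"
  proof (intro holomorphic_intros S e_holomorphic)
    fix z assume "z \<in> upper_half"
    then show "(1 + 240 * (e z * sigma_series 3 (e z))) ^ 3 - (1 - 504 * (e z * sigma_series 5 (e z))) ^ 2 \<noteq> 0"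
      using delta_form_nonzero[of z] by (simp add: delta_form_def E4_sigma_series E6_sigma_series)
  qed
  then show ?thesis
    by (rule holomorphic_transform) (simp add: klein_j_def E4_sigma_series E6_sigma_series)
qed

abbreviation cusp :: "complex filter" where "cusp \<equiv> filtercomap Im at_top"

lemma eventually_cusp: "eventually P cusp \<longleftrightarrow> (\<exists>Y. \<forall>z. Im z > Y \<longrightarrow> P z)"
proof
  assume "eventually P cusp"
  then obtain Q where Q: "eventually Q at_top" "\<And>z. Q (Im z) \<Longrightarrow> P z"
    by (auto simp: eventually_filtercomap)
  from Q(1) obtain Y where "\<And>y. y \<ge> Y \<Longrightarrow> Q y" by (auto simp: eventually_at_top_linorder)
  then show "\<exists>Y. \<forall>z. Im z > Y \<longrightarrow> P z" using Q(2) by (intro exI[of _ Y]) simp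
next
  assume "\<exists>Y. \<forall>z. Im z > Y \<longrightarrow> P z"
  then obtain Y where "\<forall>z. Im z > Y \<longrightarrow> P z" by blast
  then show "eventually P cusp"
    unfolding eventually_filtercomap
    by (intro exI[of _ "\<lambda>y. y > Y"]) (auto simp: eventually_gt_at_top)
qed

lemma cusp_neq_bot: "cusp \<noteq> bot"
proof
  assume "cusp = bot"
  then have "eventually (\<lambda>_. False) cusp" by simp
  then obtain Y where "\<forall>z. \<not> Im z > Y" by (auto simp: eventually_cusp)
  from this[rule_format, of "Complex 0 (Y + 1)"] show False by simp
qed

lemma tendsto_e_cusp: "(e \<longlongrightarrow> 0) cusp"
proof (rule tendsto_norm_zero_cancel, rule tendstoI)
  fix \<epsilon> :: real assume "\<epsilon> > 0"
  show "eventually (\<lambda>z. dist (cmod (e z)) 0 < \<epsilon>) cusp"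
    unfolding eventually_cusp
  proof (intro exI[of _ "- ln \<epsilon> / (2 * pi)"] allI impI)
    fix z assume "Im z > - ln \<epsilon> / (2 * pi)"
    then have "- 2 * pi * Im z < ln \<epsilon>" by (simp add: field_simps)
    then have "exp (- 2 * pi * Im z) < exp (ln \<epsilon>)" by (simp only: exp_less_cancel_iff)
    then show "dist (cmod (e z)) 0 < \<epsilon>" using \<open>\<epsilon> > 0\<close> by (simp add: norm_e)
  qed
qed

text \<open>The maximum of \<open>|f|\<close> is attained, by compactness of the truncated fundamental domain.\<close>

theorem invariant_vanishing_at_cusp_eq_0:
  assumes hol: "f holomorphic_on upper_half"
    and inv: "\<And>M z. mdet M = 1 \<Longrightarrow> Im z > 0 \<Longrightarrow> f (mob M z) = f z"
    and lim: "(f \<longlongrightarrow> 0) cusp" and z0: "Im z0 > 0"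
  shows "f z0 = 0"
proof (rule ccontr)
  assume nz: "f z0 \<noteq> 0"
  \<comment> \<open>Above the height \<open>Y\<close> extracted here \<open>|f|\<close> stays below
    \<open>|f z0|\<close>, so its supremum is attained in the compact part and not approached at the
    cusp.\<close>
  have "eventually (\<lambda>z. dist (f z) 0 < cmod (f z0)) cusp"
    using lim nz by (intro tendstoD) auto
  then obtain Y where Y: "\<And>z. Im z > Y \<Longrightarrow> cmod (f z) < cmod (f z0)"
    by (auto simp: eventually_cusp)
  define K where "K = cbox (Complex (-1/2) (sqrt 3 / 2)) (Complex (1/2) Y)"
  have KI: "z \<in> K \<longleftrightarrow> \<bar>Re z\<bar> \<le> 1/2 \<and> sqrt 3 / 2 \<le> Im z \<and> Im z \<le> Y" for z
    by (auto simp: K_def in_cbox_complex_iff)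
  have KH: "K \<subseteq> upper_half"
  proof
    fix z assume "z \<in> K"
    then have "sqrt 3 / 2 \<le> Im z" by (simp add: KI)
    moreover have "0 < sqrt 3 / (2::real)" by simp
    ultimately have "0 < Im z" by (rule order.strict_trans2[rotated])
    then show "z \<in> upper_half" by simp
  qed
  have red: "\<exists>z'\<in>fund_domain. f z' = f z" if "Im z > 0" for z
    using reduction_to_fund_domain[OF that] inv[OF _ that] by metis
  obtain z1 where z1: "z1 \<in> fund_domain" "f z1 = f z0" using red[OF z0] by blast
  have "Im z1 \<le> Y" using Y[of z1] z1 by (metis not_le order_less_irrefl)
  then have z1K: "z1 \<in> K" using fund_domain_Im[OF z1(1)] by (simp add: KI)
  have "continuous_on K (\<lambda>z. cmod (f z))"
    by (intro continuous_on_norm holomorphic_on_imp_continuous_on holomorphic_on_subset[OF hol KH])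
  moreover have "compact K" unfolding K_def by (rule compact_cbox)
  ultimately obtain \<xi> where \<xi>: "\<xi> \<in> K" "\<And>z. z \<in> K \<Longrightarrow> cmod (f z) \<le> cmod (f \<xi>)"
    using continuous_attains_sup[of K "\<lambda>z. cmod (f z)"] z1K by blast
  have max: "cmod (f z) \<le> cmod (f \<xi>)" if z: "z \<in> upper_half" for z
  proof -
    obtain z' where z': "z' \<in> fund_domain" "f z' = f z" using red z by blast
    show ?thesis
    proof (cases "Im z' > Y")
      case True
      then have "cmod (f z) < cmod (f z1)" using Y[of z'] z' z1 by simp
      then show ?thesis using \<xi>(2)[OF z1K] by simp
    next
      case False
      then have "z' \<in> K" using fund_domain_Im[OF z'(1)] by (simp add: KI)
      then show ?thesis using \<xi>(2) z' by metis
    qed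
  qed
  have "f constant_on upper_half"
  proof (rule maximum_modulus_principle[OF hol])
    show "open upper_half" by (rule open_halfspace_Im_gt)
    show "connected upper_half" by (intro convex_connected convex_halfspace_Im_gt)
    show "\<xi> \<in> upper_half" using \<xi> KH by blast
  qed (use max open_halfspace_Im_gt in auto)
  then obtain c where c: "\<And>z. Im z > 0 \<Longrightarrow> f z = c" by (auto simp: constant_on_def)
  have "f (Complex 0 (max Y 0 + 1)) = f z0" using c z0 by simp
  moreover have "cmod (f (Complex 0 (max Y 0 + 1))) < cmod (f z0)" by (rule Y) simp
  ultimately show False by simp
qed

subsection \<open>The functions \<open>j\<^sub>m\<close>\<close>

text \<open>Subtract the value at \<open>0\<close> and divide by \<open>q\<close>, once per
  coefficient; \<open>Schwarz3\<close> keeps each quotient holomorphic. It will split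
  \<open>j^m\<close> into a principal part, a constant and a remainder \<open>O(q)\<close>.\<close>

lemma holomorphic_taylor_remainder:
  assumes "f holomorphic_on ball 0 R" "R > 0"
  shows "\<exists>c g. g holomorphic_on ball 0 R \<and> c 0 = f 0 \<and>
           (\<forall>q\<in>ball 0 R. f q = (\<Sum>k\<le>m. c k * q ^ k) + q ^ Suc m * g q)"
proof (induction m)
  case 0
  have "(\<lambda>q. f q - f 0) holomorphic_on ball 0 R" using assms by (intro holomorphic_intros)
  then obtain h where "h holomorphic_on ball 0 R" "\<And>q. norm q < R \<Longrightarrow> f q - f 0 = q * h q"
    using Schwarz3[of "\<lambda>q. f q - f 0" R] by auto
  then show ?case by (intro exI[of _ "\<lambda>_. f 0"] exI[of _ h]) (auto simp: algebra_simps)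
next
  case (Suc m)
  then obtain c g where g: "g holomorphic_on ball 0 R" "c 0 = f 0"
    "\<And>q. q \<in> ball 0 R \<Longrightarrow> f q = (\<Sum>k\<le>m. c k * q ^ k) + q ^ Suc m * g q" by blast
  have "(\<lambda>q. g q - g 0) holomorphic_on ball 0 R" using g by (intro holomorphic_intros)
  then obtain h where h: "h holomorphic_on ball 0 R" "\<And>q. norm q < R \<Longrightarrow> g q - g 0 = q * h q"
    using Schwarz3[of "\<lambda>q. g q - g 0" R] by auto
  have "f q = (\<Sum>k\<le>Suc m. (c(Suc m := g 0)) k * q ^ k) + q ^ Suc (Suc m) * h q" if "q \<in> ball 0 R" for q
  proof -
    have "g q = g 0 + q * h q" using h(2)[of q] that by (simp add: algebra_simps)
    then show ?thesis using g(3)[OF that] by (simp add: algebra_simps)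
  qed
  with h(1) g(2) show ?case by (intro exI[of _ "c(Suc m := g 0)"] exI[of _ h]) auto
qed

lemma klein_j_filterlim: "filterlim klein_j at_infinity cusp"
proof -
  have b: "eventually (\<lambda>z. cmod (klein_j z - e (- z)) \<le> 10000) cusp"
    unfolding eventually_cusp
  proof (intro exI[of _ 1] allI impI)
    fix z assume z: "Im z > 1"
    have "sqrt 3 / 2 \<le> 1" by (rule order.trans[of _ "2 / 2"]) (auto intro: real_le_lsqrt)
    then have q: "cmod (e z) \<le> 1 / 200" using z by (intro norm_e_le) simp
    have "cmod (klein_j z - 744 - e (- z)) \<le> 1500000 * cmod (e z)"
      using z q by (intro klein_j_near_cusp) simp_all
    then have "cmod (klein_j z - 744 - e (- z)) \<le> 7500" using q by simp
    then show "cmod (klein_j z - e (- z)) \<le> 10000"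
      using norm_triangle_ineq[of "klein_j z - 744 - e (- z)" 744] by simp
  qed
  have e: "filterlim (\<lambda>z. e (- z)) at_infinity cusp"
    unfolding e_minus divide_inverse mult_1
    by (rule filterlim_compose[OF filterlim_inverse_at_infinity])
       (simp add: filterlim_at tendsto_e_cusp)
  show ?thesis
    unfolding filterlim_at_infinity[OF order.refl]
  proof (intro allI impI)
    fix r :: real assume "r > 0"
    have "eventually (\<lambda>z. r + 10000 \<le> cmod (e (- z))) cusp"
      using e[unfolded filterlim_at_infinity[OF order.refl]] \<open>r > 0\<close> by simp
    with b show "eventually (\<lambda>z. r \<le> cmod (klein_j z)) cusp"
    proof eventually_elim
      case (elim z)
      then show ?case using norm_triangle_ineq2[of "e (- z)" "e (- z) - klein_j z"]
        by (simp add: norm_minus_commute)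
    qed
  qed
qed

text \<open>Since \<open>j\<close> tends to infinity at the cusp, so does any nonconstant polynomial
  in it, while a constant polynomial tends to its value.\<close>

lemma poly_klein_j_unique:
  assumes "((\<lambda>z. poly R (klein_j z)) \<longlongrightarrow> 0) cusp"
  shows "R = 0"
proof (rule ccontr)
  assume R: "R \<noteq> 0"
  obtain a p where Rp: "R = pCons a p" by (cases R)
  show False
  proof (cases "p = 0")
    case True
    then have "((\<lambda>z::complex. a) \<longlongrightarrow> 0) cusp" using assms Rp by simp
    then have "a = 0" using tendsto_const_iff[OF cusp_neq_bot] by blast
    then show False using R Rp True by simp
  next
    case False
    have "filterlim (poly R) at_infinity at_infinity"
      by (rule filterlim_poly_at_infinity) (simp add: Rp False)
    then have "filterlim (\<lambda>z. poly R (klein_j z)) at_infinity cusp"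
      using klein_j_filterlim by (rule filterlim_compose)
    then have "eventually (\<lambda>z. 1 \<le> cmod (poly R (klein_j z))) cusp"
      by (simp add: filterlim_at_infinity[OF order.refl])
    moreover have "eventually (\<lambda>z. dist (poly R (klein_j z)) 0 < 1) cusp"
      using assms by (rule tendstoD) simp
    ultimately have "eventually (\<lambda>z. False) cusp"
    proof eventually_elim
      case (elim z)
      then show False by simp
    qed
    then show False using cusp_neq_bot by simp
  qed
qed

text \<open>Strong induction. The power \<open>j^m\<close> has leading term \<open>q^(-m)\<close>;
  its lower terms \<open>c_k q^(k - m)\<close> with \<open>1 <= k <= m\<close>, the constant
  included, are removed by subtracting \<open>c_k\<close> times the polynomials for
  \<open>m - k\<close>.\<close>

lemma klein_j_polynomial_exists:
  "\<exists>P. (\<lambda>z. poly P (klein_j z) - e (- of_nat m * z)) \<in> O[cusp](e)"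
proof (induction m rule: less_induct)
  case (less m)
  then obtain P where P: "\<And>k. k < m \<Longrightarrow> (\<lambda>z. poly (P k) (klein_j z) - e (- of_nat k * z)) \<in> O[cusp](e)"
    by metis
  define B where "B = ball (0 :: complex) (1 / 200)"
  \<comment> \<open>\<open>q j\<close> as a holomorphic function of \<open>q\<close> near
    \<open>0\<close>, with value \<open>1\<close> there.\<close>
  define h where "h q = (1 + 240 * (q * sigma_series 3 q)) ^ 3 / delta_series q" for q
  have S: "sigma_series n holomorphic_on B" for n
    by (rule holomorphic_on_subset[OF sigma_series_holomorphic]) (auto simp: B_def)
  have "delta_series q \<noteq> 0" if "q \<in> B" for q
    using delta_series_lower_bound[of q] that by (auto simp: B_def)
  then have "(\<lambda>q. h q ^ m) holomorphic_on B"
    unfolding h_def by (intro holomorphic_intros S) (auto simp: delta_series_def[abs_def] intro!: holomorphic_intros S)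
  then obtain c g where g: "g holomorphic_on B" "c 0 = h 0 ^ m"
      "\<And>q. q \<in> B \<Longrightarrow> h q ^ m = (\<Sum>k\<le>m. c k * q ^ k) + q ^ Suc m * g q"
    using holomorphic_taylor_remainder[of "\<lambda>q. h q ^ m" "1/200" m] unfolding B_def by auto
  have "sigma_series n 0 = 1" for n
    by (simp add: sigma_series_def divisor_sigma_def)
  then have c0: "c 0 = 1" by (simp add: g(2) h_def delta_series_def)
  have inB: "eventually (\<lambda>z. Im z > 0 \<and> e z \<in> B) cusp"
    unfolding eventually_cusp
  proof (intro exI[of _ 1] allI impI conjI)
    fix z assume z: "Im z > 1"
    have "sqrt 3 \<le> 1.8" by (rule real_le_lsqrt) (simp_all add: power2_eq_square)
    then have "cmod (e z) < cmod (e (\<i> * of_real (sqrt 3 / 2)))" using z by (simp add: norm_e)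
    also have "\<dots> \<le> 1 / 200" by (intro norm_e_le) simp
    finally show "e z \<in> B" by (simp add: B_def)
  qed simp
  have "(g \<longlongrightarrow> g 0) (at 0)"
    using g(1) by (metis B_def centre_in_ball continuous_on_interior divide_pos_pos holomorphic_on_imp_continuous_on
        interior_open isCont_def open_ball zero_less_numeral zero_less_one)
  then have gl: "((\<lambda>z. g (e z)) \<longlongrightarrow> g 0) cusp"
    by (rule filterlim_compose) (simp add: filterlim_at tendsto_e_cusp)
  then have "(\<lambda>z. g (e z)) \<in> O[cusp](\<lambda>_. 1)"
    by (intro bigoI_tendsto[of _ _ "g 0"]) auto
  then have "(\<lambda>z. e z * g (e z)) \<in> O[cusp](\<lambda>z. e z * 1)" by (intro landau_o.big.mult) auto
  then have r: "(\<lambda>z. e z * g (e z)) \<in> O[cusp](e)" by simp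
  have jm: "eventually (\<lambda>z. e z * g (e z) = klein_j z ^ m - (\<Sum>k\<le>m. c k * e (- of_nat (m - k) * z))) cusp"
    using inB
  proof eventually_elim
    case (elim z)
    define q where "q = e z"
    have q0: "q \<noteq> 0" by (simp add: q_def)
    have ek: "e (- of_nat i * z) = 1 / q ^ i" for i
      using e_minus[of "of_nat i * z"] by (simp add: q_def e_of_nat_mult)
    have "klein_j z ^ m = h q ^ m / q ^ m"
      using elim by (simp add: klein_j_series h_def q_def power_divide power_mult_distrib)
    also have "\<dots> = (\<Sum>k\<le>m. c k * q ^ k) / q ^ m + q * g q"
      using g(3)[of q] elim q0 by (simp add: q_def add_divide_distrib)
    also have "(\<Sum>k\<le>m. c k * q ^ k) / q ^ m = (\<Sum>k\<le>m. c k * e (- of_nat (m - k) * z))"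
      unfolding sum_divide_distrib ek using q0 by (intro sum.cong) (auto simp: power_diff)
    finally show ?case by (simp add: q_def)
  qed
  define Q where "Q = Polynomial.monom 1 m - (\<Sum>k\<in>{1..m}. Polynomial.smult (c k) (P (m - k)))"
  have "(\<lambda>z. klein_j z ^ m - (\<Sum>k\<le>m. c k * e (- of_nat (m - k) * z))) \<in> O[cusp](e)"
    using r landau_o.big.in_cong[OF jm] by blast
  moreover have "(\<lambda>z. \<Sum>k\<in>{1..m}. c k * (poly (P (m - k)) (klein_j z) - e (- of_nat (m - k) * z))) \<in> O[cusp](e)"
    proof (rule big_sum_in_bigo)
    fix k assume "k \<in> {1..m}"
    then show "(\<lambda>z. c k * (poly (P (m - k)) (klein_j z) - e (- of_nat (m - k) * z))) \<in> O[cusp](e)"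
      unfolding cmult_in_bigo_iff by (intro disjI2 P) auto
  qed
  ultimately have "(\<lambda>z. (klein_j z ^ m - (\<Sum>k\<le>m. c k * e (- of_nat (m - k) * z)))
      - (\<Sum>k\<in>{1..m}. c k * (poly (P (m - k)) (klein_j z) - e (- of_nat (m - k) * z)))) \<in> O[cusp](e)"
    by (rule sum_in_bigo(2))
  moreover have "{..m} = insert 0 {1..m}" by auto
  ultimately have "(\<lambda>z. poly Q (klein_j z) - e (- of_nat m * z)) \<in> O[cusp](e)"
    by (simp add: Q_def poly_monom poly_sum c0 right_diff_distrib sum_subtractf algebra_simps)
  then show ?case by blast
qed

text \<open>Existence and uniqueness together give the \<open>THE\<close> in \<open>j_poly\<close>
  its meaning: two candidates differ by a polynomial in \<open>j\<close> that tends to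
  \<open>0\<close>.\<close>

lemma jm_near_cusp: "(\<lambda>z. jm m z - e (- of_nat m * z)) \<in> O[cusp](e)"
proof -
  have "\<exists>!P. (\<lambda>z. poly P (klein_j z) - e (- of_nat m * z)) \<in> O[cusp](e)"
  proof (rule ex_ex1I[OF klein_j_polynomial_exists])
    fix P Q assume "(\<lambda>z. poly P (klein_j z) - e (- of_nat m * z)) \<in> O[cusp](e)"
      "(\<lambda>z. poly Q (klein_j z) - e (- of_nat m * z)) \<in> O[cusp](e)"
    then have "(\<lambda>z. (poly P (klein_j z) - e (- of_nat m * z)) - (poly Q (klein_j z) - e (- of_nat m * z))) \<in> O[cusp](e)"
      by (rule sum_in_bigo(2))
    then have "(\<lambda>z. poly (P - Q) (klein_j z)) \<in> O[cusp](e)" by simp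
    then have "((\<lambda>z. poly (P - Q) (klein_j z)) \<longlongrightarrow> 0) cusp"
      by (rule landau_o.big_small_trans[THEN smalloD_tendsto[of _ _ "\<lambda>_. 1", simplified]])
         (auto intro!: smalloI_tendsto tendsto_e_cusp)
    then have "P - Q = 0" by (rule poly_klein_j_unique)
    then show "P = Q" by simp
  qed
  from theI'[OF this] show ?thesis unfolding jm_def j_poly_def .
qed

lemma jm_tendsto: "((\<lambda>z. jm m z - e (- of_nat m * z)) \<longlongrightarrow> 0) cusp"
  by (rule landau_o.big_small_trans[OF jm_near_cusp, THEN smalloD_tendsto[of _ _ "\<lambda>_. 1", simplified]])
     (auto intro!: smalloI_tendsto tendsto_e_cusp)

lemma jm_mob: "Im z > 0 \<Longrightarrow> mdet M = 1 \<Longrightarrow> jm m (mob M z) = jm m z"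
  by (simp add: jm_def klein_j_mob)

lemma jm_holomorphic: "jm m holomorphic_on upper_half"
  unfolding jm_def[abs_def] poly_altdef by (intro holomorphic_intros klein_j_holomorphic)

subsection \<open>Integral matrices of determinant \<open>m\<close>\<close>

definition mshift :: "int \<Rightarrow> mat2" where "mshift k = (1, k, 0, 1)"

lemma mmul_mshift_0 [simp]: "mmul (mshift 0) M = M"
  by (cases M) (simp add: mshift_def)

lemma mdet_mshift [simp]: "mdet (mshift k) = 1"
  by (simp add: mshift_def)

lemma mob_mshift [simp]: "mob (mshift k) z = z + of_int k"
  by (simp add: mshift_def)

text \<open>Representatives for the quotient of the modular group by \<open>\<plusminus> mshift k\<close> from the left.\<close>

definition cusp_reps :: "mat2 set" where
  "cusp_reps = insert mid {(p, q, r, s). p * s - q * r = 1 \<and> r > 0 \<and> 0 \<le> p \<and> p < r}"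

text \<open>Hermite normal forms: one representative of each orbit of the modular group, acting by
  left multiplication, on integral matrices of determinant \<open>m\<close>.\<close>

definition hecke_reps :: "nat \<Rightarrow> mat2 set" where
  "hecke_reps m = {(a, b, 0, d) | a b d. a * d = int m \<and> 0 < d \<and> 0 \<le> b \<and> b < d}"

definition mneg :: "mat2 \<Rightarrow> mat2" where "mneg M = mmul (-1, 0, 0, -1) M"

lemma mneg_simp: "mneg (p, q, r, s) = (- p, - q, - r, - s)"
  by (simp add: mneg_def)

lemma mmul_mneg: "mmul X (mneg M) = mneg (mmul X M)"
  by (cases X; cases M) (simp add: mneg_simp)

lemma mdet_mneg [simp]: "mdet (mneg M) = mdet M"
  by (cases M) (simp add: mneg_simp)

lemma mob_mneg [simp]: "mob (mneg M) z = mob M z"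
proof -
  obtain p q r s where M: "M = (p, q, r, s)" by (metis surj_pair)
  have "mob (mneg M) z = (- (of_int p * z + of_int q)) / (- (of_int r * z + of_int s))"
    by (simp add: M mneg_simp)
  then show ?thesis by (simp only: minus_divide_divide M mob.simps)
qed

text \<open>Same coset under the stabiliser of the cusp, up to sign. The associated
  \<open>mob\<close> values differ by an integer, which \<open>e\<close> does not see.\<close>

definition cusp_equiv :: "mat2 \<Rightarrow> mat2 \<Rightarrow> bool" where
  "cusp_equiv M N \<longleftrightarrow> (\<exists>k. M = mmul (mshift k) N \<or> M = mneg (mmul (mshift k) N))"

lemma cusp_equivE:
  assumes "cusp_equiv (p, q, r, s) (p', q', r', s')"
  obtains k u where "u = 1 \<or> u = -1" "p = u * (p' + k * r')" "q = u * (q' + k * s')" "r = u * r'" "s = u * s'"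
proof -
  from assms obtain k where "(p, q, r, s) = mmul (mshift k) (p', q', r', s') \<or> (p, q, r, s) = mneg (mmul (mshift k) (p', q', r', s'))"
    unfolding cusp_equiv_def by blast
  then show ?thesis
  proof
    assume "(p, q, r, s) = mmul (mshift k) (p', q', r', s')"
    then show ?thesis by (intro that[of 1 k]) (auto simp: mshift_def)
  next
    assume "(p, q, r, s) = mneg (mmul (mshift k) (p', q', r', s'))"
    then show ?thesis by (intro that[of "-1" k]) (auto simp: mshift_def mneg_simp)
  qed
qed

lemma cusp_equivI:
  assumes "u = 1 \<or> u = -1" "p = u * (p' + k * r')" "q = u * (q' + k * s')" "r = u * r'" "s = u * s'"
  shows "cusp_equiv (p, q, r, s) (p', q', r', s')"
  unfolding cusp_equiv_def using assms by (intro exI[of _ k]) (auto simp: mshift_def mneg_simp)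

lemma cusp_equiv_sym: "cusp_equiv M N \<Longrightarrow> cusp_equiv N M"
proof -
  assume *: "cusp_equiv M N"
  obtain p q r s p' q' r' s' where MN: "M = (p, q, r, s)" "N = (p', q', r', s')" by (metis surj_pair)
  from * obtain k u where "u = 1 \<or> u = -1" "p = u * (p' + k * r')" "q = u * (q' + k * s')" "r = u * r'" "s = u * s'"
    unfolding MN by (rule cusp_equivE)
  then show "cusp_equiv N M" unfolding MN by (intro cusp_equivI[of u _ _ "- k"]) auto
qed

lemma cusp_equiv_trans: "cusp_equiv M N \<Longrightarrow> cusp_equiv N K \<Longrightarrow> cusp_equiv M K"
proof -
  assume *: "cusp_equiv M N" and **: "cusp_equiv N K"
  obtain p q r s p' q' r' s' a b c d where MN: "M = (p, q, r, s)" "N = (p', q', r', s')" "K = (a, b, c, d)"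
    by (metis surj_pair)
  from * obtain k u where 1: "u = 1 \<or> u = -1" "p = u * (p' + k * r')" "q = u * (q' + k * s')" "r = u * r'" "s = u * s'"
    unfolding MN by (rule cusp_equivE)
  from ** obtain l v where 2: "v = 1 \<or> v = -1" "p' = v * (a + l * c)" "q' = v * (b + l * d)" "r' = v * c" "s' = v * d"
    unfolding MN by (rule cusp_equivE)
  show "cusp_equiv M K" unfolding MN
    by (rule cusp_equivI[of "u * v" _ _ "k + l"]) (use 1 2 in \<open>auto simp: algebra_simps\<close>)
qed

lemma cusp_equiv_mmul: "cusp_equiv M N \<Longrightarrow> cusp_equiv (mmul M K) (mmul N K)"
  unfolding cusp_equiv_def mneg_def by (metis mmul_assoc)

lemma cusp_equiv_mob:
  assumes "cusp_equiv M N" "Im z > 0" "mdet N \<noteq> 0"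
  obtains k where "mob M z = mob N z + of_int k"
proof -
  obtain k where "M = mmul (mshift k) N \<or> M = mneg (mmul (mshift k) N)"
    using assms(1) unfolding cusp_equiv_def by blast
  then have "mob M z = mob N z + of_int k" using mob_mmul[OF assms(2,3), of "mshift k"] by auto
  then show ?thesis using that by blast
qed

lemma cusp_reps_mdet: "M \<in> cusp_reps \<Longrightarrow> mdet M = 1"
  by (auto simp: cusp_reps_def mid_def)

lemma hecke_reps_mdet: "M \<in> hecke_reps m \<Longrightarrow> mdet M = int m"
  by (auto simp: hecke_reps_def)

text \<open>A sign makes the lower left entry positive, then a shift reduces the upper left entry
  modulo it; a vanishing lower left entry leaves only signed shifts, represented by
  \<open>mid\<close>.\<close>

lemma cusp_reps_exists:
  assumes "mdet M = 1"
  obtains g where "g \<in> cusp_reps" "cusp_equiv M g"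
proof -
  obtain p q r s where M: "M = (p, q, r, s)" by (metis surj_pair)
  have det: "p * s - q * r = 1" using assms M by simp
  show ?thesis
  proof (cases "r = 0")
    case True
    then have "p * s = 1" using det by simp
    then have u: "s = 1 \<or> s = -1" "p = s" by (auto simp: zmult_eq_1_iff)
    have "cusp_equiv M mid" unfolding M mid_def
      by (rule cusp_equivI[of s _ _ "s * q"]) (use u True in auto)
    then show ?thesis using that[of mid] by (simp add: cusp_reps_def)
  next
    case False
    define u where "u = sgn r"
    have u: "u = 1 \<or> u = -1" "u * r = \<bar>r\<bar>" "u * u = 1" using False by (auto simp: u_def sgn_if)
    define k where "k = (u * p) div \<bar>r\<bar>"
    define g where "g = (u * p - k * \<bar>r\<bar>, u * q - k * (u * s), \<bar>r\<bar>, u * s)"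
    have pm: "u * p - k * \<bar>r\<bar> = (u * p) mod \<bar>r\<bar>" unfolding k_def by (simp add: minus_div_mult_eq_mod)
    have "(u * p - k * (u * r)) * (u * s) - (u * q - k * (u * s)) * (u * r) = (u * u) * (p * s - q * r)"
      by (simp add: algebra_simps)
    then have "(u * p - k * \<bar>r\<bar>) * (u * s) - (u * q - k * (u * s)) * \<bar>r\<bar> = 1"
      unfolding u(2,3) det by simp
    moreover have "0 \<le> u * p - k * \<bar>r\<bar>" "u * p - k * \<bar>r\<bar> < \<bar>r\<bar>" unfolding pm using False by simp_all
    ultimately have "g \<in> cusp_reps"
      using False unfolding cusp_reps_def g_def by simp
    moreover have "cusp_equiv M g" unfolding M g_def
    proof (rule cusp_equivI[of u _ _ k])
      have uu: "u * (u * x) = x" for x using u(3) by (simp flip: mult.assoc)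
      show "u = 1 \<or> u = -1" by (rule u(1))
      show "p = u * (u * p - k * \<bar>r\<bar> + k * \<bar>r\<bar>)" by (simp add: uu)
      show "q = u * (u * q - k * (u * s) + k * (u * s))" by (simp add: uu)
      show "r = u * \<bar>r\<bar>" by (simp add: uu flip: u(2))
      show "s = u * (u * s)" by (simp add: uu)
    qed
    ultimately show ?thesis using that by blast
  qed
qed

lemma bezout_coprime: "p * s - q * r = 1 \<Longrightarrow> coprime r s" for p q r s :: int
  by (rule coprimeI) (metis dvd_diff dvd_mult)

text \<open>Equal bottom rows give \<open>(p - p') s = (q - q') r\<close> with \<open>r\<close>,
  \<open>s\<close> coprime, so \<open>p\<close> and \<open>p'\<close> are congruent modulo
  \<open>r\<close> and the range of \<open>p\<close> decides.\<close>

lemma cusp_reps_bottom_row_unique: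
  assumes "(p, q, r, s) \<in> cusp_reps" "(p', q', r', s') \<in> cusp_reps" "v = 1 \<or> v = -1"
    and "r = v * r'" "s = v * s'"
  shows "(p, q, r, s) = (p', q', r', s')"
proof (cases "r = 0")
  case True
  then have "r' = 0" using assms by auto
  then show ?thesis using True assms by (auto simp: cusp_reps_def mid_def)
next
  case False
  have r: "r > 0" "0 \<le> p" "p < r" "p * s - q * r = 1"
    using assms(1) False by (auto simp: cusp_reps_def mid_def)
  have "r' \<noteq> 0" using False assms by auto
  then have r': "r' > 0" "0 \<le> p'" "p' < r'" "p' * s' - q' * r' = 1"
    using assms(2) by (auto simp: cusp_reps_def mid_def)
  have v: "v = 1" using assms(3,4) r r' by auto
  then have rs: "r' = r" "s' = s" using assms by auto
  have "(p - p') * s = (q - q') * r" using r(4) r'(4) unfolding rs by (simp add: algebra_simps)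
  moreover have "coprime r s" by (rule bezout_coprime[OF r(4)])
  ultimately have "r dvd p - p'" by (metis coprime_dvd_mult_left_iff dvd_triv_right)
  moreover have "\<bar>p - p'\<bar> < r" using r r' rs by auto
  ultimately have "p = p'" by (metis abs_of_pos dvd_imp_le_int eq_iff_diff_eq_0 not_le r(1))
  then have "q * r = q' * r" using r(4) r'(4) rs by (simp add: algebra_simps)
  then show ?thesis using \<open>p = p'\<close> r(1) rs by simp
qed

lemma cusp_reps_unique:
  assumes "g \<in> cusp_reps" "h \<in> cusp_reps" "cusp_equiv g h"
  shows "g = h"
proof -
  obtain p q r s p' q' r' s' where MN: "g = (p, q, r, s)" "h = (p', q', r', s')" by (metis surj_pair)
  from assms(3) show ?thesis unfolding MN
    by (rule cusp_equivE) (use assms cusp_reps_bottom_row_unique MN in metis)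
qed

lemma hecke_reps_shift:
  assumes "a * d = int m" "d > 0"
  obtains X where "X \<in> hecke_reps m" "cusp_equiv (a, b, 0, d) X" "\<exists>k. X = mmul (mshift k) (a, b, 0, d)"
proof
  let ?X = "(a, b mod d, 0, d)"
  show "?X \<in> hecke_reps m" using assms by (simp add: hecke_reps_def)
  show "cusp_equiv (a, b, 0, d) ?X"
    by (rule cusp_equivI[of 1 _ _ "b div d"]) (auto simp: mod_div_mult_eq)
  show "\<exists>k. ?X = mmul (mshift k) (a, b, 0, d)"
    by (intro exI[of _ "- (b div d)"]) (simp add: mshift_def minus_div_mult_eq_mod)
qed

text \<open>Bezout coefficients for the first column give a unimodular matrix that clears the lower
  left entry from the left; a shift then reduces the upper right entry.\<close>

lemma hnf_exists:
  assumes "mdet N = int m" "m \<ge> 1"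
  obtains X g where "X \<in> hecke_reps m" "mdet g = 1" "N = mmul g X"
proof -
  obtain a b c d where N: "N = (a, b, c, d)" by (metis surj_pair)
  have det: "a * d - b * c = int m" using assms N by simp
  define h where "h = gcd a c"
  have h0: "h > 0" using det assms by (auto simp: h_def gcd_pos_int)
  obtain x y where xy: "x * a + y * c = h" unfolding h_def by (metis bezout_int)
  obtain a' c' where ac: "a = h * a'" "c = h * c'" unfolding h_def by (meson gcd_dvd1 gcd_dvd2 dvdE)
  have "h * (x * a' + y * c') = h * 1" using xy ac by (simp add: algebra_simps)
  then have bez: "x * a' + y * c' = 1" using h0 by simp
  define g where "g = (x, y, - c', a')"
  have g1: "mdet g = 1" using bez by (simp add: g_def)
  have gN: "mmul g N = (h, x * b + y * d, 0, a' * d - c' * b)"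
    using xy by (simp add: g_def N ac algebra_simps)
  have hd: "h * (a' * d - c' * b) = int m" using det ac by (simp add: algebra_simps)
  then have "0 < h * (a' * d - c' * b)" using assms by simp
  then have "0 < a' * d - c' * b" using h0 by (simp add: zero_less_mult_iff)
  then obtain X k where X: "X \<in> hecke_reps m" "X = mmul (mshift k) (mmul g N)"
    using hecke_reps_shift[OF hd] unfolding gN by metis
  define G where "G = mmul (mshift k) g"
  have X': "X = mmul G N" using X by (simp add: mmul_assoc G_def)
  have G1: "mdet G = 1" by (simp add: mdet_mmul g1 G_def)
  show ?thesis
  proof (rule that[OF X(1)])
    show "mdet (minv G) = 1" using G1 by simp
    show "N = mmul (minv G) X"
      unfolding X' using G1 by (simp only: mmul_assoc[symmetric] mmul_minv mmul_mid)
  qed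
qed

text \<open>The zero in the lower left corner makes \<open>g\<close> triangular, positivity makes
  its diagonal \<open>1\<close>, and the range of \<open>b\<close> leaves no shift.\<close>

lemma hnf_unique:
  assumes "X \<in> hecke_reps m" "Y \<in> hecke_reps m" "m \<ge> 1" "mdet g = 1" "X = mmul g Y"
  shows "X = Y \<and> g = mid"
proof -
  obtain a b d where X: "X = (a, b, 0, d)" "a * d = int m" "0 < d" "0 \<le> b" "b < d"
    using assms(1) by (auto simp: hecke_reps_def)
  obtain a' b' d' where Y: "Y = (a', b', 0, d')" "a' * d' = int m" "0 < d'" "0 \<le> b'" "b' < d'"
    using assms(2) by (auto simp: hecke_reps_def)
  obtain p q r s where g: "g = (p, q, r, s)" by (metis surj_pair)
  have a: "a > 0" "a' > 0" using X Y assms(3)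
    by (metis int_eq_iff of_nat_0_less_iff order_less_le_trans zero_less_mult_pos2 zero_less_one)+
  have eq: "a = p * a'" "b = p * b' + q * d'" "r * a' = 0" "d = r * b' + s * d'"
    using assms(5) by (auto simp: X Y g)
  have r: "r = 0" using eq a by simp
  have "p * s = 1" using assms(4) r by (simp add: g)
  moreover have "p > 0" using eq a by (metis zero_less_mult_pos2)
  ultimately have ps: "p = 1" "s = 1" by (auto simp: zmult_eq_1_iff)
  have dd: "d = d'" using eq r ps by simp
  have bq: "b = b' + q * d" using eq ps dd by simp
  then have "b mod d = b' mod d" by simp
  moreover have "b mod d = b" "b' mod d = b'" using X Y dd by auto
  ultimately have bb: "b = b'" by simp
  then have "q = 0" using bq X by simp
  with bb dd eq ps r show ?thesis by (simp add: X Y g mid_def)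
qed

text \<open>The mirror image of \<open>hnf_exists\<close>: the triangular factor stands on the left
  and is split off by the gcd of the bottom row. Only \<open>\<plusminus>\<close> shifts act on the
  left here, but reducing \<open>b\<close> modulo \<open>d\<close> takes no more.\<close>

lemma hecke_cusp_exists:
  assumes "mdet N = int m" "m \<ge> 1"
  obtains X g where "X \<in> hecke_reps m" "g \<in> cusp_reps" "cusp_equiv N (mmul X g)"
proof -
  obtain a b c d where N: "N = (a, b, c, d)" by (metis surj_pair)
  have det: "a * d - b * c = int m" using assms N by simp
  define h where "h = gcd c d"
  have h0: "h > 0" using det assms by (auto simp: h_def gcd_pos_int)
  obtain x y where xy: "x * c + y * d = h" unfolding h_def by (metis bezout_int)
  obtain c' d' where cd: "c = h * c'" "d = h * d'" unfolding h_def by (meson gcd_dvd1 gcd_dvd2 dvdE)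
  have "h * (x * c' + y * d') = h * 1" using xy cd by (simp add: algebra_simps)
  then have bez: "x * c' + y * d' = 1" using h0 by simp
  define \<gamma> where "\<gamma> = (y, - x, c', d')"
  have g1: "mdet \<gamma> = 1" using bez by (simp add: \<gamma>_def algebra_simps)
  obtain g where g: "g \<in> cusp_reps" "cusp_equiv \<gamma> g" using cusp_reps_exists[OF g1] .
  define t where "t = a * x + b * y"
  have tri: "N = mmul (a * d' - b * c', t, 0, h) \<gamma>"
  proof -
    have "(a * d' - b * c') * y + t * c' = a * (x * c' + y * d')"
         "(a * d' - b * c') * (- x) + t * d' = b * (x * c' + y * d')"
      by (simp_all add: t_def algebra_simps)
    then show ?thesis using bez cd by (simp add: \<gamma>_def N)
  qed
  have hd: "(a * d' - b * c') * h = int m" using det cd by (simp add: algebra_simps)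
  from g(2) obtain k where k: "\<gamma> = mmul (mshift k) g \<or> \<gamma> = mneg (mmul (mshift k) g)"
    unfolding cusp_equiv_def by blast
  \<comment> \<open>The shift that separates \<open>\<gamma>\<close> from its representative
    \<open>g\<close> is absorbed into the triangular factor.\<close>
  define T where "T = mmul (a * d' - b * c', t, 0, h) (mshift k)"
  have "cusp_equiv N (mmul T g)"
  proof -
    have "N = mmul T g \<or> N = mneg (mmul T g)"
      using k unfolding tri T_def by (auto simp only: mmul_assoc mmul_mneg)
    then show ?thesis unfolding cusp_equiv_def by (intro exI[of _ 0]) simp
  qed
  moreover have "T = (a * d' - b * c', (a * d' - b * c') * k + t, 0, h)" by (simp add: T_def mshift_def)
  then obtain X where X: "X \<in> hecke_reps m" "cusp_equiv T X" using hecke_reps_shift[OF hd h0] by metis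
  ultimately have "cusp_equiv N (mmul X g)" using cusp_equiv_trans cusp_equiv_mmul by blast
  then show ?thesis using that X g by blast
qed

lemma hecke_cusp_unique:
  assumes "X \<in> hecke_reps m" "Y \<in> hecke_reps m" "g \<in> cusp_reps" "h \<in> cusp_reps" "m \<ge> 1"
    and "cusp_equiv (mmul X g) (mmul Y h)"
  shows "X = Y \<and> g = h"
proof -
  obtain a b d where X: "X = (a, b, 0, d)" "a * d = int m" "0 < d" "0 \<le> b" "b < d"
    using assms(1) by (auto simp: hecke_reps_def)
  obtain a' b' d' where Y: "Y = (a', b', 0, d')" "a' * d' = int m" "0 < d'" "0 \<le> b'" "b' < d'"
    using assms(2) by (auto simp: hecke_reps_def)
  obtain p q r s where g: "g = (p, q, r, s)" by (metis surj_pair)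
  obtain p' q' r' s' where h: "h = (p', q', r', s')" by (metis surj_pair)
  have dg: "p * s - q * r = 1" and dh: "p' * s' - q' * r' = 1"
    using cusp_reps_mdet assms g h by fastforce+
  from assms(6) obtain k u where u: "u = 1 \<or> u = -1"
    and e1: "a * p + b * r = u * ((a' * p' + b' * r') + k * (d' * r'))"
            "a * q + b * s = u * ((a' * q' + b' * s') + k * (d' * s'))"
    and e2: "d * r = u * (d' * r')" "d * s = u * (d' * s')"
    unfolding X Y g h by (simp, elim cusp_equivE) auto
  have cop: "gcd r s = 1" by (rule coprime_imp_gcd_eq_1[OF bezout_coprime[OF dg]])
  have cop': "gcd r' s' = 1" by (rule coprime_imp_gcd_eq_1[OF bezout_coprime[OF dh]])
  \<comment> \<open>Bottom rows of \<open>g\<close> and \<open>h\<close> are primitive, so the gcd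
    of the bottom row of the product recovers \<open>d\<close>.\<close>
  have "d * gcd r s = gcd (d * r) (d * s)" using X by (simp add: gcd_mult_left)
  also have "\<dots> = gcd (d' * r') (d' * s')" unfolding e2 using u by auto
  also have "\<dots> = d' * gcd r' s'" using Y by (simp add: gcd_mult_left)
  finally have dd: "d = d'" using cop cop' by simp
  have "d * r = d * (u * r')" "d * s = d * (u * s')" using e2 dd by (simp_all add: algebra_simps)
  then have "r = u * r'" "s = u * s'" using X by simp_all
  then have gh: "g = h"
    using cusp_reps_bottom_row_unique[OF assms(3,4)[unfolded g h] u] by (simp add: g h)
  have "a * d = a' * d" using X Y dd by simp
  then have aa: "a = a'" using X by simp
  have u1: "u = 1"
  proof (rule ccontr)
    assume "u \<noteq> 1"
    then have "u = -1" using u by simp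
    then have "r = 0" "s = 0" using \<open>r = u * r'\<close> \<open>s = u * s'\<close> gh g h by auto
    then show False using dg by simp
  qed
  have "b * r = (b' + k * d) * r" "b * s = (b' + k * d) * s"
    using e1 gh g h aa dd u1 by (auto simp: algebra_simps)
  moreover have "r \<noteq> 0 \<or> s \<noteq> 0" using dg by auto
  ultimately have bk: "b = b' + k * d" by auto
  have "b mod d = b' mod d" unfolding bk by simp
  moreover have "b mod d = b" "b' mod d = b'" using X Y dd by auto
  ultimately have "b = b'" by simp
  then show ?thesis using gh aa dd by (simp add: X Y)
qed

lemma finite_hecke_reps: "m \<ge> 1 \<Longrightarrow> finite (hecke_reps m)"
proof -
  assume m: "m \<ge> 1"
  have "hecke_reps m \<subseteq> {0..int m} \<times> {0..int m} \<times> {0} \<times> {0..int m}"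
  proof
    fix X assume "X \<in> hecke_reps m"
    then obtain a b d where X: "X = (a, b, 0, d)" "a * d = int m" "0 < d" "0 \<le> b" "b < d"
      by (auto simp: hecke_reps_def)
    have a: "a > 0" using X m by (metis of_nat_0_less_iff order_less_le_trans zero_less_mult_pos2 zero_less_one)
    have "d dvd int m" "a dvd int m" using X by (metis dvd_triv_left dvd_triv_right)+
    then have "d \<le> int m" "a \<le> int m" using m by (auto intro: zdvd_imp_le)
    then show "X \<in> {0..int m} \<times> {0..int m} \<times> {0} \<times> {0..int m}" using X a by auto
  qed
  then show ?thesis by (rule finite_subset) simp
qed

lemma sum_hecke_reps:
  fixes f :: "mat2 \<Rightarrow> 'a :: comm_monoid_add"
  assumes "m \<ge> 1"
  shows "sum f (hecke_reps m) = (\<Sum>d | d dvd m. \<Sum>b<d. f (int (m div d), int b, 0, int d))"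
proof -
  have fin: "finite {d. d dvd m}" using assms by simp
  have "(\<Sum>d | d dvd m. \<Sum>b<d. f (int (m div d), int b, 0, int d)) =
        sum (\<lambda>(d, b). f (int (m div d), int b, 0, int d)) (Sigma {d. d dvd m} (\<lambda>d. {..<d}))"
    by (rule sum.Sigma) (use fin in auto)
  also have "\<dots> = sum f (hecke_reps m)"
  proof (rule sum.reindex_bij_witness[of _ "\<lambda>(a, b, c, d). (nat d, nat b)" "\<lambda>(d, b). (int (m div d), int b, 0, int d)"], goal_cases)
    case (2 x)
    then show ?case using assms by (auto simp: hecke_reps_def dvd_pos_nat simp flip: of_nat_mult)
  next
    case (3 X)
    then obtain a b d where X: "X = (a, b, 0, d)" "a * d = int m" "0 < d" "0 \<le> b" "b < d"
      by (auto simp: hecke_reps_def)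
    have "int (m div nat d) = int m div d" using X by (simp add: zdiv_int)
    also have "\<dots> = a" using X(2)[symmetric] X(3) by simp
    finally show ?case using X by simp
  next
    case (4 X)
    then obtain a b d where X: "X = (a, b, 0, d)" "a * d = int m" "0 < d" "0 \<le> b" "b < d"
      by (auto simp: hecke_reps_def)
    have "d dvd int m" using X by (metis dvd_triv_right)
    then have "nat d dvd m" using X by (simp add: nat_dvd_iff)
    then show ?case using X by auto
  qed auto
  finally show ?thesis by simp
qed

lemma card_hecke_reps: "m \<ge> 1 \<Longrightarrow> card (hecke_reps m) = divisor_sigma 1 m"
  using sum_hecke_reps[of m "\<lambda>_. 1 :: nat"] by (simp add: divisor_sigma_def)

subsection \<open>\<open>j\<^sub>m\<close> as a Hecke sum\<close>

lemma root_of_unity_sum: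
  assumes "d > 1"
  shows "(\<Sum>b<d. e (- of_nat b / of_nat d)) = 0"
proof -
  define \<zeta> where "\<zeta> = e (- 1 / of_nat d)"
  have pow: "\<zeta> ^ b = e (- of_nat b / of_nat d)" for b
    using e_of_nat_mult[of b "- 1 / of_nat d"] by (simp add: \<zeta>_def)
  have "\<zeta> ^ d = e (of_int (- 1))" using assms by (simp add: pow)
  then have 1: "\<zeta> ^ d = 1" by (simp only: e_of_int)
  have "\<zeta> \<noteq> 1"
  proof
    assume "\<zeta> = 1"
    then have "exp (2 * of_real pi * \<i> * (- 1 / of_nat d)) = 1" by (simp add: \<zeta>_def e_def)
    then obtain n :: int where n: "Im (2 * of_real pi * \<i> * (- 1 / of_nat d)) = of_int (2 * n) * pi"
      unfolding exp_eq_1 by blast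
    have "2 * of_real pi * \<i> * (- 1 / of_nat d) = \<i> * of_real (- (2 * pi / real d))" by simp
    then have "Im (2 * of_real pi * \<i> * (- 1 / of_nat d)) = - (2 * pi / real d)"
      by (simp only: Im_i_times Re_complex_of_real)
    with n have "2 * pi * (- (1 / real d)) = 2 * pi * of_int n" by simp
    then have "- (1 / real d) = of_int n" by (rule mult_left_cancel[THEN iffD1, rotated]) simp
    then have "of_int n * real d = - 1" using assms by (simp add: field_simps)
    then have "of_int (n * int d) = (of_int (- 1) :: real)" by simp
    then have "n * int d = - 1" by (simp only: of_int_eq_iff)
    then have "int d dvd 1" by (metis dvd_minus_iff dvd_triv_right)
    then show False using assms by simp
  qed
  then have "(\<Sum>b<d. \<zeta> ^ b) = 0" using 1 by (simp add: geometric_sum)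
  then show ?thesis by (simp add: pow)
qed

text \<open>The height of \<open>mob X w\<close> does not depend on \<open>b\<close>, so a condition
  \<open>P\<close> on it factors out and the sum over \<open>b\<close> runs over roots of unity.
  Only \<open>d = 1\<close> survives. The lemma is applied once without a cutoff and once with the
  cutoff at height \<open>1\<close>.\<close>

lemma hecke_exponential_sum:
  assumes m: "m \<ge> 1"
  shows "(\<Sum>X\<in>hecke_reps m. if P (Im (mob X w)) then e (- mob X w) else 0)
    = (if P (real m * Im w) then e (- of_nat m * w) else 0)"
proof -
  define f where "f X = (if P (Im (mob X w)) then e (- mob X w) else 0)" for X
  have "(\<Sum>b<d. f (int (m div d), int b, 0, int d)) =
      (if d = 1 then (if P (real m * Im w) then e (- of_nat m * w) else 0) else 0)" if d: "d dvd m" for d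
  proof -
    have d0: "d > 0" using d m by (auto intro: Nat.gr0I)
    define u where "u = of_nat (m div d) * w / of_nat d"
    have eq: "mob (int (m div d), int b, 0, int d) w = u + of_nat b / of_nat d" for b
      by (simp add: u_def add_divide_distrib)
    have "Im (u + of_nat b / of_nat d) = Im u" for b
    proof -
      have "u + of_nat b / of_nat d = u + of_real (real b / real d)" by simp
      then show ?thesis by (simp only: plus_complex.sel Im_complex_of_real)
    qed
    moreover have "e (- (u + of_nat b / of_nat d)) = e (- u) * e (- of_nat b / of_nat d)" for b
      by (simp flip: e_add)
    ultimately have "f (int (m div d), int b, 0, int d) = (if P (Im u) then e (- u) else 0) * e (- of_nat b / of_nat d)" for b
      by (simp only: f_def eq) simp
    then have s: "(\<Sum>b<d. f (int (m div d), int b, 0, int d)) = (if P (Im u) then e (- u) else 0) * (\<Sum>b<d. e (- of_nat b / of_nat d))"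
      by (simp only: sum_distrib_left)
    show ?thesis
    proof (cases "d = 1")
      case True
      have "e 0 = 1" by (simp add: e_def)
      then show ?thesis unfolding s using True by (simp add: u_def)
    next
      case False
      then show ?thesis unfolding s using root_of_unity_sum[of d] d0 by simp
    qed
  qed
  then have "(\<Sum>d | d dvd m. \<Sum>b<d. f (int (m div d), int b, 0, int d)) =
      (\<Sum>d | d dvd m. if d = 1 then (if P (real m * Im w) then e (- of_nat m * w) else 0) else 0)"
    by (intro sum.cong) auto
  also have "\<dots> = (if P (real m * Im w) then e (- of_nat m * w) else 0)"
    using m by (subst sum.delta) auto
  finally show ?thesis unfolding f_def[symmetric] sum_hecke_reps[OF m] .
qed

lemma mdet_hecke_pos: "m \<ge> 1 \<Longrightarrow> X \<in> hecke_reps m \<Longrightarrow> mdet X > 0"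
  using hecke_reps_mdet[of X m] by simp

lemma klein_j_minus_exp_tendsto: "((\<lambda>w. klein_j w - 744 - e (- w)) \<longlongrightarrow> 0) cusp"
proof (rule Lim_null_comparison)
  show "eventually (\<lambda>w. norm (klein_j w - 744 - e (- w)) \<le> 1500000 * cmod (e w)) cusp"
    unfolding eventually_cusp
  proof (intro exI[of _ 1] allI impI)
    fix w assume w: "Im w > 1"
    have "sqrt 3 \<le> 2" by (rule real_le_lsqrt) simp_all
    then have "cmod (e w) \<le> 1 / 200" using w by (intro norm_e_le) simp
    then show "norm (klein_j w - 744 - e (- w)) \<le> 1500000 * cmod (e w)"
      using w by (intro klein_j_near_cusp) simp_all
  qed
  show "((\<lambda>w. 1500000 * cmod (e w)) \<longlongrightarrow> 0) cusp"
    using tendsto_mult_right_zero[OF tendsto_norm_zero[OF tendsto_e_cusp]] .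
qed

lemma filterlim_mob_hecke:
  assumes "m \<ge> 1" "X \<in> hecke_reps m"
  shows "filterlim (mob X) cusp cusp"
proof -
  obtain a b d where X: "X = (a, b, 0, d)" "a * d = int m" "0 < d"
    using assms(2) by (auto simp: hecke_reps_def)
  have a: "a > 0" using X assms(1)
    by (metis of_nat_0_less_iff order_less_le_trans zero_less_mult_pos2 zero_less_one)
  have Im: "Im (mob X z) = of_int a / of_int d * Im z" for z
  proof -
    have "mob X z = (of_int a * z + of_int b) / of_real (of_int d)" by (simp add: X)
    then show ?thesis by (simp only: Im_divide_of_real) simp
  qed
  have "filterlim (\<lambda>z. of_int a / of_int d * Im z) at_top cusp"
    by (rule filterlim_tendsto_pos_mult_at_top[OF tendsto_const _ filterlim_filtercomap]) (use a X in simp)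
  then show ?thesis by (simp add: filterlim_filtercomap_iff o_def Im)
qed

theorem jm_eq_hecke_sum:
  assumes m: "m \<ge> 1" and z: "Im z > 0"
  shows "jm m z = (\<Sum>X\<in>hecke_reps m. klein_j (mob X z) - 744)"
proof -
  define T where "T z = (\<Sum>X\<in>hecke_reps m. klein_j (mob X z) - 744)" for z
  have fin: "finite (hecke_reps m)" by (rule finite_hecke_reps[OF m])
  have inv: "T (mob g z) = T z" if g: "mdet g = 1" and z: "Im z > 0" for g z
  proof -
    \<comment> \<open>Right multiplication by \<open>g\<close> permutes the orbits that
      \<open>hecke_reps\<close> represents; \<open>\<sigma>\<close> below is this permutation, and
      \<open>\<gamma>\<close> disappears by invariance of \<open>j\<close>.\<close>
    have "\<exists>Y \<gamma>. Y \<in> hecke_reps m \<and> mdet \<gamma> = 1 \<and> mmul X g = mmul \<gamma> Y" if "X \<in> hecke_reps m" for X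
    proof -
      have "mdet (mmul X g) = int m" using g hecke_reps_mdet[OF that] by (simp add: mdet_mmul)
      from hnf_exists[OF this m] show ?thesis by metis
    qed
    then obtain \<sigma> \<gamma> where \<sigma>: "\<And>X. X \<in> hecke_reps m \<Longrightarrow> \<sigma> X \<in> hecke_reps m"
      "\<And>X. X \<in> hecke_reps m \<Longrightarrow> mdet (\<gamma> X) = 1"
      "\<And>X. X \<in> hecke_reps m \<Longrightarrow> mmul X g = mmul (\<gamma> X) (\<sigma> X)" by metis
    have "inj_on \<sigma> (hecke_reps m)"
    proof (rule inj_onI)
      fix X Y assume XY: "X \<in> hecke_reps m" "Y \<in> hecke_reps m" "\<sigma> X = \<sigma> Y"
      have "\<sigma> Y = mmul (minv (\<gamma> Y)) (mmul Y g)"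
        unfolding \<sigma>(3)[OF XY(2)] using \<sigma>(2)[OF XY(2)] by (simp only: mmul_assoc[symmetric] mmul_minv mmul_mid)
      then have "mmul X g = mmul (\<gamma> X) (mmul (minv (\<gamma> Y)) (mmul Y g))"
        using \<sigma>(3)[OF XY(1)] XY(3) by simp
      then have "mmul (mmul X g) (minv g) = mmul (mmul (mmul (\<gamma> X) (minv (\<gamma> Y))) Y) (mmul g (minv g))"
        by (simp only: mmul_assoc)
      then have "X = mmul (mmul (\<gamma> X) (minv (\<gamma> Y))) Y"
        using g by (simp only: mmul_assoc mmul_minv mmul_mid)
      moreover have "mdet (mmul (\<gamma> X) (minv (\<gamma> Y))) = 1" using \<sigma>(2) XY by (simp add: mdet_mmul)
      ultimately show "X = Y" using hnf_unique[OF XY(1,2) m] by blast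
    qed
    moreover from this have "\<sigma> ` hecke_reps m = hecke_reps m"
      using \<sigma>(1) fin by (intro endo_inj_surj) auto
    ultimately have "T z = (\<Sum>X\<in>hecke_reps m. klein_j (mob (\<sigma> X) z) - 744)"
      unfolding T_def by (metis (no_types, lifting) sum.reindex_cong)
    also have "\<dots> = T (mob g z)"
      unfolding T_def
    proof (rule sum.cong[OF refl])
      fix X assume X: "X \<in> hecke_reps m"
      have d: "mdet (\<sigma> X) > 0" by (rule mdet_hecke_pos[OF m \<sigma>(1)[OF X]])
      have "mob X (mob g z) = mob (\<gamma> X) (mob (\<sigma> X) z)"
        using \<sigma>(3)[OF X] g z d by (metis less_irrefl mob_mmul zero_neq_one)
      then show "klein_j (mob (\<sigma> X) z) - 744 = klein_j (mob X (mob g z)) - 744"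
        using klein_j_mob[OF Im_mob_pos[OF z d] \<sigma>(2)[OF X]] by simp
    qed
    finally show ?thesis by simp
  qed
  have hol: "T holomorphic_on upper_half"
  proof -
    have "(\<lambda>z. klein_j (mob X z)) holomorphic_on upper_half" if X: "X \<in> hecke_reps m" for X
    proof -
      obtain a b d where X': "X = (a, b, 0, d)" "0 < d" using X by (auto simp: hecke_reps_def)
      have "mob X holomorphic_on upper_half"
        unfolding X' mob.simps[abs_def] using X'(2) by (auto intro!: holomorphic_intros simp: X'(1) fun_eq_iff cong: holomorphic_cong)
      moreover have "mob X ` upper_half \<subseteq> upper_half"
        using Im_mob_pos[OF _ mdet_hecke_pos[OF m X]] by auto
      ultimately show ?thesis
        using holomorphic_on_compose_gen[OF _ klein_j_holomorphic] by (simp add: o_def)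
    qed
    then show ?thesis unfolding T_def[abs_def] by (intro holomorphic_intros)
  qed
  \<comment> \<open>The exponentials of all Hecke terms add up to \<open>e (- m z)\<close>, so
    \<open>T\<close> and \<open>jm m\<close> have the same principal part and both lack a constant
    term.\<close>
  have "((\<lambda>z. T z - e (- of_nat m * z)) \<longlongrightarrow> 0) cusp"
  proof -
    have "((\<lambda>z. \<Sum>X\<in>hecke_reps m. klein_j (mob X z) - 744 - e (- mob X z)) \<longlongrightarrow> 0) cusp"
      by (intro tendsto_null_sum filterlim_compose[OF klein_j_minus_exp_tendsto filterlim_mob_hecke[OF m]])
    moreover have "(\<Sum>X\<in>hecke_reps m. klein_j (mob X z) - 744 - e (- mob X z)) = T z - e (- of_nat m * z)" for z
      using hecke_exponential_sum[OF m, of "\<lambda>_. True" z] by (simp add: T_def sum_subtractf)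
    ultimately show ?thesis by simp
  qed
  from tendsto_diff[OF jm_tendsto[of m] this]
  have "((\<lambda>z. jm m z - T z) \<longlongrightarrow> 0) cusp" by simp
  then have "jm m z - T z = 0"
    by (intro invariant_vanishing_at_cusp_eq_0[where f = "\<lambda>z. jm m z - T z", OF _ _ _ z])
       (auto intro!: holomorphic_intros hol jm_holomorphic simp: inv jm_mob)
  then show ?thesis by (simp add: T_def)
qed

subsection \<open>Approximation of \<open>j\<^sub>m\<close> by exponentials\<close>

text \<open>A lower bound on the height bounds the denominator, leaving finitely many bottom rows,
  and a bottom row determines the representative.\<close>

lemma finite_cusp_reps_high:
  assumes z: "Im z > 0" and c: "c > 0"
  shows "finite {g \<in> cusp_reps. Im (mob g z) > c}"
proof -
  let ?S = "{g \<in> cusp_reps. Im (mob g z) > c}"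
  define row where "row = (\<lambda>(p::int, q::int, r::int, s::int). (r, s))"
  have "row ` ?S \<subseteq> {(r, s). cmod (of_int r * z + of_int s) \<le> sqrt (Im z / c)}"
  proof (rule image_subsetI)
    fix g assume g: "g \<in> ?S"
    obtain p q r s where gg: "g = (p, q, r, s)" by (metis surj_pair)
    have det: "mdet g = 1" using g cusp_reps_mdet by blast
    then have rs: "(r, s) \<noteq> (0, 0)" using gg by auto
    have n: "cmod (of_int r * z + of_int s) > 0" using of_int_denominator_nonzero[OF z rs] by simp
    have "Im (mob g z) = Im z / (cmod (of_int r * z + of_int s))\<^sup>2"
      unfolding gg Im_mob[OF z rs] det[unfolded gg] by simp
    then have "c < Im z / (cmod (of_int r * z + of_int s))\<^sup>2" using g by simp
    then have "(cmod (of_int r * z + of_int s))\<^sup>2 \<le> Im z / c" using n c by (simp add: field_simps)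
    then have "cmod (of_int r * z + of_int s) \<le> sqrt (Im z / c)" by (rule real_le_rsqrt)
    then show "row g \<in> {(r, s). cmod (of_int r * z + of_int s) \<le> sqrt (Im z / c)}" by (simp add: row_def gg)
  qed
  then have "finite (row ` ?S)" using finite_small_denominators[OF z] finite_subset by blast
  moreover have "inj_on row ?S"
  proof (rule inj_onI)
    fix g h assume gh: "g \<in> ?S" "h \<in> ?S" "row g = row h"
    obtain p q r s where g: "g = (p, q, r, s)" by (metis surj_pair)
    obtain p' q' r' s' where h: "h = (p', q', r', s')" by (metis surj_pair)
    show "g = h" using cusp_reps_bottom_row_unique[of p q r s p' q' r' s' 1] gh g h by (simp add: row_def)
  qed
  ultimately show ?thesis by (rule finite_imageD)
qed

text \<open>If \<open>N\<close> carries a point \<open>w\<close> of height above \<open>1\<close> to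
  another such point and its lower left entry \<open>r\<close> is nonzero, then the new height is at
  most \<open>Im w / (r Im w)^2 < 1\<close>. So \<open>N\<close> is a signed shift.\<close>

lemma cusp_reps_high_unique:
  assumes t: "Im t > 0" and g: "g \<in> cusp_reps" "Im (mob g t) > 1" and h: "h \<in> cusp_reps" "Im (mob h t) > 1"
  shows "g = h"
proof -
  define w where "w = mob g t"
  have dg: "mdet g = 1" "mdet h = 1" using g h cusp_reps_mdet by auto
  define N where "N = mmul h (minv g)"
  have hN: "h = mmul N g" using dg unfolding N_def by (simp only: mmul_assoc mmul_minv mmul_mid)
  have dN: "mdet N = 1" using dg by (simp add: N_def mdet_mmul)
  obtain p q r s where N: "N = (p, q, r, s)" by (metis surj_pair)
  have det: "p * s - q * r = 1" using dN N by simp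
  have ht: "mob h t = mob N w" unfolding hN w_def using t dg by (simp add: mob_mmul)
  have w1: "Im w > 1" using g by (simp add: w_def)
  have "r = 0"
  proof (rule ccontr)
    assume r: "r \<noteq> 0"
    then have rs: "(r, s) \<noteq> (0, 0)" by simp
    have "Im w \<le> \<bar>of_int r\<bar> * Im w" using r w1 by (simp add: mult_le_cancel_right1)
    also have "\<dots> = \<bar>Im (of_int r * w + of_int s)\<bar>" using w1 by (simp add: abs_mult)
    also have "\<dots> \<le> cmod (of_int r * w + of_int s)" by (rule abs_Im_le_cmod)
    finally have "(Im w)\<^sup>2 \<le> (cmod (of_int r * w + of_int s))\<^sup>2" using w1 by (intro power_mono) auto
    moreover have "Im w * 1 < Im w * Im w" using w1 by (intro mult_strict_left_mono) auto
    ultimately have "Im w \<le> (cmod (of_int r * w + of_int s))\<^sup>2" by (simp add: power2_eq_square)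
    moreover have "Im (mob N w) = Im w / (cmod (of_int r * w + of_int s))\<^sup>2"
      using Im_mob[of w r s p q] w1 rs unfolding dN[unfolded N] N by simp
    ultimately have "Im (mob N w) \<le> 1" using w1 by (simp add: divide_le_eq_1)
    then show False using h ht by simp
  qed
  then have ps: "p * s = 1" using det by simp
  then have "s = 1 \<or> s = -1" "p = s" by (auto simp: zmult_eq_1_iff)
  then have "cusp_equiv N mid" unfolding N mid_def
    by (intro cusp_equivI[of s _ _ "s * q"]) (use \<open>r = 0\<close> in auto)
  then have "cusp_equiv h g" unfolding hN using cusp_equiv_mmul[of N mid g] by simp
  then show ?thesis using cusp_reps_unique[OF h(1) g(1)] by simp
qed

text \<open>Crudely \<open>pi < 4\<close> and \<open>exp 1 <= 3\<close>, so the value is at most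
  \<open>3^8\<close>.\<close>

lemma exp_2pi_le: "exp (2 * pi) \<le> 6561"
proof -
  have "exp (2 * pi) \<le> exp (8 * 1)" using pi_less_4 by simp
  also have "\<dots> = exp 1 ^ 8" using exp_of_nat_mult[of 8 "1::real"] by simp
  also have "\<dots> \<le> 3 ^ 8" using exp_le by (intro power_mono) auto
  finally show ?thesis by simp
qed

text \<open>Where \<open>Im w >= sqrt 3 / 2\<close> the error is at most
  \<open>1500000 / 200 = 7500\<close>. If no translate is higher than \<open>1\<close>, the
  exponential omitted on the fundamental domain costs at most \<open>6561\<close> more;
  \<open>20000\<close> covers both.\<close>

lemma klein_j_approximation:
  assumes t: "Im t > 0"
  shows "cmod (klein_j t - 744 - (\<Sum>g | g \<in> cusp_reps \<and> Im (mob g t) > 1. e (- mob g t))) \<le> 20000"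
proof -
  have near: "cmod (klein_j w - 744 - e (- w)) \<le> 7500" if w: "Im w \<ge> sqrt 3 / 2" for w
  proof -
    have q: "cmod (e w) \<le> 1 / 200" by (rule norm_e_le[OF w])
    have "sqrt 3 / 2 > (0::real)" by simp
    then have "Im w > 0" using w by linarith
    then show ?thesis using klein_j_near_cusp[OF _ q] q by simp
  qed
  show ?thesis
  proof (cases "\<exists>g\<in>cusp_reps. Im (mob g t) > 1")
    case True
    then obtain g where g: "g \<in> cusp_reps" "Im (mob g t) > 1" by blast
    then have "{g. g \<in> cusp_reps \<and> Im (mob g t) > 1} = {g}"
      using cusp_reps_high_unique[OF t] by blast
    then have "(\<Sum>g | g \<in> cusp_reps \<and> Im (mob g t) > 1. e (- mob g t)) = e (- mob g t)" by simp
    moreover have "klein_j t = klein_j (mob g t)" using klein_j_mob[OF t cusp_reps_mdet[OF g(1)]] by simp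
    moreover have "sqrt 3 \<le> 2" by (rule real_le_lsqrt) simp_all
    then have "cmod (klein_j (mob g t) - 744 - e (- mob g t)) \<le> 7500" using g by (intro near) simp
    ultimately show ?thesis by simp
  next
    case False
    obtain M where M: "mdet M = 1" "mob M t \<in> fund_domain" using reduction_to_fund_domain[OF t] .
    define w where "w = mob M t"
    have "Im w \<le> 1"
    proof (rule ccontr)
      assume "\<not> Im w \<le> 1"
      moreover obtain g where g: "g \<in> cusp_reps" "cusp_equiv M g" using cusp_reps_exists[OF M(1)] .
      moreover obtain k where "mob M t = mob g t + of_int k"
        using cusp_equiv_mob[OF g(2) t] cusp_reps_mdet[OF g(1)] by auto
      ultimately show False using False by (auto simp: w_def)
    qed
    then have "cmod (e (- w)) \<le> exp (2 * pi)" by (simp add: norm_e)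
    also note exp_2pi_le
    finally have "cmod (e (- w)) \<le> 6561" .
    moreover have "cmod (klein_j w - 744 - e (- w)) \<le> 7500"
      unfolding w_def by (intro near fund_domain_Im(1) M)
    ultimately have "cmod (klein_j w - 744) \<le> 20000"
      using norm_triangle_ineq[of "klein_j w - 744 - e (- w)" "e (- w)"] by simp
    moreover have "klein_j w = klein_j t" unfolding w_def by (rule klein_j_mob[OF t M(1)])
    moreover have "{g. g \<in> cusp_reps \<and> Im (mob g t) > 1} = {}" using False by blast
    ultimately show ?thesis by (simp only: sum.empty diff_0_right)
  qed
qed

text \<open>Both \<open>g X\<close> and \<open>X g\<close> run through the integral matrices of determinant \<open>m\<close> modulo
  \<^const>\<open>cusp_equiv\<close>.\<close>

lemma hecke_cusp_exchange:
  assumes m: "m \<ge> 1" and z: "Im z > 0"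
  shows "(\<Sum>(X, g) | X \<in> hecke_reps m \<and> g \<in> cusp_reps \<and> Im (mob g (mob X z)) > 1. e (- mob g (mob X z)))
       = (\<Sum>(X, g) | X \<in> hecke_reps m \<and> g \<in> cusp_reps \<and> Im (mob X (mob g z)) > 1. e (- mob X (mob g z)))"
proof -
  define U where "U = hecke_reps m \<times> cusp_reps"
  \<comment> \<open>Pairs are related when \<open>g X\<close> and \<open>X' g'\<close> lie in the
    same coset. Both directions have solutions, chosen as \<open>j\<close> and \<open>i\<close>;
    uniqueness makes the two maps mutually inverse.\<close>
  define R where "R = (\<lambda>(X, g) (X', g'). cusp_equiv (mmul g X) (mmul X' g'))"
  have "\<exists>y. x \<in> U \<longrightarrow> y \<in> U \<and> R x y" for x
  proof (cases "x \<in> U")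
    case True
    then obtain X g where x: "x = (X, g)" "X \<in> hecke_reps m" "g \<in> cusp_reps" by (auto simp: U_def)
    have "mdet (mmul g X) = int m" using x hecke_reps_mdet cusp_reps_mdet by (simp add: mdet_mmul)
    from hecke_cusp_exists[OF this m] obtain X' g'
      where "X' \<in> hecke_reps m" "g' \<in> cusp_reps" "cusp_equiv (mmul g X) (mmul X' g')" .
    then show ?thesis by (intro exI[of _ "(X', g')"]) (simp add: U_def R_def x)
  qed auto
  then obtain j where j: "\<And>x. x \<in> U \<Longrightarrow> j x \<in> U" "\<And>x. x \<in> U \<Longrightarrow> R x (j x)" by metis
  have "\<exists>x. y \<in> U \<longrightarrow> x \<in> U \<and> R x y" for y
  proof (cases "y \<in> U")
    case True
    then obtain X g where y: "y = (X, g)" "X \<in> hecke_reps m" "g \<in> cusp_reps" by (auto simp: U_def)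
    have "mdet (mmul X g) = int m" using y hecke_reps_mdet cusp_reps_mdet by (simp add: mdet_mmul)
    from hnf_exists[OF this m] obtain X' \<gamma> where X': "X' \<in> hecke_reps m" "mdet \<gamma> = 1" "mmul X g = mmul \<gamma> X'" .
    obtain g' where g': "g' \<in> cusp_reps" "cusp_equiv \<gamma> g'" using cusp_reps_exists[OF X'(2)] .
    have "cusp_equiv (mmul g' X') (mmul X g)"
      unfolding X'(3) by (rule cusp_equiv_mmul[OF cusp_equiv_sym[OF g'(2)]])
    then show ?thesis using X' g' by (intro exI[of _ "(X', g')"]) (simp add: U_def R_def y)
  qed auto
  then obtain i where i: "\<And>x. x \<in> U \<Longrightarrow> i x \<in> U" "\<And>x. x \<in> U \<Longrightarrow> R (i x) x" by metis
  have R1: "y = y'" if "x \<in> U" "y \<in> U" "y' \<in> U" "R x y" "R x y'" for x y y'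
  proof -
    obtain X g X' g' where y: "y = (X, g)" "y' = (X', g')" by (metis surj_pair)
    have "cusp_equiv (mmul X g) (mmul X' g')"
      using that cusp_equiv_trans cusp_equiv_sym unfolding R_def y by (cases x) blast
    then show ?thesis using hecke_cusp_unique[of X m X' g g'] that m by (auto simp: U_def y)
  qed
  \<comment> \<open>The shift and sign are moved into \<open>\<gamma>\<close>, so that
    \<open>X\<close> and \<open>X'\<close> differ by a unimodular left factor and the normal form is
    unique.\<close>
  have R2: "x = x'" if "x \<in> U" "x' \<in> U" "y \<in> U" "R x y" "R x' y" for x x' y
  proof -
    obtain X g X' g' where x: "x = (X, g)" "x' = (X', g')" by (metis surj_pair)
    have U: "X \<in> hecke_reps m" "X' \<in> hecke_reps m" "g \<in> cusp_reps" "g' \<in> cusp_reps"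
      using that by (auto simp: U_def x)
    have dg: "mdet g = 1" "mdet g' = 1" using U cusp_reps_mdet by auto
    have "cusp_equiv (mmul g X) (mmul g' X')"
      using that cusp_equiv_trans cusp_equiv_sym unfolding R_def x by (cases y) blast
    then obtain k where "mmul g X = mmul (mshift k) (mmul g' X') \<or> mmul g X = mneg (mmul (mshift k) (mmul g' X'))"
      unfolding cusp_equiv_def by blast
    then obtain \<gamma> where \<gamma>: "mmul g X = mmul \<gamma> X'" "\<gamma> = mmul (mshift k) g' \<or> \<gamma> = mneg (mmul (mshift k) g')"
      unfolding mneg_def by (metis mmul_assoc)
    have d\<gamma>: "mdet \<gamma> = 1" using \<gamma>(2) dg by (auto simp: mdet_mmul)
    have "X = mmul (minv g) (mmul g X)" using dg by (simp only: mmul_assoc[symmetric] mmul_minv mmul_mid)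
    then have "X = mmul (mmul (minv g) \<gamma>) X'" using \<gamma>(1) by (simp add: mmul_assoc)
    moreover have "mdet (mmul (minv g) \<gamma>) = 1" using dg d\<gamma> by (simp add: mdet_mmul)
    ultimately have *: "X = X'" "mmul (minv g) \<gamma> = mid" using hnf_unique[OF U(1,2) m] by blast+
    have "\<gamma> = mmul g (mmul (minv g) \<gamma>)" using dg by (simp only: mmul_assoc[symmetric] mmul_minv mmul_mid)
    then have "\<gamma> = g" using * by simp
    then have "cusp_equiv g g'" unfolding cusp_equiv_def using \<gamma>(2) by blast
    then show ?thesis using cusp_reps_unique[OF U(3,4)] * by (simp add: x)
  qed
  \<comment> \<open>Related pairs give points that differ by an integer: the heights agree, hence
    the cutoffs, and so do the exponentials.\<close>
  have val: "Im (mob X (mob g z)) = Im (mob g0 (mob X0 z)) \<and> e (- mob X (mob g z)) = e (- mob g0 (mob X0 z))"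
    if "(X0, g0) \<in> U" "(X, g) \<in> U" "R (X0, g0) (X, g)" for X0 g0 X g
  proof -
    have d: "mdet X0 > 0" "mdet X > 0" "mdet g = 1" "mdet g0 = 1"
      using that mdet_hecke_pos[OF m] cusp_reps_mdet by (auto simp: U_def)
    have "cusp_equiv (mmul g0 X0) (mmul X g)" using that by (simp add: R_def)
    then obtain k where "mob (mmul g0 X0) z = mob (mmul X g) z + of_int k"
      using cusp_equiv_mob[OF _ z] d by (metis mdet_mmul mult.right_neutral less_irrefl)
    then have k: "mob g0 (mob X0 z) = mob X (mob g z) + of_int k" using d z by (simp add: mob_mmul)
    have "e (- mob g0 (mob X0 z)) = e (- mob X (mob g z) + of_int (- k))" unfolding k by simp
    then have "e (- mob g0 (mob X0 z)) = e (- mob X (mob g z))" by (simp only: e_add e_of_int mult_1_right)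
    then show ?thesis using k by simp
  qed
  show ?thesis
  proof (rule sum.reindex_bij_witness[of _ i j], goal_cases)
    case (1 x) then show ?case using R2[of "i (j x)" x "j x"] i j by (auto simp: U_def)
  next
    case (2 x)
    then have "x \<in> U" by (auto simp: U_def)
    then show ?case using val[of "fst x" "snd x" "fst (j x)" "snd (j x)"] j[of x] 2 by (auto simp: U_def)
  next
    case (3 y) then show ?case using R1[of "i y" "j (i y)" y] i j by (auto simp: U_def)
  next
    case (4 y)
    then have "y \<in> U" by (auto simp: U_def)
    then show ?case using val[of "fst (i y)" "snd (i y)" "fst y" "snd y"] i[of y] 4 by (auto simp: U_def)
  next
    case (5 x)
    then have "x \<in> U" by (auto simp: U_def)
    then show ?case using val[of "fst x" "snd x" "fst (j x)" "snd (j x)"] j[of x] by (simp add: case_prod_unfold)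
  qed
qed

theorem jm_approximation:
  assumes m: "m \<ge> 1" and z: "Im z > 0"
  shows "cmod (jm m z - (\<Sum>g | g \<in> cusp_reps \<and> Im (mob g z) > 1 / real m. e (- of_nat m * mob g z)))
           \<le> 20000 * real (divisor_sigma 1 m)"
proof -
  have fin: "finite (hecke_reps m)" by (rule finite_hecke_reps[OF m])
  have pos: "Im (mob X z) > 0" if "X \<in> hecke_reps m" for X
    using Im_mob_pos[OF z mdet_hecke_pos[OF m that]] .
  define F where "F = {g. g \<in> cusp_reps \<and> Im (mob g z) > 1 / real m}"
  have finF: "finite F" unfolding F_def by (rule finite_cusp_reps_high[OF z]) (use m in simp)
  \<comment> \<open>\<open>X\<close> multiplies the height by \<open>a / d <= m\<close>, so a height
    above \<open>1\<close> after \<open>X\<close> forces one above \<open>1 / m\<close> before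
    it.\<close>
  have inF: "g \<in> F" if hyps: "g \<in> cusp_reps" "X \<in> hecke_reps m" "Im (mob X (mob g z)) > 1" for X g
  proof -
    obtain a b d where X: "X = (a, b, 0, d)" "a * d = int m" "0 < d"
      using hyps(2) by (auto simp: hecke_reps_def)
    have a: "a > 0" using X m by (metis of_nat_0_less_iff order_less_le_trans zero_less_mult_pos2 zero_less_one)
    have w: "Im (mob g z) > 0" using Im_mob_pos[OF z] cusp_reps_mdet[OF hyps(1)] by simp
    have "mob X (mob g z) = (of_int a * mob g z + of_int b) / of_real (of_int d)" by (simp add: X)
    then have "Im (mob X (mob g z)) = of_int a * Im (mob g z) / of_int d" by (simp only: Im_divide_of_real) simp
    then have "of_int d < of_int a * Im (mob g z)" using hyps(3) X by (simp add: field_simps)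
    moreover have "of_int a * Im (mob g z) \<le> real m * Im (mob g z)"
    proof -
      have "a * 1 \<le> a * d" using a X by (intro mult_left_mono) auto
      then have "of_int a \<le> real m" using X(2) by linarith
      then show ?thesis using w by (intro mult_right_mono) auto
    qed
    moreover have "1 \<le> real_of_int d" using X by simp
    ultimately have "1 < real m * Im (mob g z)" by linarith
    then show ?thesis using hyps(1) m by (simp add: F_def field_simps)
  qed
  define G where "G X = {g. g \<in> cusp_reps \<and> Im (mob g (mob X z)) > 1}" for X
  have finG: "finite (G X)" if "X \<in> hecke_reps m" for X
    unfolding G_def by (rule finite_cusp_reps_high[OF pos[OF that]]) simp
  have "(\<Sum>X\<in>hecke_reps m. \<Sum>g\<in>G X. e (- mob g (mob X z))) =
        (\<Sum>(X, g)\<in>Sigma (hecke_reps m) G. e (- mob g (mob X z)))"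
    by (rule sum.Sigma) (use fin finG in auto)
  also have "Sigma (hecke_reps m) G = {(X, g). X \<in> hecke_reps m \<and> g \<in> cusp_reps \<and> Im (mob g (mob X z)) > 1}"
    by (auto simp: G_def)
  also note hecke_cusp_exchange[OF m z]
  also have "{(X, g). X \<in> hecke_reps m \<and> g \<in> cusp_reps \<and> Im (mob X (mob g z)) > 1}
      = prod.swap ` Sigma F (\<lambda>g. {X \<in> hecke_reps m. Im (mob X (mob g z)) > 1})"
    using inF by (auto simp: F_def image_iff)
  also have "(\<Sum>(X, g)\<in>prod.swap ` Sigma F (\<lambda>g. {X \<in> hecke_reps m. Im (mob X (mob g z)) > 1}). e (- mob X (mob g z)))
     = (\<Sum>(g, X)\<in>Sigma F (\<lambda>g. {X \<in> hecke_reps m. Im (mob X (mob g z)) > 1}). e (- mob X (mob g z)))"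
    by (subst sum.reindex) (auto simp: case_prod_unfold intro!: inj_onI)
  also have "\<dots> = (\<Sum>g\<in>F. \<Sum>X | X \<in> hecke_reps m \<and> Im (mob X (mob g z)) > 1. e (- mob X (mob g z)))"
    by (rule sum.Sigma[symmetric]) (use fin finF in auto)
  also have "\<dots> = (\<Sum>g\<in>F. e (- of_nat m * mob g z))"
  proof (rule sum.cong[OF refl])
    fix g assume g: "g \<in> F"
    have "(\<Sum>X | X \<in> hecke_reps m \<and> Im (mob X (mob g z)) > 1. e (- mob X (mob g z)))
      = (\<Sum>X\<in>hecke_reps m. if Im (mob X (mob g z)) > 1 then e (- mob X (mob g z)) else 0)"
      using fin by (rule sum.inter_filter)
    \<comment> \<open>On \<open>F\<close> the surviving cutoff \<open>m Im (g z) > 1\<close> holds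
      automatically.\<close>
    also have "\<dots> = e (- of_nat m * mob g z)"
      unfolding hecke_exponential_sum[OF m, of "\<lambda>y. y > 1"] using g m by (simp add: F_def field_simps)
    finally show "(\<Sum>X | X \<in> hecke_reps m \<and> Im (mob X (mob g z)) > 1. e (- mob X (mob g z))) = e (- of_nat m * mob g z)" .
  qed
  finally have "(\<Sum>g\<in>F. e (- of_nat m * mob g z)) = (\<Sum>X\<in>hecke_reps m. \<Sum>g\<in>G X. e (- mob g (mob X z)))" by simp
  then have "jm m z - (\<Sum>g\<in>F. e (- of_nat m * mob g z))
      = (\<Sum>X\<in>hecke_reps m. klein_j (mob X z) - 744 - (\<Sum>g\<in>G X. e (- mob g (mob X z))))"
    by (simp add: jm_eq_hecke_sum[OF m z] sum_subtractf)
  also have "cmod \<dots> \<le> (\<Sum>X\<in>hecke_reps m. 20000)"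
    unfolding G_def by (intro sum_norm_le klein_j_approximation pos)
  also have "\<dots> = 20000 * real (divisor_sigma 1 m)" by (simp add: card_hecke_reps[OF m])
  finally show ?thesis by (simp add: F_def)
qed

subsection \<open>The action on binary quadratic forms\<close>

text \<open>Substituting the inverse matrix makes the root equivariant: \<open>bqf_root\<close> of \<open>bqf_act g Q\<close> is
  \<open>mob g\<close> of the root of \<open>Q\<close>.\<close>

fun bqf_act :: "mat2 \<Rightarrow> bqf \<Rightarrow> bqf" where
  "bqf_act (p, q, r, s) (a, b, c) =
     (a * s\<^sup>2 - b * s * r + c * r\<^sup>2, - 2 * a * s * q + b * (s * p + q * r) - 2 * c * r * p,
      a * q\<^sup>2 - b * q * p + c * p\<^sup>2)"

lemma bqf_eval_act:
  "bqf_eval (bqf_act (p, q, r, s) Q) x y =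
     bqf_eval Q (of_int s * x - of_int q * y) (- of_int r * x + of_int p * y)" for x y :: "'a :: comm_ring_1"
  by (cases Q) (simp add: power2_eq_square algebra_simps)

lemma bqf_act_mmul: "bqf_act M (bqf_act N Q) = bqf_act (mmul M N) Q"
  by (cases M; cases N; cases Q) (simp add: power2_eq_square algebra_simps)

lemma bqf_act_mid [simp]: "bqf_act mid Q = Q"
  by (cases Q) (simp add: mid_def)

lemma bqf_act_minv: "mdet M = 1 \<Longrightarrow> bqf_act (minv M) (bqf_act M Q) = Q"
  by (simp add: bqf_act_mmul mmul_minv)

lemma bqf_disc_act:
  assumes "mdet M = 1" shows "bqf_disc (bqf_act M Q) = bqf_disc Q"
proof -
  obtain p q r s a b c where MQ: "M = (p, q, r, s)" "Q = (a, b, c)" by (metis surj_pair)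
  have "bqf_disc (bqf_act M Q) = (p * s - q * r)\<^sup>2 * bqf_disc Q"
    by (simp add: MQ power2_eq_square algebra_simps)
  then show ?thesis using assms MQ by simp
qed

lemma bqf_act_in_bqfs:
  assumes "mdet M = 1" "Q \<in> bqfs D" shows "bqf_act M Q \<in> bqfs D"
proof -
  obtain p q r s where M: "M = (p, q, r, s)" by (metis surj_pair)
  have det: "real_of_int p * real_of_int s - real_of_int q * real_of_int r = 1"
    using assms(1) unfolding M by (metis mdet.simps of_int_1 of_int_diff of_int_mult)
  have "bqf_eval (bqf_act M Q) x y > 0" if xy: "(x, y) \<noteq> (0, 0)" for x y :: real
  proof -
    define u v where "u = of_int s * x - of_int q * y" and "v = - of_int r * x + of_int p * y"
    have "of_int p * u + of_int q * v = (real_of_int p * real_of_int s - real_of_int q * real_of_int r) * x"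
         "of_int r * u + of_int s * v = (real_of_int p * real_of_int s - real_of_int q * real_of_int r) * y"
      by (simp_all add: u_def v_def algebra_simps)
    then have "(u, v) \<noteq> (0, 0)" using xy det by auto
    then show ?thesis using assms(2) unfolding M bqf_eval_act u_def[symmetric] v_def[symmetric]
      by (simp add: bqfs_def bqf_pos_def_def)
  qed
  then show ?thesis using assms bqf_disc_act by (simp add: bqfs_def bqf_pos_def_def)
qed

lemma bqfs_leading_pos: "(a, b, c) \<in> bqfs D \<Longrightarrow> a > 0"
proof -
  assume "(a, b, c) \<in> bqfs D"
  then have "\<forall>x y::real. (x, y) \<noteq> (0, 0) \<longrightarrow> bqf_eval (a, b, c) x y > 0"
    unfolding bqfs_def bqf_pos_def_def mem_Collect_eq by (rule conjunct1)
  from this[rule_format, of 1 0] show "a > 0" by simp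
qed

lemma bqf_root_Im_Re:
  assumes "(a, b, c) \<in> bqfs D"
  shows "Re (bqf_root (a, b, c)) = - of_int b / (2 * of_int a)"
    and "Im (bqf_root (a, b, c)) = sqrt \<bar>of_int D\<bar> / (2 * of_int a)"
proof -
  have D: "bqf_disc (a, b, c) = D" using assms by (simp add: bqfs_def)
  have "bqf_root (a, b, c) = Complex (- of_int b / (2 * of_int a)) (sqrt \<bar>of_int D\<bar> / (2 * of_int a))"
  proof -
    have "bqf_root (a, b, c) = (Complex (- of_int b) (sqrt \<bar>of_int D\<bar>)) / of_real (2 * of_int a)"
      unfolding bqf_root.simps D by (simp add: complex_eq_iff)
    then show ?thesis by (simp add: complex_eq_iff)
  qed
  then show "Re (bqf_root (a, b, c)) = - of_int b / (2 * of_int a)"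
    "Im (bqf_root (a, b, c)) = sqrt \<bar>of_int D\<bar> / (2 * of_int a)" by simp_all
qed

lemma bqf_root_Im_pos:
  assumes "D < 0" "Q \<in> bqfs D" shows "Im (bqf_root Q) > 0"
proof -
  obtain a b c where Q: "Q = (a, b, c)" by (metis surj_pair)
  then show ?thesis using bqf_root_Im_Re(2)[of a b c D] bqfs_leading_pos[of a b c D] assms by simp
qed

text \<open>Real and imaginary parts of the equation give \<open>b = - 2 a Re w\<close> and
  \<open>c = a |w|^2\<close>, hence \<open>D = - (2 a Im w)^2\<close>.\<close>

lemma bqf_root_unique:
  assumes D: "D < 0" and Q: "(a, b, c) \<in> bqfs D" and w: "Im w > 0"
    and eq: "of_int a * w\<^sup>2 + of_int b * w + of_int c = 0"
  shows "bqf_root (a, b, c) = w"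
proof -
  define x y where "x = Re w" and "y = Im w"
  have a: "a > 0" by (rule bqfs_leading_pos[OF Q])
  have disc: "b\<^sup>2 - 4 * a * c = D" using Q by (simp add: bqfs_def)
  from arg_cong[OF eq, of Im] have "y * (2 * of_int a * x + of_int b) = 0"
    by (simp add: x_def y_def power2_eq_square algebra_simps)
  then have b: "of_int b = - (2 * of_int a * x)" using w by (auto simp: y_def)
  from arg_cong[OF eq, of Re] have "of_int a * (x\<^sup>2 - y\<^sup>2) + of_int b * x + of_int c = 0"
    by (simp add: x_def y_def power2_eq_square algebra_simps)
  then have c: "of_int c = of_int a * (x\<^sup>2 + y\<^sup>2)" unfolding b by (simp add: power2_eq_square algebra_simps)
  have "real_of_int D = (of_int b)\<^sup>2 - 4 * of_int a * of_int c" unfolding disc[symmetric] by simp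
  also have "\<dots> = - ((2 * of_int a * y)\<^sup>2)" unfolding b c by (simp add: power2_eq_square algebra_simps)
  finally have "\<bar>real_of_int D\<bar> = (2 * of_int a * y)\<^sup>2" by simp
  then have "sqrt \<bar>real_of_int D\<bar> = 2 * of_int a * y"
    using a w by (simp add: real_sqrt_unique y_def)
  then show ?thesis using bqf_root_Im_Re[OF Q] a b by (simp add: complex_eq_iff x_def y_def)
qed

lemma bqf_root_equation:
  assumes D: "D < 0" and Q: "(a, b, c) \<in> bqfs D"
  defines "z \<equiv> bqf_root (a, b, c)"
  shows "of_int a * z\<^sup>2 + of_int b * z + of_int c = 0"
proof -
  have a: "a > 0" by (rule bqfs_leading_pos[OF Q])
  have disc: "b\<^sup>2 - 4 * a * c = D" using Q by (simp add: bqfs_def)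
  define S where "S = \<i> * of_real (sqrt \<bar>real_of_int D\<bar>)"
  have "S\<^sup>2 = - of_real (\<bar>real_of_int D\<bar>)"
    unfolding S_def by (simp add: power_mult_distrib flip: of_real_power)
  then have S2: "S\<^sup>2 = of_int (b\<^sup>2 - 4 * a * c)" unfolding disc using D by simp
  have dz: "2 * of_int a * z = - of_int b + S"
    using a disc by (simp add: z_def S_def)
  have "4 * of_int a * (of_int a * z\<^sup>2 + of_int b * z + of_int c) =
      (2 * of_int a * z)\<^sup>2 + 2 * of_int b * (2 * of_int a * z) + 4 * of_int a * of_int c"
    by (simp add: power2_eq_square algebra_simps)
  also have "\<dots> = S\<^sup>2 - of_int (b\<^sup>2 - 4 * a * c)" unfolding dz by (simp add: power2_eq_square algebra_simps)
  also have "\<dots> = 0" using S2 by simp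
  finally show ?thesis using a by simp
qed

declare bqf_root.simps [simp del]

text \<open>The transformed form, evaluated at numerator and denominator of \<open>mob M z\<close>,
  equals the old form at \<open>(z, 1)\<close> and vanishes; the root in the upper half-plane is
  unique.\<close>

lemma bqf_root_act:
  assumes D: "D < 0" and Q: "Q \<in> bqfs D" and M: "mdet M = 1"
  shows "bqf_root (bqf_act M Q) = mob M (bqf_root Q)"
proof -
  obtain p q r s where M': "M = (p, q, r, s)" by (metis surj_pair)
  obtain a b c where Q': "Q = (a, b, c)" by (metis surj_pair)
  define z where "z = bqf_root Q"
  have z: "Im z > 0" unfolding z_def by (rule bqf_root_Im_pos[OF D Q])
  have eq: "of_int a * z\<^sup>2 + of_int b * z + of_int c = 0"
    using bqf_root_equation[OF D Q[unfolded Q']] by (simp add: z_def Q')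
  have det: "(of_int p * of_int s - of_int q * of_int r :: complex) = 1"
    using M unfolding M' by (metis mdet.simps of_int_1 of_int_diff of_int_mult)
  define P R where "P = of_int p * z + of_int q" and "R = of_int r * z + of_int s"
  have R: "R \<noteq> 0" unfolding R_def using z M M' by (intro of_int_denominator_nonzero) auto
  have 1: "of_int s * P - of_int q * R = (of_int p * of_int s - of_int q * of_int r) * z"
       "- of_int r * P + of_int p * R = (of_int p * of_int s - of_int q * of_int r)"
    by (simp_all add: P_def R_def algebra_simps)
  have "bqf_eval (bqf_act M Q) P R = bqf_eval Q z 1"
    unfolding M' bqf_eval_act 1 det by simp
  also have "\<dots> = 0" using eq by (simp add: Q')
  finally have ev: "bqf_eval (bqf_act M Q) P R = 0" .
  obtain a' b' c' where A: "bqf_act M Q = (a', b', c')" by (metis surj_pair)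
  define w where "w = mob M z"
  have w: "w = P / R" by (simp add: w_def M' P_def R_def)
  have "of_int a' * w\<^sup>2 + of_int b' * w + of_int c' = bqf_eval (bqf_act M Q) P R / R\<^sup>2"
    unfolding A w using R by (simp add: power2_eq_square field_simps)
  then have "of_int a' * w\<^sup>2 + of_int b' * w + of_int c' = 0" using ev by simp
  moreover have "Im w > 0" unfolding w_def by (rule Im_mob_pos[OF z]) (simp add: M)
  ultimately have "bqf_root (a', b', c') = w"
    using bqf_act_in_bqfs[OF M Q] unfolding A by (intro bqf_root_unique[OF D])
  then show ?thesis by (simp add: A w_def z_def)
qed

lemma bqf_root_inj:
  assumes D: "D < 0" and Q: "Q \<in> bqfs D" "Q' \<in> bqfs D" "bqf_root Q = bqf_root Q'"
  shows "Q = Q'"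
proof -
  obtain a b c where Q1: "Q = (a, b, c)" by (metis surj_pair)
  obtain a' b' c' where Q2: "Q' = (a', b', c')" by (metis surj_pair)
  have a: "a > 0" "a' > 0" using Q bqfs_leading_pos Q1 Q2 by blast+
  have disc: "b\<^sup>2 - 4 * a * c = D" "b'\<^sup>2 - 4 * a' * c' = D" using Q by (simp_all add: bqfs_def Q1 Q2)
  have s: "sqrt \<bar>real_of_int D\<bar> > 0" using D by simp
  have "sqrt \<bar>real_of_int D\<bar> / (2 * of_int a) = sqrt \<bar>real_of_int D\<bar> / (2 * of_int a')"
    using arg_cong[OF Q(3), of Im] bqf_root_Im_Re(2) Q unfolding Q1 Q2 by metis
  then have aa: "a = a'" using s a by (simp add: field_simps)
  have "- real_of_int b / (2 * of_int a) = - of_int b' / (2 * of_int a')"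
    using arg_cong[OF Q(3), of Re] bqf_root_Im_Re(1) Q unfolding Q1 Q2 by metis
  then have bb: "b = b'" using aa a by (simp add: field_simps)
  have "4 * a' * c = 4 * a' * c'" using disc unfolding aa bb by linarith
  then show ?thesis using aa bb a by (simp add: Q1 Q2)
qed

lemma bqf_equiv_iff_act: "bqf_equiv Q Q' \<longleftrightarrow> (\<exists>M. mdet M = 1 \<and> Q' = bqf_act M Q)"
proof
  assume "bqf_equiv Q Q'"
  then obtain p q r s :: int where det: "p * s - q * r = 1"
    and ev: "\<And>x y::int. bqf_eval Q' x y = bqf_eval Q (p * x + q * y) (r * x + s * y)"
    unfolding bqf_equiv_def by blast
  \<comment> \<open>The inverse of the substitution, as \<open>bqf_act\<close> substitutes the
    inverse matrix.\<close>
  define M where "M = (s, - q, - r, p)"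
  have "bqf_eval Q' x y = bqf_eval (bqf_act M Q) x y" for x y :: int
    unfolding M_def bqf_eval_act ev by simp
  \<comment> \<open>The values \<open>a\<close>, \<open>c\<close> and \<open>a + b + c\<close>
    determine a form.\<close>
  then have "bqf_eval Q' 1 (0::int) = bqf_eval (bqf_act M Q) 1 0"
    "bqf_eval Q' 0 (1::int) = bqf_eval (bqf_act M Q) 0 1"
    "bqf_eval Q' 1 (1::int) = bqf_eval (bqf_act M Q) 1 1" by blast+
  then have "Q' = bqf_act M Q"
    by (cases Q'; cases "bqf_act M Q") simp
  moreover have "mdet M = 1" using det by (simp add: M_def algebra_simps)
  ultimately show "\<exists>M. mdet M = 1 \<and> Q' = bqf_act M Q" by blast
next
  assume "\<exists>M. mdet M = 1 \<and> Q' = bqf_act M Q"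
  then obtain M where M: "mdet M = 1" "Q' = bqf_act M Q" by blast
  obtain p q r s where M': "M = (p, q, r, s)" by (metis surj_pair)
  show "bqf_equiv Q Q'" unfolding bqf_equiv_def
    by (rule exI[of _ s], rule exI[of _ "- q"], rule exI[of _ "- r"], rule exI[of _ p])
       (use M in \<open>simp add: M' bqf_eval_act algebra_simps del: bqf_act.simps\<close>)
qed

lemma bqf_equiv_sym: "bqf_equiv Q Q' \<Longrightarrow> bqf_equiv Q' Q"
  unfolding bqf_equiv_iff_act by (metis bqf_act_minv mdet_minv)

lemma bqf_equiv_trans: "bqf_equiv Q Q' \<Longrightarrow> bqf_equiv Q' Q'' \<Longrightarrow> bqf_equiv Q Q''"
  unfolding bqf_equiv_iff_act by (metis bqf_act_mmul mdet_mmul mult_1)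

lemma genus_character_dvd_aux:
  assumes "bqf_act M (a, b, c) = (a', b', c')"
  shows "Gcd {a, b, c, d} dvd Gcd {a', b', c', d}"
proof -
  define h where "h = Gcd {a, b, c, d}"
  have "h dvd a" "h dvd b" "h dvd c" "h dvd d" unfolding h_def by (rule Gcd_dvd; simp)+
  then obtain A B C where abc: "a = h * A" "b = h * B" "c = h * C" by (auto elim!: dvdE)
  obtain p q r s where M: "M = (p, q, r, s)" by (metis surj_pair)
  have "a' = h * (A * s\<^sup>2 - B * s * r + C * r\<^sup>2)"
    "b' = h * (- 2 * A * s * q + B * (s * p + q * r) - 2 * C * r * p)"
    "c' = h * (A * q\<^sup>2 - B * q * p + C * p\<^sup>2)"
    using assms by (auto simp: M abc algebra_simps)
  then have "h dvd a'" "h dvd b'" "h dvd c'" by (metis dvd_triv_left)+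
  with \<open>h dvd d\<close> show ?thesis unfolding h_def[symmetric] by (intro Gcd_greatest) auto
qed

text \<open>Equivalent forms represent the same integers and have the same content with
  \<open>d\<close>. Hence \<open>SOME\<close> is applied to the same predicate on both sides and
  picks the same \<open>n\<close>.\<close>

lemma genus_character_act:
  assumes M: "mdet M = 1" shows "genus_character d (bqf_act M Q) = genus_character d Q"
proof -
  obtain a b c where Q: "Q = (a, b, c)" by (metis surj_pair)
  obtain a' b' c' where A: "bqf_act M Q = (a', b', c')" by (metis surj_pair)
  have inv: "bqf_act (minv M) (a', b', c') = (a, b, c)"
    using bqf_act_minv[OF M, of Q] A Q by simp
  have "Gcd {a, b, c, d} = Gcd {a', b', c', d}"
    using genus_character_dvd_aux[of M a b c a' b' c' d] genus_character_dvd_aux[OF inv, of d] A Q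
    by (simp add: zdvd_antisym_nonneg)
  moreover have sub: "\<exists>x y::int. n = bqf_eval Q x y" if "\<exists>x y::int. n = bqf_eval (bqf_act M Q) x y" for n M Q
  proof -
    obtain p q r s where M: "M = (p, q, r, s)" by (metis surj_pair)
    show ?thesis using that unfolding M bqf_eval_act by blast
  qed
  have "(\<exists>x y::int. n = bqf_eval (a, b, c) x y) \<longleftrightarrow> (\<exists>x y::int. n = bqf_eval (a', b', c') x y)" for n
    using sub[of n M "(a, b, c)"] sub[of n "minv M" "(a', b', c')"] unfolding inv A[unfolded Q] by blast
  ultimately show ?thesis unfolding A unfolding Q genus_character.simps by presburger
qed

subsection \<open>Stabilisers in the fundamental domain\<close>

definition rho :: complex where "rho = Complex (- 1 / 2) (sqrt 3 / 2)"

text \<open>Stabilisers modulo sign, meant for points of \<open>fund_domain\<close>, where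
  \<open>i\<close> and \<open>rho\<close> are the only elliptic points.\<close>

definition stabiliser_reps :: "complex \<Rightarrow> mat2 set" where
  "stabiliser_reps z = (if z = \<i> then {mid, (0, -1, 1, 0)}
     else if z = rho then {mid, (-1, -1, 1, 0), (0, -1, 1, 1)} else {mid})"

lemma rho_neq_i: "rho \<noteq> \<i>"
  by (simp add: rho_def complex_eq_iff)

lemma i_in_fund_domain: "\<i> \<in> fund_domain"
  by (simp add: fund_domain_def)

lemma cmod_rho: "cmod rho = 1"
  by (simp add: rho_def cmod_def power2_eq_square)

lemma rho_in_fund_domain: "rho \<in> fund_domain"
  using cmod_rho by (simp add: fund_domain_def) (simp add: rho_def)

lemma rho_squared: "rho * rho = - rho - 1"
  by (simp add: rho_def complex_eq_iff)

lemma rho_Re_Im: "Re rho = - 1 / 2" "Im rho = sqrt 3 / 2"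
  by (simp_all add: rho_def)

lemma rhoI:
  assumes "cmod z = 1" "Re z = - 1 / 2" "Im z > 0" shows "z = rho"
proof -
  have "(Re z)\<^sup>2 + (Im z)\<^sup>2 = 1" using assms by (metis cmod_power2 one_power2)
  then have "(Im z)\<^sup>2 = (sqrt 3 / 2)\<^sup>2" using assms by (simp add: power2_eq_square)
  then have "Im z = sqrt 3 / 2" using assms by (simp add: power2_eq_iff_nonneg)
  then show ?thesis using assms by (simp add: complex_eq_iff rho_Re_Im)
qed

lemma stabiliser_reps_mdet: "\<sigma> \<in> stabiliser_reps z \<Longrightarrow> mdet \<sigma> = 1"
  by (auto simp: stabiliser_reps_def mid_def split: if_splits)

lemma stabiliser_reps_fix: "\<sigma> \<in> stabiliser_reps z \<Longrightarrow> mob \<sigma> z = z"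
proof -
  assume \<sigma>: "\<sigma> \<in> stabiliser_reps z"
  have r0: "rho \<noteq> 0" "rho + 1 \<noteq> 0" by (auto simp: rho_def complex_eq_iff)
  have "(- rho - 1) / rho = rho" "1 / (rho + 1) = - rho"
    using r0 by (simp_all add: divide_eq_eq distrib_left rho_squared)
  then have "mob (-1, -1, 1, 0) rho = rho" "mob (0, -1, 1, 1) rho = rho" by simp_all
  moreover have "mob (0, -1, 1, 0) \<i> = \<i>" by (simp add: field_simps)
  ultimately show ?thesis using \<sigma> by (auto simp: stabiliser_reps_def simp del: mob.simps split: if_splits)
qed

lemma stabiliser_reps_neg:
  "\<sigma> \<in> stabiliser_reps z \<Longrightarrow> \<sigma>' \<in> stabiliser_reps z \<Longrightarrow> \<sigma> = mneg \<sigma>' \<Longrightarrow> False"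
  by (auto simp: stabiliser_reps_def mid_def mneg_simp split: if_splits)

text \<open>From \<open>|z| >= 1\<close> and \<open>|Re z| <= 1/2\<close> the left side is at least
  \<open>r^2 - |r s| + s^2\<close>, a positive integer.\<close>

lemma norm_denominator_ge_1:
  assumes z: "z \<in> fund_domain" and rs: "(r, s) \<noteq> (0, 0)"
  shows "(cmod (of_int r * z + of_int s))\<^sup>2 \<ge> 1"
    and "(cmod (of_int r * z + of_int s))\<^sup>2 = (of_int r)\<^sup>2 * (cmod z)\<^sup>2 + 2 * of_int r * of_int s * Re z + (of_int s)\<^sup>2"
proof -
  show eq: "(cmod (of_int r * z + of_int s))\<^sup>2 = (of_int r)\<^sup>2 * (cmod z)\<^sup>2 + 2 * of_int r * of_int s * Re z + (of_int s)\<^sup>2"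
    unfolding cmod_power2 by (simp add: power2_eq_square algebra_simps)
  have z1: "(cmod z)\<^sup>2 \<ge> 1" using fund_domain_Im(4)[OF z] by (simp add: one_le_power)
  have "\<bar>2 * of_int r * of_int s * Re z\<bar> = 2 * \<bar>of_int (r * s)\<bar> * \<bar>Re z\<bar>" by (simp add: abs_mult)
  also have "\<dots> \<le> 2 * \<bar>of_int (r * s)\<bar> * (1 / 2)" using fund_domain_Im(3)[OF z] by (intro mult_left_mono) auto
  finally have x: "\<bar>2 * of_int r * of_int s * Re z\<bar> \<le> of_int \<bar>r * s\<bar>" by simp
  have "(of_int r)\<^sup>2 * 1 \<le> (of_int r)\<^sup>2 * (cmod z)\<^sup>2" using z1 by (intro mult_left_mono) auto
  then have "of_int (r\<^sup>2 - \<bar>r * s\<bar> + s\<^sup>2) \<le> (cmod (of_int r * z + of_int s))\<^sup>2"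
    unfolding eq using x by simp
  moreover have "1 \<le> r\<^sup>2 - \<bar>r * s\<bar> + s\<^sup>2"
  proof -
    have "0 \<le> (\<bar>r\<bar> - \<bar>s\<bar>)\<^sup>2" by simp
    then have "2 * \<bar>r * s\<bar> \<le> r\<^sup>2 + s\<^sup>2" by (simp add: power2_eq_square algebra_simps abs_mult)
    moreover have "r\<^sup>2 + s\<^sup>2 > 0" using rs by (simp add: sum_power2_gt_zero_iff)
    ultimately show ?thesis by linarith
  qed
  then have "(1::real) \<le> of_int (r\<^sup>2 - \<bar>r * s\<bar> + s\<^sup>2)" by (metis of_int_1 of_int_le_iff)
  ultimately show "(cmod (of_int r * z + of_int s))\<^sup>2 \<ge> 1" by linarith
qed

text \<open>Neither \<open>M\<close> nor its inverse can raise the height inside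
  \<open>fund_domain\<close>, so the denominator has modulus \<open>1\<close>, which leaves few
  bottom rows. The sign condition picks one of \<open>M\<close> and \<open>mneg M\<close>.\<close>

lemma fund_domain_orbit_pos:
  assumes z: "z \<in> fund_domain" and w: "mob (p, q, r, s) z \<in> fund_domain"
    and det: "p * s - q * r = 1" and r: "r > 0 \<or> r = 0 \<and> s > 0"
  shows "mob (p, q, r, s) z = z \<and> (p, q, r, s) \<in> stabiliser_reps z"
proof -
  define w where "w = mob (p, q, r, s) z"
  have w: "w \<in> fund_domain" using assms by (simp add: w_def)
  have rs: "(r, s) \<noteq> (0, 0)" using r by auto
  note z' = fund_domain_Im[OF z] and w' = fund_domain_Im[OF w]
  define N where "N = (cmod (of_int r * z + of_int s))\<^sup>2"
  have N1: "N \<ge> 1" and Neq: "N = (of_int r)\<^sup>2 * (cmod z)\<^sup>2 + 2 * of_int r * of_int s * Re z + (of_int s)\<^sup>2"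
    using norm_denominator_ge_1[OF z rs] by (simp_all only: N_def)
  have Imw: "Im w = Im z / N" using Im_mob[OF z'(2) rs, of p q] det by (simp add: w_def N_def del: mob.simps)
  have "mob (s, - q, - r, p) w = z"
    using mob_minv[OF z'(2), of "(p, q, r, s)"] det by (simp add: w_def del: mob.simps)
  moreover have rs': "(- r, p) \<noteq> (0, 0)" using det by auto
  ultimately have "Im z = Im w / (cmod (of_int (- r) * w + of_int p))\<^sup>2"
    using Im_mob[OF w'(2) rs', of s "- q"] det by (simp add: algebra_simps del: mob.simps)
  also have "\<dots> \<le> Im w / 1" using norm_denominator_ge_1(1)[OF w rs'] w'(2) by (intro frac_le) auto
  finally have "Im z \<le> Im z / N" using Imw by simp
  then have "N = 1" using N1 z'(2) by (simp add: field_simps mult_le_cancel_left1)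
  have z1: "(cmod z)\<^sup>2 \<ge> 1" using z'(4) by (simp add: one_le_power)
  show ?thesis
  proof (cases "r = 0")
    case True
    then have "p * s = 1" "s > 0" using det r by auto
    then have ps: "s = 1" "p = 1" by (auto simp: zmult_eq_1_iff)
    have "w = z + of_int q" using True ps by (simp add: w_def)
    moreover have "-1/2 \<le> Re z" "Re z < 1/2" "-1/2 \<le> Re w" "Re w < 1/2"
      using z w by (auto simp: fund_domain_def)
    ultimately have "of_int q < (1::real)" "of_int q > (-1::real)" by auto
    then have "q = 0" by simp
    then show ?thesis using True ps by (simp add: w_def stabiliser_reps_def mid_def)
  next
    case False
    then have r0: "r > 0" using r by simp
    \<comment> \<open>For \<open>r >= 2\<close> the imaginary part alone gives
      \<open>N >= (r Im z)^2 >= 3\<close>.\<close>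
    have r1: "r = 1"
    proof (rule ccontr)
      assume "r \<noteq> 1"
      then have "r \<ge> 2" using r0 by simp
      have "(of_int r * Im z)\<^sup>2 \<le> N" unfolding N_def cmod_power2 by simp
      moreover have "(2 * (sqrt 3 / 2))\<^sup>2 \<le> (of_int r * Im z)\<^sup>2"
        using \<open>r \<ge> 2\<close> z'(1) by (intro power_mono mult_mono) auto
      ultimately show False using \<open>N = 1\<close> by simp
    qed
    have e1: "(cmod z)\<^sup>2 + of_int s * (2 * Re z + of_int s) = 1"
      using \<open>N = 1\<close> unfolding Neq r1 by (simp add: power2_eq_square algebra_simps)
    have x: "-1/2 \<le> Re z" "Re z < 1/2" using z by (auto simp: fund_domain_def)
    \<comment> \<open>By \<open>e1\<close> the product \<open>s (2 Re z + s)\<close> cannot be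
      positive. The strict bound \<open>Re z < 1/2\<close> rules out \<open>s = -1\<close>, whereas
      \<open>Re z = -1/2\<close> leaves \<open>s = 1\<close> possible.\<close>
    have s_cases: "s = 0 \<or> s = 1"
    proof (rule ccontr)
      assume s: "\<not> (s = 0 \<or> s = 1)"
      have "of_int s * (2 * Re z + of_int s) > 0"
      proof (cases "s > 0")
        case True
        then have "s \<ge> 2" using s by simp
        then have "2 * Re z + of_int s > 0" using x by simp
        then show ?thesis using True by simp
      next
        case False
        then have "s \<le> -1" using s by simp
        then have "of_int s \<le> (-1 :: real)" by simp
        then have "2 * Re z + of_int s < 0" using x by linarith
        then show ?thesis using False s by (intro mult_neg_neg) auto
      qed
      then show False using e1 z1 by simp
    qed
    have zn0: "z \<noteq> 0" using z' by auto
    from s_cases show ?thesis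
    proof
      assume s: "s = 0"
      then have "(cmod z)\<^sup>2 = 1" using e1 by simp
      then have c1: "cmod z = 1" by (simp add: power2_eq_1_iff) (use norm_ge_zero[of z] in linarith)
      have q: "q = -1" using det s r1 by simp
      have x0: "Re z \<le> 0" using z c1 by (auto simp: fund_domain_def)
      have "z * cnj z = 1" using c1 complex_norm_square[of z] by simp
      then have "w = of_int p - cnj z"
        using zn0 by (simp add: w_def r1 s q field_simps)
      then have Rew: "Re w = of_int p - Re z" and Imw: "Im w = Im z" by simp_all
      have xw: "-1/2 \<le> Re w" "Re w < 1/2" using w by (auto simp: fund_domain_def)
      have "of_int p < (1::real)" "of_int p > (-2::real)" using Rew xw x x0 by linarith+
      then have "p = 0 \<or> p = -1" by auto
      then show ?thesis
      proof
        \<comment> \<open>Both \<open>z\<close> and \<open>- cnj z\<close> lie on the unit circle,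
          where \<open>fund_domain\<close> admits only nonpositive real parts, so
          \<open>Re z = 0\<close>.\<close>
        assume p: "p = 0"
        then have "w = - cnj z" using \<open>w = of_int p - cnj z\<close> by simp
        then have "cmod w = 1" using c1 by simp
        then have "Re w \<le> 0" using w by (auto simp: fund_domain_def)
        then have "Re z = 0" using Rew p x0 by simp
        then have "Im z = 1" using c1 z'(2) by (simp add: cmod_def)
        then have zi: "z = \<i>" using \<open>Re z = 0\<close> by (simp add: complex_eq_iff)
        have "(p, q, r, s) \<in> stabiliser_reps z" by (simp add: zi stabiliser_reps_def p q r1 s)
        then show ?thesis using stabiliser_reps_fix by blast
      next
        assume p: "p = -1"
        then have "Re z = - 1 / 2" using Rew xw x by simp
        then have zr: "z = rho" using c1 z'(2) by (intro rhoI)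
        have "(p, q, r, s) \<in> stabiliser_reps z" using rho_neq_i by (simp add: zr stabiliser_reps_def p q r1 s)
        then show ?thesis using stabiliser_reps_fix by blast
      qed
    next
      assume s: "s = 1"
      have xr: "Re z = - 1 / 2" and c2: "(cmod z)\<^sup>2 = 1" using e1 z1 x by (auto simp: s)
      have c1: "cmod z = 1" using c2 by (simp add: power2_eq_1_iff) (use norm_ge_zero[of z] in linarith)
      have zr: "z = rho" using c1 xr z'(2) by (intro rhoI)
      have q: "q = p - 1" using det s r1 by simp
      have d: "rho + 1 \<noteq> 0" by (simp add: rho_def complex_eq_iff)
      have "w = rho + of_int p"
      proof -
        have "of_int p * rho + of_int (p - 1) = (rho + of_int p) * (rho + 1)"
          by (simp add: distrib_left distrib_right rho_squared)
        then show ?thesis using d by (simp add: w_def zr r1 s q)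
      qed
      then have "Re w = of_int p - 1 / 2" by (simp add: rho_Re_Im)
      moreover have "-1/2 \<le> Re w" "Re w < 1/2" using w by (auto simp: fund_domain_def)
      ultimately have "of_int p < (1::real)" "of_int p \<ge> (0::real)" by linarith+
      then have p: "p = 0" by simp
      have "(p, q, r, s) \<in> stabiliser_reps z" using rho_neq_i by (simp add: zr stabiliser_reps_def p q r1 s)
      then show ?thesis using stabiliser_reps_fix by blast
    qed
  qed
qed

theorem fund_domain_orbit:
  assumes z: "z \<in> fund_domain" and w: "mob M z \<in> fund_domain" and det: "mdet M = 1"
  shows "mob M z = z \<and> (\<exists>\<sigma>\<in>stabiliser_reps z. M = \<sigma> \<or> M = mneg \<sigma>)"
proof -
  obtain p q r s where M: "M = (p, q, r, s)" by (metis surj_pair)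
  show ?thesis
  proof (cases "r > 0 \<or> r = 0 \<and> s > 0")
    case True
    then show ?thesis using fund_domain_orbit_pos[of z p q r s] assms M by auto
  next
    case False
    have "r \<noteq> 0 \<or> s \<noteq> 0" using det M by auto
    then have "- r > 0 \<or> - r = 0 \<and> - s > 0" using False by auto
    moreover have "mob (- p, - q, - r, - s) z = mob M z" using mob_mneg[of M z] M by (simp add: mneg_simp)
    moreover have "(- p) * (- s) - (- q) * (- r) = 1" using det M by simp
    ultimately have "mob M z = z \<and> (- p, - q, - r, - s) \<in> stabiliser_reps z"
      using fund_domain_orbit_pos[of z "- p" "- q" "- r" "- s"] assms by simp
    then show ?thesis using M by (intro conjI bexI[of _ "(- p, - q, - r, - s)"]) (auto simp: mneg_simp)
  qed
qed

lemma card_stabiliser_reps: "card (stabiliser_reps z) = (if z = \<i> then 2 else if z = rho then 3 else 1)"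
  by (simp add: stabiliser_reps_def mid_def)

text \<open>The cosets in question are those of \<open>\<gamma> \<sigma>\<close> with
  \<open>\<sigma>\<close> in the stabiliser of \<open>z\<close>. This counts how often one point of
  the strip is hit.\<close>

lemma card_cusp_reps_fibre:
  assumes z: "z \<in> fund_domain" and g0: "mdet \<gamma> = 1"
  shows "card {g \<in> cusp_reps. \<exists>k. mob g z + of_int k = mob \<gamma> z} = card (stabiliser_reps z)"
proof -
  have Im: "Im z > 0" by (rule fund_domain_Im(2)[OF z])
  let ?G = "{g \<in> cusp_reps. \<exists>k. mob g z + of_int k = mob \<gamma> z}"
  have "\<exists>g. \<sigma> \<in> stabiliser_reps z \<longrightarrow> g \<in> cusp_reps \<and> cusp_equiv (mmul \<gamma> \<sigma>) g" for \<sigma>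
    using cusp_reps_exists[of "mmul \<gamma> \<sigma>"] g0 stabiliser_reps_mdet[of \<sigma> z] by (metis mdet_mmul mult_1)
  then obtain f where f: "\<And>\<sigma>. \<sigma> \<in> stabiliser_reps z \<Longrightarrow> f \<sigma> \<in> cusp_reps"
    "\<And>\<sigma>. \<sigma> \<in> stabiliser_reps z \<Longrightarrow> cusp_equiv (mmul \<gamma> \<sigma>) (f \<sigma>)" by metis
  have fix\<gamma>: "mob (mmul \<gamma> \<sigma>) z = mob \<gamma> z" if "\<sigma> \<in> stabiliser_reps z" for \<sigma>
    using mob_mmul[OF Im, of \<sigma> \<gamma>] stabiliser_reps_mdet[OF that] stabiliser_reps_fix[OF that] by simp
  have "bij_betw f (stabiliser_reps z) ?G"
  proof (rule bij_betwI')
    fix \<sigma> \<tau> assume st: "\<sigma> \<in> stabiliser_reps z" "\<tau> \<in> stabiliser_reps z"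
    show "f \<sigma> = f \<tau> \<longleftrightarrow> \<sigma> = \<tau>"
    proof
      assume "f \<sigma> = f \<tau>"
      then have "cusp_equiv (mmul \<gamma> \<sigma>) (mmul \<gamma> \<tau>)"
        using f(2)[OF st(1)] f(2)[OF st(2)] cusp_equiv_trans cusp_equiv_sym by metis
      then obtain k where k: "mmul \<gamma> \<sigma> = mmul (mshift k) (mmul \<gamma> \<tau>) \<or> mmul \<gamma> \<sigma> = mneg (mmul (mshift k) (mmul \<gamma> \<tau>))"
        unfolding cusp_equiv_def by blast
      have d: "mdet (mmul \<gamma> \<tau>) = 1" using g0 stabiliser_reps_mdet[OF st(2)] by (simp add: mdet_mmul)
      have "mob (mmul \<gamma> \<sigma>) z = mob (mmul \<gamma> \<tau>) z + of_int k"
        using k mob_mmul[OF Im, of "mmul \<gamma> \<tau>" "mshift k"] d by auto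
      \<comment> \<open>Both products send \<open>z\<close> to the same point, so the shift between
        them is trivial and only a sign remains.\<close>
      then have "k = 0" using fix\<gamma>[OF st(1)] fix\<gamma>[OF st(2)] by simp
      then have "mmul \<gamma> \<sigma> = mmul \<gamma> \<tau> \<or> mmul \<gamma> \<sigma> = mmul \<gamma> (mneg \<tau>)"
        using k by (simp add: mmul_mneg)
      then have "mmul (minv \<gamma>) (mmul \<gamma> \<sigma>) = mmul (minv \<gamma>) (mmul \<gamma> \<tau>) \<or>
          mmul (minv \<gamma>) (mmul \<gamma> \<sigma>) = mmul (minv \<gamma>) (mmul \<gamma> (mneg \<tau>))" by auto
      then have "\<sigma> = \<tau> \<or> \<sigma> = mneg \<tau>"
        using g0 by (simp only: mmul_assoc[symmetric] mmul_minv mmul_mid)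
      then show "\<sigma> = \<tau>" using stabiliser_reps_neg[OF st] by blast
    qed simp
  next
    fix \<sigma> assume \<sigma>: "\<sigma> \<in> stabiliser_reps z"
    obtain k where "mob (mmul \<gamma> \<sigma>) z = mob (f \<sigma>) z + of_int k"
      using cusp_equiv_mob[OF f(2)[OF \<sigma>] Im] cusp_reps_mdet[OF f(1)[OF \<sigma>]] by auto
    then show "f \<sigma> \<in> ?G" using fix\<gamma>[OF \<sigma>] f(1)[OF \<sigma>] by (simp del: mob.simps)
  next
    fix g assume "g \<in> ?G"
    then obtain k where g: "g \<in> cusp_reps" "mob g z + of_int k = mob \<gamma> z" by blast
    have dg: "mdet g = 1" by (rule cusp_reps_mdet[OF g(1)])
    define T where "T = mmul (mshift k) g"
    have dT: "mdet T = 1" by (simp add: T_def mdet_mmul dg)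
    have Tz: "mob T z = mob \<gamma> z" using mob_mmul[OF Im, of g "mshift k"] dg g(2) by (simp add: T_def)
    have "mob (mmul (minv \<gamma>) T) z = z"
      using mob_mmul[OF Im, of T "minv \<gamma>"] dT Tz mob_minv[OF Im g0] by simp
    moreover have "mdet (mmul (minv \<gamma>) T) = 1" using g0 dT by (simp add: mdet_mmul)
    ultimately obtain \<sigma> where \<sigma>: "\<sigma> \<in> stabiliser_reps z" "mmul (minv \<gamma>) T = \<sigma> \<or> mmul (minv \<gamma>) T = mneg \<sigma>"
      using fund_domain_orbit[OF z, of "mmul (minv \<gamma>) T"] z by auto
    have "T = mmul \<gamma> (mmul (minv \<gamma>) T)" using g0 by (simp only: mmul_assoc[symmetric] mmul_minv mmul_mid)
    then have "T = mmul \<gamma> \<sigma> \<or> T = mneg (mmul \<gamma> \<sigma>)" using \<sigma>(2) by (metis mmul_mneg)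
    then have "cusp_equiv T (mmul \<gamma> \<sigma>)" unfolding cusp_equiv_def by (intro exI[of _ 0]) simp
    moreover have "cusp_equiv T g" unfolding cusp_equiv_def T_def by blast
    ultimately have "cusp_equiv g (f \<sigma>)"
      using f(2)[OF \<sigma>(1)] cusp_equiv_trans cusp_equiv_sym by metis
    then have "g = f \<sigma>" using cusp_reps_unique[OF g(1) f(1)[OF \<sigma>(1)]] by simp
    then show "\<exists>\<sigma>\<in>stabiliser_reps z. g = f \<sigma>" using \<sigma>(1) by blast
  qed
  then show ?thesis by (simp add: bij_betw_same_card)
qed

subsection \<open>Reduced forms\<close>

definition reduced_forms :: "int \<Rightarrow> bqf set" where
  "reduced_forms D = {Q. Q \<in> bqfs D \<and> bqf_root Q \<in> fund_domain}"

lemma equiv_reduced: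
  assumes D: "D < 0" and Q: "Q \<in> reduced_forms D" and Q': "Q' \<in> reduced_forms D" and M: "Q' = bqf_act M Q" "mdet M = 1"
  shows "Q = Q'"
proof -
  have q: "Q \<in> bqfs D" "Q' \<in> bqfs D" "bqf_root Q \<in> fund_domain" "bqf_root Q' \<in> fund_domain"
    using Q Q' by (auto simp: reduced_forms_def)
  have "bqf_root Q' = mob M (bqf_root Q)" unfolding M(1) by (rule bqf_root_act[OF D q(1) M(2)])
  then have "bqf_root Q' = bqf_root Q" using fund_domain_orbit[OF q(3), of M] q(4) M(2) by simp
  then show ?thesis using bqf_root_inj[OF D q(1,2)] by simp
qed

lemma reduced_exists:
  assumes D: "D < 0" and Q: "Q \<in> bqfs D"
  obtains M where "mdet M = 1" "bqf_act M Q \<in> reduced_forms D"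
proof -
  obtain M where M: "mdet M = 1" "mob M (bqf_root Q) \<in> fund_domain"
    using reduction_to_fund_domain[OF bqf_root_Im_pos[OF D Q]] .
  then have "bqf_act M Q \<in> reduced_forms D"
    using bqf_act_in_bqfs[OF M(1) Q] bqf_root_act[OF D Q M(1)] by (simp add: reduced_forms_def)
  then show ?thesis using that M by blast
qed

lemma bqf_weight_reduced:
  assumes D: "D < 0" and Q: "Q \<in> reduced_forms D"
  shows "bqf_weight Q = card (stabiliser_reps (bqf_root Q))"
proof -
  have QD: "Q \<in> bqfs D" using Q by (simp add: reduced_forms_def)
  \<comment> \<open>Handles \<open>[a, 0, a]\<close> and \<open>[a, a, a]\<close> at once, with
    \<open>t = 0\<close> and \<open>t = 1\<close>: such a form is itself reduced, hence equals the
    reduced \<open>Q\<close> equivalent to it.\<close>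
  have special: "(\<exists>a. bqf_equiv Q (a, t * a, a)) \<longleftrightarrow> bqf_root Q = z0"
    if z0: "z0 \<in> fund_domain" and root: "\<And>a. a > 0 \<Longrightarrow> (a, t * a, a) \<in> bqfs D \<Longrightarrow> bqf_root (a, t * a, a) = z0"
      and form: "\<And>a b c. (a, b, c) \<in> bqfs D \<Longrightarrow> bqf_root (a, b, c) = z0 \<Longrightarrow> b = t * a \<and> c = a" for t z0
  proof
    assume "\<exists>a. bqf_equiv Q (a, t * a, a)"
    then obtain a M where M: "mdet M = 1" "(a, t * a, a) = bqf_act M Q" unfolding bqf_equiv_iff_act by blast
    have A: "(a, t * a, a) \<in> bqfs D" using bqf_act_in_bqfs[OF M(1) QD] M(2) by simp
    then have "bqf_root (a, t * a, a) = z0" using root bqfs_leading_pos by blast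
    then show "bqf_root Q = z0"
      using equiv_reduced[OF D Q _ M(2,1)] A z0 by (simp add: reduced_forms_def)
  next
    assume r: "bqf_root Q = z0"
    obtain a b c where Q': "Q = (a, b, c)" by (metis surj_pair)
    have "Q = (a, t * a, a)" using form[of a b c] QD r by (simp add: Q')
    then have "bqf_equiv Q (a, t * a, a)" unfolding bqf_equiv_iff_act
      by (intro exI[of _ mid]) (metis bqf_act_mid mdet_mid)
    then show "\<exists>a. bqf_equiv Q (a, t * a, a)" by blast
  qed
  have i: "(\<exists>a. bqf_equiv Q (a, 0 * a, a)) \<longleftrightarrow> bqf_root Q = \<i>"
  proof (rule special[OF i_in_fund_domain])
    fix a assume a: "a > 0" "(a, 0 * a, a) \<in> bqfs D"
    show "bqf_root (a, 0 * a, a) = \<i>"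
      by (rule bqf_root_unique[OF D a(2)]) simp_all
  next
    fix a b c assume A: "(a, b, c) \<in> bqfs D" "bqf_root (a, b, c) = \<i>"
    have "of_int a * \<i>\<^sup>2 + of_int b * \<i> + of_int c = 0" using bqf_root_equation[OF D A(1)] A(2) by simp
    then show "b = 0 * a \<and> c = a" by (simp add: complex_eq_iff)
  qed
  have r: "(\<exists>a. bqf_equiv Q (a, 1 * a, a)) \<longleftrightarrow> bqf_root Q = rho"
  proof (rule special[OF rho_in_fund_domain])
    fix a assume a: "a > 0" "(a, 1 * a, a) \<in> bqfs D"
    have "of_int a * rho\<^sup>2 + of_int (1 * a) * rho + of_int a = of_int a * (rho * rho + rho + 1)"
      by (simp add: power2_eq_square algebra_simps)
    also have "\<dots> = 0" by (simp add: rho_squared)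
    finally show "bqf_root (a, 1 * a, a) = rho"
      by (intro bqf_root_unique[OF D a(2)]) (simp_all add: rho_Re_Im)
  next
    fix a b c assume A: "(a, b, c) \<in> bqfs D" "bqf_root (a, b, c) = rho"
    have "of_int a * rho\<^sup>2 + of_int b * rho + of_int c = 0" using bqf_root_equation[OF D A(1)] A(2) by simp
    then have e: "of_int a * (- rho - 1) + of_int b * rho + of_int c = 0"
      by (simp only: power2_eq_square rho_squared)
    from arg_cong[OF e, of Im] have "sqrt 3 * (real_of_int b - real_of_int a) = 0"
      by (simp add: rho_Re_Im algebra_simps)
    then have ba: "b = a" by simp
    from arg_cong[OF e, of Re] have "c = a" unfolding ba by (simp add: rho_Re_Im algebra_simps)
    with ba show "b = 1 * a \<and> c = a" by simp
  qed
  show ?thesis unfolding bqf_weight_def card_stabiliser_reps using i r by simp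
qed

text \<open>Reducedness gives \<open>|b| <= a <= sqrt (|D| / 3)\<close>, and \<open>c\<close> is
  determined by \<open>a\<close>, \<open>b\<close> and \<open>D\<close>. The count is
  \<open>A (2 A + 1) <= 3 A^2 <= |D|\<close>.\<close>

lemma card_reduced_forms:
  assumes D: "D < 0"
  shows "finite (reduced_forms D)" "real (card (reduced_forms D)) \<le> \<bar>of_int D\<bar>"
proof -
  define A where "A = \<lfloor>sqrt (\<bar>of_int D\<bar> / 3)\<rfloor>"
  have A0: "A \<ge> 0" by (simp add: A_def)
  have "of_int A \<le> sqrt (\<bar>of_int D\<bar> / 3)" by (simp add: A_def)
  then have "(of_int A)\<^sup>2 \<le> (sqrt (\<bar>real_of_int D\<bar> / 3))\<^sup>2" using A0 by (intro power_mono) auto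
  then have A2: "3 * (of_int A)\<^sup>2 \<le> \<bar>real_of_int D\<bar>" by simp
  define f where "f = (\<lambda>(a::int, b::int, c::int). (a, b))"
  have sub: "f ` reduced_forms D \<subseteq> {1..A} \<times> {- A..A}"
  proof (rule image_subsetI)
    fix Q assume Q: "Q \<in> reduced_forms D"
    obtain a b c where Q': "Q = (a, b, c)" by (metis surj_pair)
    have QD: "(a, b, c) \<in> bqfs D" and z: "bqf_root (a, b, c) \<in> fund_domain" using Q by (auto simp: reduced_forms_def Q')
    have a: "a > 0" by (rule bqfs_leading_pos[OF QD])
    have "\<bar>Re (bqf_root (a, b, c))\<bar> \<le> 1 / 2" by (rule fund_domain_Im(3)[OF z])
    then have b: "\<bar>b\<bar> \<le> a" using a unfolding bqf_root_Im_Re(1)[OF QD] by (simp add: field_simps)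
    have "sqrt 3 / 2 \<le> Im (bqf_root (a, b, c))" by (rule fund_domain_Im(1)[OF z])
    then have "sqrt 3 * of_int a \<le> sqrt \<bar>of_int D\<bar>" using a unfolding bqf_root_Im_Re(2)[OF QD] by (simp add: field_simps)
    then have "of_int a \<le> sqrt (\<bar>of_int D\<bar> / 3)" by (simp add: real_sqrt_divide field_simps)
    then have "a \<le> A" by (simp add: A_def le_floor_iff)
    then show "f Q \<in> {1..A} \<times> {- A..A}" using a b by (auto simp: f_def Q')
  qed
  have inj: "inj_on f (reduced_forms D)"
  proof (rule inj_onI)
    fix Q Q' assume Q: "Q \<in> reduced_forms D" "Q' \<in> reduced_forms D" "f Q = f Q'"
    obtain a b c a' b' c' where q: "Q = (a, b, c)" "Q' = (a', b', c')" by (metis surj_pair)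
    have "a > 0" using Q(1) bqfs_leading_pos[of a b c D] by (simp add: reduced_forms_def q)
    moreover have "b\<^sup>2 - 4 * a * c = D" "b\<^sup>2 - 4 * a * c' = D"
      using Q by (auto simp: reduced_forms_def q bqfs_def f_def)
    ultimately have "c = c'" by auto
    then show "Q = Q'" using Q(3) by (simp add: q f_def)
  qed
  show "finite (reduced_forms D)" using finite_imageD[OF finite_subset[OF sub] inj] by simp
  have "card (reduced_forms D) = card (f ` reduced_forms D)" using inj by (simp add: card_image)
  also have "\<dots> \<le> card ({1..A} \<times> {- A..A})" by (rule card_mono[OF _ sub]) simp
  also have "\<dots> = nat A * nat (2 * A + 1)" by (simp add: card_cartesian_product algebra_simps)
  finally have "int (card (reduced_forms D)) \<le> A * (2 * A + 1)" using A0
    by (simp flip: of_nat_le_iff [where 'a = int])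
  also have "\<dots> \<le> 3 * A\<^sup>2"
  proof (cases "A = 0")
    case False
    then have "A * 1 \<le> A * A" using A0 by (intro mult_left_mono) auto
    then show ?thesis by (simp add: power2_eq_square algebra_simps)
  qed simp
  finally have "real_of_int (int (card (reduced_forms D))) \<le> real_of_int (3 * A\<^sup>2)" by (rule of_int_le_iff[THEN iffD2])
  then show "real (card (reduced_forms D)) \<le> \<bar>of_int D\<bar>" using A2 by simp
qed

text \<open>Every class contains a reduced form and no class has a weight above
  \<open>1\<close>.\<close>

lemma class_number_le:
  assumes D: "D < 0" shows "class_number D \<le> real (card (reduced_forms D))" "class_number D \<ge> 0"
proof -
  let ?r = "{(Q, Q'). Q \<in> bqfs D \<and> Q' \<in> bqfs D \<and> bqf_equiv Q Q'}"
  have sub: "bqf_classes D \<subseteq> (\<lambda>Q. ?r `` {Q}) ` reduced_forms D"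
  proof
    fix K assume "K \<in> bqf_classes D"
    then obtain Q where Q: "Q \<in> bqfs D" "K = ?r `` {Q}" unfolding bqf_classes_def by (rule quotientE)
    obtain M where M: "mdet M = 1" "bqf_act M Q \<in> reduced_forms D" using reduced_exists[OF D Q(1)] .
    have e: "bqf_equiv Q (bqf_act M Q)" unfolding bqf_equiv_iff_act using M(1) by blast
    have "bqf_act M Q \<in> bqfs D" using M(2) by (simp add: reduced_forms_def)
    then have "?r `` {Q} = ?r `` {bqf_act M Q}"
      using e Q(1) bqf_equiv_trans bqf_equiv_sym by blast
    then show "K \<in> (\<lambda>Q. ?r `` {Q}) ` reduced_forms D" using M(2) Q(2) by blast
  qed
  have fin: "finite (reduced_forms D)" by (rule card_reduced_forms[OF D])
  have w: "1 / real (bqf_weight Q) \<le> 1" for Q by (simp add: bqf_weight_def)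
  have "class_number D \<le> (\<Sum>K\<in>bqf_classes D. 1)" unfolding class_number_def by (rule sum_mono[OF w])
  also have "\<dots> = real (card (bqf_classes D))" by simp
  also have "card (bqf_classes D) \<le> card ((\<lambda>Q. ?r `` {Q}) ` reduced_forms D)"
    by (rule card_mono[OF finite_imageI[OF fin] sub])
  also have "\<dots> \<le> card (reduced_forms D)" by (rule card_image_le[OF fin])
  finally show "class_number D \<le> real (card (reduced_forms D))" by simp
  show "class_number D \<ge> 0" unfolding class_number_def by (intro sum_nonneg) simp
qed

subsection \<open>The trace and the sum over the strip\<close>

lemma e_shift: "e (- of_nat m * (w + of_int k)) = e (- of_nat m * w)"
proof -
  have "- of_nat m * (w + of_int k) = - of_nat m * w + of_int (- int m * k)" by (simp add: algebra_simps)
  then show ?thesis by (simp only: e_add e_of_int mult_1_right)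
qed

text \<open>A pair of a reduced \<open>Q\<close> and a representative \<open>g\<close> gives the
  form \<open>g Q\<close>, shifted into the strip. Each form of the strip arises from one
  \<open>Q\<close> and exactly \<open>bqf_weight Q\<close> many \<open>g\<close>, which cancels the
  weight.\<close>

lemma strip_sum:
  assumes D: "D < 0" and m: "m \<ge> 1"
  shows "(\<Sum>Q | Q \<in> bqfs D \<and> bqf_root Q \<in> strip_above (1 / real m).
            of_int (genus_character d Q) * e (- of_nat m * bqf_root Q)) =
         (\<Sum>Q\<in>reduced_forms D. of_int (genus_character d Q) / of_nat (bqf_weight Q) *
            (\<Sum>g | g \<in> cusp_reps \<and> Im (mob g (bqf_root Q)) > 1 / real m. e (- of_nat m * mob g (bqf_root Q))))"
    (is "sum ?f ?S = _")
proof -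
  let ?R = "reduced_forms D"
  have RD: "Q \<in> bqfs D" "bqf_root Q \<in> fund_domain" "Im (bqf_root Q) > 0" if "Q \<in> ?R" for Q
    using that fund_domain_Im(2) by (auto simp: reduced_forms_def)
  have finR: "finite ?R" by (rule card_reduced_forms[OF D])
  define G where "G Q = {g. g \<in> cusp_reps \<and> Im (mob g (bqf_root Q)) > 1 / real m}" for Q
  have finG: "finite (G Q)" if "Q \<in> ?R" for Q
    unfolding G_def by (rule finite_cusp_reps_high[OF RD(3)[OF that]]) (use m in simp)
  define P where "P = Sigma ?R G"
  have finP: "finite P" unfolding P_def using finR finG by (intro finite_SigmaI)
  \<comment> \<open>The integer that moves \<open>Re w\<close> into \<open>[-1/2, 1/2)\<close>; the
    shift keeps the height and with it the cutoff \<open>1 / m\<close>.\<close>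
  define k where "k w = - \<lfloor>Re w + 1 / 2\<rfloor>" for w :: complex
  have k: "-1/2 \<le> Re (w + of_int (k w))" "Re (w + of_int (k w)) < 1/2" for w
    unfolding k_def by (simp, linarith)+
  define N where "N = (\<lambda>(Q, g). mmul (mshift (k (mob g (bqf_root Q)))) g)"
  define \<Phi> where "\<Phi> = (\<lambda>x. bqf_act (N x) (fst x))"
  define h where "h = (\<lambda>(Q, g). complex_of_int (genus_character d Q) / of_nat (bqf_weight Q) * e (- of_nat m * mob g (bqf_root Q)))"
  have x: "mdet (N (Q, g)) = 1" "\<Phi> (Q, g) \<in> bqfs D"
    "bqf_root (\<Phi> (Q, g)) = mob g (bqf_root Q) + of_int (k (mob g (bqf_root Q)))"
    if "Q \<in> ?R" "g \<in> cusp_reps" for Q g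
  proof -
    have dg: "mdet g = 1" by (rule cusp_reps_mdet[OF that(2)])
    show dN: "mdet (N (Q, g)) = 1" by (simp add: N_def mdet_mmul dg)
    show "\<Phi> (Q, g) \<in> bqfs D" unfolding \<Phi>_def using bqf_act_in_bqfs[OF dN] RD[OF that(1)] by simp
    have "bqf_root (\<Phi> (Q, g)) = mob (N (Q, g)) (bqf_root Q)"
      unfolding \<Phi>_def using bqf_root_act[OF D _ dN] RD[OF that(1)] by simp
    then show "bqf_root (\<Phi> (Q, g)) = mob g (bqf_root Q) + of_int (k (mob g (bqf_root Q)))"
      unfolding N_def using mob_mmul[OF RD(3)[OF that(1)], of g] dg by simp
  qed
  have \<Phi>S: "\<Phi> y \<in> ?S" if yP: "y \<in> P" for y
  proof -
    obtain Q g where y: "y = (Q, g)" "Q \<in> ?R" "g \<in> cusp_reps" "Im (mob g (bqf_root Q)) > 1 / real m"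
      using yP unfolding P_def G_def by blast
    have "bqf_root (\<Phi> y) \<in> strip_above (1 / real m)"
      unfolding strip_above_def y(1) x(3)[OF y(2,3)] mem_Collect_eq
      using k y(4) m by (auto intro: order.strict_trans[of 0 "1 / real m"])
    then show ?thesis using x(2)[OF y(2,3)] y(1) by simp
  qed
  \<comment> \<open>\<open>Q0\<close> is the unique reduced form equivalent to \<open>Q\<close>, so
    the fibre is counted by \<open>card_cusp_reps_fibre\<close> at the root of
    \<open>Q0\<close>.\<close>
  have fibre: "\<exists>Q0\<in>?R. {y \<in> P. \<Phi> y = Q} = {Q0} \<times> {g \<in> cusp_reps. \<exists>k. mob g (bqf_root Q0) + of_int k = bqf_root Q} \<and>
      genus_character d Q0 = genus_character d Q \<and>
      card {g \<in> cusp_reps. \<exists>k. mob g (bqf_root Q0) + of_int k = bqf_root Q} = bqf_weight Q0" if Q: "Q \<in> ?S" for Q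
  proof -
    have QD: "Q \<in> bqfs D" and Qs: "bqf_root Q \<in> strip_above (1 / real m)" using Q by auto
    obtain M where M: "mdet M = 1" "bqf_act M Q \<in> ?R" using reduced_exists[OF D QD] .
    define Q0 where "Q0 = bqf_act M Q"
    have Q0: "Q0 \<in> ?R" using M by (simp add: Q0_def)
    have Qact: "Q = bqf_act (minv M) Q0" unfolding Q0_def by (rule bqf_act_minv[OF M(1), symmetric])
    have rQ: "bqf_root Q = mob (minv M) (bqf_root Q0)"
      unfolding Qact by (rule bqf_root_act[OF D RD(1)[OF Q0]]) (simp add: M)
    have "{y \<in> P. \<Phi> y = Q} = {Q0} \<times> {g \<in> cusp_reps. \<exists>k. mob g (bqf_root Q0) + of_int k = bqf_root Q}"
    proof (intro equalityI subsetI)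
      fix y assume y: "y \<in> {y \<in> P. \<Phi> y = Q}"
      then obtain Q1 g where y': "y = (Q1, g)" "Q1 \<in> ?R" "g \<in> cusp_reps" unfolding P_def G_def by blast
      have \<Phi>y: "\<Phi> (Q1, g) = Q" using y y' by simp
      have "Q0 = bqf_act (mmul M (N (Q1, g))) Q1"
        unfolding Q0_def \<Phi>y[symmetric] \<Phi>_def by (simp add: bqf_act_mmul)
      moreover have "mdet (mmul M (N (Q1, g))) = 1" using M x(1)[OF y'(2,3)] by (simp add: mdet_mmul)
      ultimately have "Q1 = Q0" using equiv_reduced[OF D y'(2) Q0] by blast
      moreover have "bqf_root Q = mob g (bqf_root Q1) + of_int (k (mob g (bqf_root Q1)))"
        using x(3)[OF y'(2,3)] \<Phi>y by simp
      ultimately show "y \<in> {Q0} \<times> {g \<in> cusp_reps. \<exists>k. mob g (bqf_root Q0) + of_int k = bqf_root Q}"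
        using y' by (simp add: y'(1))
    next
      fix y assume "y \<in> {Q0} \<times> {g \<in> cusp_reps. \<exists>k. mob g (bqf_root Q0) + of_int k = bqf_root Q}"
      then obtain g i where y: "y = (Q0, g)" "g \<in> cusp_reps" "mob g (bqf_root Q0) + of_int i = bqf_root Q" by blast
      have "Im (mob g (bqf_root Q0)) = Im (bqf_root Q)" using arg_cong[OF y(3), of Im] by simp
      then have "g \<in> G Q0" using y(2) Qs by (simp add: G_def strip_above_def)
      then have yP: "y \<in> P" using Q0 y(1) by (simp add: P_def)
      let ?w = "mob g (bqf_root Q0)"
      have "Re (bqf_root Q) = Re ?w + of_int i" using arg_cong[OF y(3), of Re] by simp
      moreover have "Re (?w + of_int (k ?w)) = Re ?w + of_int (k ?w)" by simp
      moreover have "-1/2 \<le> Re (bqf_root Q)" "Re (bqf_root Q) < 1/2" using Qs by (auto simp: strip_above_def)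
      ultimately have "\<bar>real_of_int i - real_of_int (k ?w)\<bar> < 1" using k[of ?w] by linarith
      then have "i = k ?w" by linarith
      then have "bqf_root (\<Phi> (Q0, g)) = bqf_root Q" using x(3)[OF Q0 y(2)] y(3) by simp
      then have "\<Phi> (Q0, g) = Q" using bqf_root_inj[OF D x(2)[OF Q0 y(2)] QD] by simp
      then show "y \<in> {y \<in> P. \<Phi> y = Q}" using yP y(1) by simp
    qed
    moreover have "genus_character d Q0 = genus_character d Q"
      unfolding Q0_def by (rule genus_character_act[OF M(1)])
    moreover have "card {g \<in> cusp_reps. \<exists>k. mob g (bqf_root Q0) + of_int k = bqf_root Q} = bqf_weight Q0"
      unfolding rQ bqf_weight_reduced[OF D Q0]
      by (rule card_cusp_reps_fibre[OF RD(2)[OF Q0]]) (simp add: M)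
    ultimately show ?thesis using Q0 by blast
  qed
  have w0: "bqf_weight Q > 0" for Q by (simp add: bqf_weight_def)
  have "?S \<subseteq> \<Phi> ` P"
  proof
    fix Q assume Q: "Q \<in> ?S"
    from fibre[OF Q] obtain Q0 where Q0: "{y \<in> P. \<Phi> y = Q} = {Q0} \<times> {g \<in> cusp_reps. \<exists>k. mob g (bqf_root Q0) + of_int k = bqf_root Q}"
      "card {g \<in> cusp_reps. \<exists>k. mob g (bqf_root Q0) + of_int k = bqf_root Q} = bqf_weight Q0" by blast
    have "{g \<in> cusp_reps. \<exists>k. mob g (bqf_root Q0) + of_int k = bqf_root Q} \<noteq> {}"
      using Q0(2) w0[of Q0] by (metis card.empty less_irrefl)
    then have "{y \<in> P. \<Phi> y = Q} \<noteq> {}" unfolding Q0(1) by blast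
    then show "Q \<in> \<Phi> ` P" by blast
  qed
  \<comment> \<open>Finiteness of the strip set matters, since a sum over an infinite set would be
    \<open>0\<close>; it is the image of a finite set of pairs.\<close>
  then have finS: "finite ?S" using finP finite_surj by blast
  have "(\<Sum>Q\<in>?R. of_int (genus_character d Q) / of_nat (bqf_weight Q) * (\<Sum>g\<in>G Q. e (- of_nat m * mob g (bqf_root Q)))) =
        (\<Sum>Q\<in>?R. \<Sum>g\<in>G Q. h (Q, g))"
    by (simp only: sum_distrib_left h_def split)
  also have "\<dots> = sum h P"
    unfolding P_def using sum.Sigma[OF finR, of G "\<lambda>Q g. h (Q, g)"] finG by (simp add: case_prod_unfold)
  also have "\<dots> = (\<Sum>Q\<in>?S. \<Sum>y | y \<in> P \<and> \<Phi> y = Q. h y)"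
    by (rule sum.group[OF finP finS, symmetric]) (use \<Phi>S in blast)
  also have "\<dots> = sum ?f ?S"
  proof (rule sum.cong[OF refl])
    fix Q assume Q: "Q \<in> ?S"
    from fibre[OF Q] obtain Q0 where Q0: "{y \<in> P. \<Phi> y = Q} = {Q0} \<times> {g \<in> cusp_reps. \<exists>k. mob g (bqf_root Q0) + of_int k = bqf_root Q}"
      "card {g \<in> cusp_reps. \<exists>k. mob g (bqf_root Q0) + of_int k = bqf_root Q} = bqf_weight Q0"
      "genus_character d Q0 = genus_character d Q" by blast
    have "h y = ?f Q / of_nat (bqf_weight Q0)" if "y \<in> {y \<in> P. \<Phi> y = Q}" for y
    proof -
      from that obtain g i where y: "y = (Q0, g)" "mob g (bqf_root Q0) + of_int i = bqf_root Q"
        unfolding Q0(1) by blast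
      have "e (- of_nat m * bqf_root Q) = e (- of_nat m * mob g (bqf_root Q0))"
        unfolding y(2)[symmetric] by (rule e_shift)
      then show ?thesis by (simp add: h_def y(1) Q0(3))
    qed
    then have "(\<Sum>y | y \<in> P \<and> \<Phi> y = Q. h y) = (\<Sum>y\<in>{y \<in> P. \<Phi> y = Q}. ?f Q / of_nat (bqf_weight Q0))"
      by (intro sum.cong) auto
    also have "\<dots> = of_nat (card {y \<in> P. \<Phi> y = Q}) * (?f Q / of_nat (bqf_weight Q0))" by simp
    also have "card {y \<in> P. \<Phi> y = Q} = bqf_weight Q0"
      unfolding Q0(1) card_cartesian_product Q0(2) by simp
    also have "of_nat (bqf_weight Q0) * (?f Q / of_nat (bqf_weight Q0)) = ?f Q" using w0[of Q0] by simp
    finally show "(\<Sum>y | y \<in> P \<and> \<Phi> y = Q. h y) = ?f Q" .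
  qed
  finally show ?thesis by (simp add: G_def)
qed

section \<open>Elementary bounds and the comparison with the stated error\<close>

lemma abs_kronecker_le: "\<bar>kronecker a n\<bar> \<le> 1"
proof -
  have "\<bar>kronecker_prime a p\<bar> \<le> 1" for p by (simp add: kronecker_prime_def Legendre_def)
  then have "(\<Prod>p\<in>prime_factors n. \<bar>kronecker_prime a p\<bar> ^ multiplicity p n) \<le> 1"
    by (intro prod_le_1) (auto intro: power_le_one)
  then show ?thesis by (simp add: kronecker_def abs_mult abs_prod power_abs)
qed

lemma abs_genus_character_le: "\<bar>genus_character d Q\<bar> \<le> 1"
  by (cases Q) (simp add: abs_kronecker_le)

lemma divisor_sigma_1_le: "m \<ge> 1 \<Longrightarrow> real (divisor_sigma 1 m) \<le> real m * real (tau (int m))"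
proof -
  assume m: "m \<ge> 1"
  have "divisor_sigma 1 m \<le> card {t. t dvd m} * m"
  proof -
    have "(\<Sum>t | t dvd m. t ^ 1) \<le> of_nat (card {t. t dvd m}) * m"
      by (rule sum_bounded_above) (use m in \<open>auto dest: dvd_imp_le\<close>)
    then show ?thesis by (simp add: divisor_sigma_def)
  qed
  also have "card {t. t dvd m} = tau (int m)" by (simp add: tau_def)
  finally have "real (divisor_sigma 1 m) \<le> real (tau (int m) * m)" by (simp only: of_nat_le_iff)
  then show ?thesis by (simp add: mult.commute)
qed

lemma tau_ge_1: "n \<noteq> 0 \<Longrightarrow> tau n \<ge> 1"
proof -
  assume n: "n \<noteq> 0"
  have "{k::nat. int k dvd n} \<subseteq> {..nat \<bar>n\<bar>}" by (auto dest: dvd_imp_le_int[OF n] simp: le_nat_iff)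
  then have "finite {k::nat. int k dvd n}" using finite_subset by blast
  moreover have "1 \<in> {k::nat. int k dvd n}" by simp
  ultimately show ?thesis unfolding tau_def by (metis One_nat_def Suc_leI card_gt_0_iff empty_iff)
qed

lemma zeta_ge_1: "s > 1 \<Longrightarrow> zeta s \<ge> 1"
proof -
  assume s: "s > 1"
  have "summable (\<lambda>n. real n powr (- s))" using s by (simp add: summable_real_powr_iff)
  then have "summable (\<lambda>n. real (Suc n) powr (- s))" by (subst summable_Suc_iff)
  then have su: "summable (\<lambda>n. 1 / real (Suc n) powr s)" by (simp only: powr_minus_divide)
  have "(\<Sum>n\<in>{0}. 1 / real (Suc n) powr s) \<le> zeta s"
    unfolding zeta_def by (rule sum_le_suminf[OF su]) auto
  then show ?thesis by simp
qed

text \<open>At most \<open>|D|\<close> reduced forms contribute \<open>20000 sigma_1(m)\<close>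
  each, as the coefficients have modulus at most \<open>1\<close>. The class number term, bounded
  trivially, contributes the remaining \<open>24\<close>.\<close>

lemma trace_jm_estimate:
  assumes D: "D < 0" and m: "m \<ge> 1"
  shows "cmod (trace_jm d m D
            + of_real (24 * (if d = 1 then 1 else 0) * real (divisor_sigma 1 m) * class_number D)
            - (\<Sum>Q | Q \<in> bqfs D \<and> bqf_root Q \<in> strip_above (1 / real m).
                 of_int (genus_character d Q) * e (- of_nat m * bqf_root Q)))
         \<le> 20024 * \<bar>of_int D\<bar> * real (divisor_sigma 1 m)"
proof -
  let ?R = "reduced_forms D" and ?\<sigma> = "real (divisor_sigma 1 m)"
  define A where "A Q = (\<Sum>g | g \<in> cusp_reps \<and> Im (mob g (bqf_root Q)) > 1 / real m. e (- of_nat m * mob g (bqf_root Q)))" for Q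
  let ?c = "\<lambda>Q. complex_of_int (genus_character d Q) / of_nat (bqf_weight Q)"
  have "trace_jm d m D - (\<Sum>Q | Q \<in> bqfs D \<and> bqf_root Q \<in> strip_above (1 / real m).
                 of_int (genus_character d Q) * e (- of_nat m * bqf_root Q))
        = (\<Sum>Q\<in>?R. ?c Q * (jm m (bqf_root Q) - A Q))"
    unfolding strip_sum[OF D m] trace_jm_def reduced_forms_def[symmetric] A_def
    by (simp only: sum_subtractf right_diff_distrib)
  moreover have "cmod (\<Sum>Q\<in>?R. ?c Q * (jm m (bqf_root Q) - A Q)) \<le> (\<Sum>Q\<in>?R. 20000 * ?\<sigma>)"
  proof (rule sum_norm_le)
    fix Q assume Q: "Q \<in> ?R"
    then have "Im (bqf_root Q) > 0" using fund_domain_Im(2) by (auto simp: reduced_forms_def)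
    then have a: "cmod (jm m (bqf_root Q) - A Q) \<le> 20000 * ?\<sigma>" unfolding A_def by (rule jm_approximation[OF m])
    have "\<bar>real_of_int (genus_character d Q)\<bar> \<le> 1" using abs_genus_character_le[of d Q] by linarith
    moreover have "real (bqf_weight Q) \<ge> 1" by (simp add: bqf_weight_def)
    ultimately have "cmod (?c Q) \<le> 1" by (simp add: norm_divide divide_le_eq)
    then have "cmod (?c Q) * cmod (jm m (bqf_root Q) - A Q) \<le> 1 * (20000 * ?\<sigma>)" using a by (intro mult_mono) auto
    then show "cmod (?c Q * (jm m (bqf_root Q) - A Q)) \<le> 20000 * ?\<sigma>" by (simp only: norm_mult mult_1)
  qed
  moreover have "(\<Sum>Q\<in>?R. 20000 * ?\<sigma>) \<le> 20000 * \<bar>of_int D\<bar> * ?\<sigma>"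
    using mult_right_mono[OF card_reduced_forms(2)[OF D], of "20000 * ?\<sigma>"] by simp
  moreover have "cmod (of_real (24 * (if d = 1 then 1 else 0) * ?\<sigma> * class_number D)) \<le> 24 * \<bar>of_int D\<bar> * ?\<sigma>"
  proof -
    have h: "class_number D \<le> \<bar>of_int D\<bar>" "class_number D \<ge> 0"
      using class_number_le[OF D] card_reduced_forms(2)[OF D] by linarith+
    have "cmod (of_real (24 * (if d = 1 then 1 else 0) * ?\<sigma> * class_number D))
        = 24 * (if d = 1 then 1 else 0) * ?\<sigma> * class_number D"
      using h by (simp add: norm_mult)
    also have "\<dots> \<le> 24 * 1 * ?\<sigma> * \<bar>of_int D\<bar>" using h by (intro mult_mono) auto
    finally show ?thesis by (simp add: mult_ac)
  qed
  ultimately show ?thesis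
    by (smt (verit) add_diff_eq diff_add_eq distrib_right mult.assoc norm_triangle_ineq)
qed

theorem theorem1p3:
  fixes D d d' :: int and m :: nat and \<delta> l :: real
  assumes "D < 0" and "is_discriminant D"
    and "fundamental_discriminant d" and "is_discriminant d'" and "D = d * d'"
    and "m \<ge> 1"
    and "0 < \<delta>" and "\<delta> \<le> 1/4"
    and "\<And>c::nat. c \<ge> 1 \<Longrightarrow> real (tau (int c)) \<le> l * real c powr \<delta>"
  shows "cmod (trace_jm d m D
            + of_real (24 * (if d = 1 then 1 else 0) * real (divisor_sigma 1 m) * class_number D)
            - (\<Sum>Q | Q \<in> bqfs D \<and> bqf_root Q \<in> strip_above (1 / real m).
                 of_int (genus_character d Q) * e (- of_nat m * bqf_root Q)))
         \<le> \<bar>real_of_int D\<bar> powr (13/12 + \<delta>/2) * real m powr (7/6 + \<delta>)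
            * real (tau D) * real (tau (int m)) * (zeta (1 + \<delta>))\<^sup>2 * l
            * ln (2 * real m * \<bar>real_of_int D\<bar> powr (1/2)) * \<bar>ln \<delta>\<bar>
            * (if d < 0 then 8.5 * 10^6 else 2 * 10^6 * real m)"
proof -
  let ?B = "\<bar>real_of_int D\<bar>" and ?C = "if d < 0 then 8.5 * 10^6 else 2 * 10^6 * real m"
  have B: "?B \<ge> 1" using assms(1) by simp
  have m1: "real m \<ge> 1" using assms(6) by simp
  have "?B powr 1 \<le> ?B powr (13/12 + \<delta>/2)" using B assms(7) by (intro powr_mono) auto
  then have 1: "?B \<le> ?B powr (13/12 + \<delta>/2)" using B by simp
  have "real m powr 1 \<le> real m powr (7/6 + \<delta>)" using m1 assms(7) by (intro powr_mono) auto
  then have 2: "real m \<le> real m powr (7/6 + \<delta>)" using m1 by simp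
  have 3: "1 \<le> real (tau D)" using tau_ge_1[of D] assms(1) by simp
  have 4: "1 \<le> (zeta (1 + \<delta>))\<^sup>2" using zeta_ge_1[of "1 + \<delta>"] assms(7) by (simp add: one_le_power)
  \<comment> \<open>The divisor bound at \<open>c = 1\<close>.\<close>
  have 5: "1 \<le> l" using assms(9)[of 1] tau_ge_1[of 1] by simp
  have "1 * 1 \<le> real m * ?B powr (1/2)" using m1 ge_one_powr_ge_zero[OF B, of "1/2"] by (intro mult_mono) auto
  then have "ln 2 \<le> ln (2 * real m * ?B powr (1/2))" by (intro ln_mono) auto
  then have 6: "1/2 \<le> ln (2 * real m * ?B powr (1/2))" using ln2_ge_two_thirds by simp
  have "ln \<delta> \<le> ln (1/4)" using assms(7,8) by (intro ln_mono) auto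
  also have "ln (1/4 :: real) = - 2 * ln 2" using ln_realpow[of 2 2] by (simp add: ln_div)
  finally have 7: "1 \<le> \<bar>ln \<delta>\<bar>" using ln2_ge_two_thirds by simp
  \<comment> \<open>The smaller of the two constants, attained for \<open>d >= 0\<close> and
    \<open>m = 1\<close>.\<close>
  have 8: "2000000 \<le> ?C" using m1 by simp
  have "20024 * ?B * real (divisor_sigma 1 m) \<le> 20024 * ?B * (real m * real (tau (int m)))"
    by (intro mult_left_mono divisor_sigma_1_le assms) simp
  \<comment> \<open>The factors are lined up with those of the claim, each replaced by its lower
    bound; numerically \<open>20024 <= 1/2 * 2000000\<close>.\<close>
  also have "\<dots> \<le> ?B * real m * 1 * real (tau (int m)) * 1 * 1 * (1/2) * 1 * 2000000"
    by (simp add: mult_right_mono mult_ac)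
  also have "\<dots> \<le> ?B powr (13/12 + \<delta>/2) * real m powr (7/6 + \<delta>)
            * real (tau D) * real (tau (int m)) * (zeta (1 + \<delta>))\<^sup>2 * l
            * ln (2 * real m * ?B powr (1/2)) * \<bar>ln \<delta>\<bar> * ?C"
    using 1 2 3 4 5 6 7 8 by (intro mult_mono) auto
  finally show ?thesis
    using trace_jm_estimate[OF assms(1,6), of d] by linarith
qed

end
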